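(* Let $\mathcal A$ be a unital $C^*$-algebra and let $\mathcal B$ be a von Neumann algebra or an injective $C^*$-algebra. Let $\phi_1,\phi_2\in\mathrm{UCP}(\mathcal A,\mathcal B)$. Then there is a joint representation tuple $(\mathcal E,\sigma_1,\sigma_2,x)$ for $\phi_1$ and $\phi_2$ such that $$\gamma(\phi_1,\phi_2)=\|\sigma_1-\sigma_2\|_{cb}.$$
   Context: A von Neumann algebra means a strongly closed $C^*$-subalgebra of $\mathbb B(G)$ for some Hilbert space $G$, with unit the identity of $G$. $\mathrm{UCP}(\mathcal A,\mathcal B)$ is the set of unital completely positive maps $\mathcal A\to\mathcal B$. For a Hilbert (right) $\mathcal B$-module $\mathcal E$, $\mathbf B^a(\mathcal E)$ is the $C^*$-algebra of bounded adjointable maps on $\mathcal E$; inner products are linear in the second variable. A joint representation tuple for $\phi_1,\phi_2$ is $(\mathcal E,\sigma_1,\sigma_2,x)$ with $\mathcal E$ a Hilbert $\mathcal B$-module, $\sigma_1,\sigma_2:\mathcal A\to\mathbf B^a(\mathcal E)$ unital $*$-homomorphisms, and $x\in\mathcal E$ with $\langle x,x\rangle=1$ such that $\phi_i(a)=\langle x,\sigma_i(a)x\rangle$ for all $a\in\mathcal A$, $i=1,2$. Define $\gamma(\phi_1,\phi_2)=\inf\|\sigma_1-\sigma_2\|_{cb}$ over all joint representation tuples, where $\|\cdot\|_{cb}$ is the completely bounded norm. *)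

theory Defs
  imports
    "HOL-Analysis.Analysis"
    "HOL-Algebra.Ring"
    "HOL-Library.Function_Algebras"
begin

section \<open>Complex Banach spaces, unital C*-algebras, Hilbert spaces\<close>

class complex_banach = banach +
  fixes scaleC :: "complex \<Rightarrow> 'a \<Rightarrow> 'a"  (infixr \<open>*\<^sub>C\<close> 75)
  assumes scaleC_add_right: "c *\<^sub>C (x + y) = c *\<^sub>C x + c *\<^sub>C y"
    and scaleC_add_left: "(c + d) *\<^sub>C x = c *\<^sub>C x + d *\<^sub>C x"
    and scaleC_scaleC: "c *\<^sub>C (d *\<^sub>C x) = (c * d) *\<^sub>C x"
    and scaleC_of_real: "complex_of_real r *\<^sub>C x = r *\<^sub>R x"
    and norm_scaleC: "norm (c *\<^sub>C x) = cmod c * norm x"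

text \<open>
  As usual for types of class \<open>real_normed_algebra_1\<close>, unital C*-algebras are nonzero.
\<close>

class unital_cstar_algebra = real_normed_algebra_1 + complex_banach +
  fixes star :: "'a \<Rightarrow> 'a"
  assumes mult_scaleC_left: "(c *\<^sub>C x) * y = c *\<^sub>C (x * y)"
    and mult_scaleC_right: "x * (c *\<^sub>C y) = c *\<^sub>C (x * y)"
    and star_add: "star (x + y) = star x + star y"
    and star_scaleC: "star (c *\<^sub>C x) = cnj c *\<^sub>C star x"
    and star_mult: "star (x * y) = star y * star x"
    and star_star: "star (star x) = x"
    and cstar_identity: "norm (star x * x) = (norm x)\<^sup>2"

class complex_hilbert_space = complex_banach +
  fixes cinner :: "'a \<Rightarrow> 'a \<Rightarrow> complex"
  assumes cinner_add_right: "cinner x (y + z) = cinner x y + cinner x z"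
    and cinner_scaleC_right: "cinner x (c *\<^sub>C y) = c * cinner x y"
    and cinner_commute: "cinner y x = cnj (cinner x y)"
    and cinner_self: "cinner x x = complex_of_real ((norm x)\<^sup>2)"


section \<open>Unital completely positive maps\<close>

text \<open>
  An \<open>n \<times> n\<close> matrix is a function of two indices, of which only the entries with indices
  below \<open>n\<close> matter. A positive element of \<open>M\<^sub>n(A)\<close> is one of the form \<open>Y\<^sup>* Y\<close>.
\<close>

definition mat_positive :: "nat \<Rightarrow> (nat \<Rightarrow> nat \<Rightarrow> 'a::unital_cstar_algebra) \<Rightarrow> bool" where
  "mat_positive n X \<longleftrightarrow>
     (\<exists>Y. \<forall>i<n. \<forall>j<n. X i j = (\<Sum>k<n. star (Y k i) * Y k j))"

definition UCP :: "('a::unital_cstar_algebra \<Rightarrow> 'b::unital_cstar_algebra) set" where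
  "UCP = {\<phi>. (\<forall>a b. \<phi> (a + b) = \<phi> a + \<phi> b) \<and> (\<forall>c a. \<phi> (c *\<^sub>C a) = c *\<^sub>C \<phi> a) \<and> \<phi> 1 = 1 \<and>
     (\<forall>n X. mat_positive n X \<longrightarrow> mat_positive n (\<lambda>i j. \<phi> (X i j)))}"


section \<open>Von Neumann algebras\<close>

definition bounded_clinear_op :: "('g::complex_hilbert_space \<Rightarrow> 'g) \<Rightarrow> bool" where
  "bounded_clinear_op T \<longleftrightarrow> bounded_linear T \<and> (\<forall>c x. T (c *\<^sub>C x) = c *\<^sub>C T x)"

definition strongly_closed :: "('g::complex_hilbert_space \<Rightarrow> 'g) set \<Rightarrow> bool" where
  "strongly_closed M \<longleftrightarrow>
     (\<forall>T. bounded_clinear_op T \<and>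
          (\<forall>F e. finite F \<and> e > 0 \<longrightarrow> (\<exists>S\<in>M. \<forall>\<xi>\<in>F. norm (S \<xi> - T \<xi>) < e))
        \<longrightarrow> T \<in> M)"

text \<open>
  \<open>\<pi>\<close> identifies the C*-algebra \<open>'b\<close> (with its operations, involution, unit and norm) with a
  C*-subalgebra of \<open>\<bbbB>(G)\<close> that contains the identity of \<open>G\<close>.
\<close>

definition isometric_unital_rep ::
    "('b::unital_cstar_algebra \<Rightarrow> 'g::complex_hilbert_space \<Rightarrow> 'g) \<Rightarrow> bool" where
  "isometric_unital_rep \<pi> \<longleftrightarrow>
     (\<forall>b. bounded_clinear_op (\<pi> b)) \<and>
     (\<forall>b c x. \<pi> (b + c) x = \<pi> b x + \<pi> c x) \<and>
     (\<forall>z b x. \<pi> (z *\<^sub>C b) x = z *\<^sub>C \<pi> b x) \<and>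
     (\<forall>b c x. \<pi> (b * c) x = \<pi> b (\<pi> c x)) \<and>
     (\<forall>x. \<pi> 1 x = x) \<and>
     (\<forall>b x y. cinner (\<pi> (star b) x) y = cinner x (\<pi> b y)) \<and>
     (\<forall>b. onorm (\<pi> b) = norm b)"

definition von_neumann_algebra_on ::
    "'g::complex_hilbert_space itself \<Rightarrow> 'b::unital_cstar_algebra itself \<Rightarrow> bool" where
  "von_neumann_algebra_on _ _ \<longleftrightarrow>
     (\<exists>\<pi> :: 'b \<Rightarrow> 'g \<Rightarrow> 'g. isometric_unital_rep \<pi> \<and> strongly_closed (range \<pi>))"


section \<open>Injective C*-algebras\<close>

text \<open>
  Injectivity quantifies over C*-algebras, so these are needed as objects and not only as
  types: a C*-algebra is here a ring in the sense of HOL-Algebra with additional structure.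
\<close>

record 'd cstar_struct = "'d ring" +
  cs_scale :: "complex \<Rightarrow> 'd \<Rightarrow> 'd"
  cs_star :: "'d \<Rightarrow> 'd"
  cs_norm :: "'d \<Rightarrow> real"

definition cstar_structure :: "'d cstar_struct \<Rightarrow> bool" where
  "cstar_structure D \<longleftrightarrow>
     ring D \<and>
     (\<forall>c. \<forall>x\<in>carrier D. cs_scale D c x \<in> carrier D) \<and>
     (\<forall>c. \<forall>x\<in>carrier D. \<forall>y\<in>carrier D.
        cs_scale D c (x \<oplus>\<^bsub>D\<^esub> y) = cs_scale D c x \<oplus>\<^bsub>D\<^esub> cs_scale D c y) \<and>
     (\<forall>c d. \<forall>x\<in>carrier D. cs_scale D (c + d) x = cs_scale D c x \<oplus>\<^bsub>D\<^esub> cs_scale D d x) \<and>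
     (\<forall>c d. \<forall>x\<in>carrier D. cs_scale D c (cs_scale D d x) = cs_scale D (c * d) x) \<and>
     (\<forall>x\<in>carrier D. cs_scale D 1 x = x) \<and>
     (\<forall>c. \<forall>x\<in>carrier D. \<forall>y\<in>carrier D.
        cs_scale D c x \<otimes>\<^bsub>D\<^esub> y = cs_scale D c (x \<otimes>\<^bsub>D\<^esub> y) \<and>
        x \<otimes>\<^bsub>D\<^esub> cs_scale D c y = cs_scale D c (x \<otimes>\<^bsub>D\<^esub> y)) \<and>
     (\<forall>x\<in>carrier D. cs_star D x \<in> carrier D \<and> cs_star D (cs_star D x) = x) \<and>
     (\<forall>x\<in>carrier D. \<forall>y\<in>carrier D.
        cs_star D (x \<oplus>\<^bsub>D\<^esub> y) = cs_star D x \<oplus>\<^bsub>D\<^esub> cs_star D y \<and>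
        cs_star D (x \<otimes>\<^bsub>D\<^esub> y) = cs_star D y \<otimes>\<^bsub>D\<^esub> cs_star D x) \<and>
     (\<forall>c. \<forall>x\<in>carrier D. cs_star D (cs_scale D c x) = cs_scale D (cnj c) (cs_star D x)) \<and>
     (\<forall>x\<in>carrier D. 0 \<le> cs_norm D x \<and> (cs_norm D x = 0 \<longleftrightarrow> x = \<zero>\<^bsub>D\<^esub>)) \<and>
     (\<forall>c. \<forall>x\<in>carrier D. cs_norm D (cs_scale D c x) = cmod c * cs_norm D x) \<and>
     (\<forall>x\<in>carrier D. \<forall>y\<in>carrier D.
        cs_norm D (x \<oplus>\<^bsub>D\<^esub> y) \<le> cs_norm D x + cs_norm D y \<and>
        cs_norm D (x \<otimes>\<^bsub>D\<^esub> y) \<le> cs_norm D x * cs_norm D y) \<and>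
     (\<forall>x\<in>carrier D. cs_norm D (cs_star D x \<otimes>\<^bsub>D\<^esub> x) = (cs_norm D x)\<^sup>2) \<and>
     (\<forall>s. (\<forall>n. s n \<in> carrier D) \<and>
          (\<forall>e>0. \<exists>N::nat. \<forall>m\<ge>N. \<forall>n\<ge>N. cs_norm D (s m \<ominus>\<^bsub>D\<^esub> s n) < e)
        \<longrightarrow> (\<exists>l\<in>carrier D. (\<lambda>n. cs_norm D (s n \<ominus>\<^bsub>D\<^esub> l)) \<longlonglongrightarrow> 0))"

definition mat_positive_in :: "'d cstar_struct \<Rightarrow> nat \<Rightarrow> (nat \<Rightarrow> nat \<Rightarrow> 'd) \<Rightarrow> bool" where
  "mat_positive_in D n X \<longleftrightarrow>
     (\<exists>Y. (\<forall>k<n. \<forall>i<n. Y k i \<in> carrier D) \<and>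
          (\<forall>i<n. \<forall>j<n. X i j = (\<Oplus>\<^bsub>D\<^esub>k\<in>{..<n}. cs_star D (Y k i) \<otimes>\<^bsub>D\<^esub> Y k j)))"

definition operator_system :: "'d cstar_struct \<Rightarrow> 'd set \<Rightarrow> bool" where
  "operator_system D S \<longleftrightarrow>
     S \<subseteq> carrier D \<and> \<one>\<^bsub>D\<^esub> \<in> S \<and>
     (\<forall>x\<in>S. \<forall>y\<in>S. x \<oplus>\<^bsub>D\<^esub> y \<in> S) \<and> (\<forall>c. \<forall>x\<in>S. cs_scale D c x \<in> S) \<and>
     (\<forall>x\<in>S. cs_star D x \<in> S)"

definition cp_on :: "'d cstar_struct \<Rightarrow> 'd set \<Rightarrow> ('d \<Rightarrow> 'b::unital_cstar_algebra) \<Rightarrow> bool" where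
  "cp_on D S \<psi> \<longleftrightarrow>
     (\<forall>x\<in>S. \<forall>y\<in>S. \<psi> (x \<oplus>\<^bsub>D\<^esub> y) = \<psi> x + \<psi> y) \<and>
     (\<forall>c. \<forall>x\<in>S. \<psi> (cs_scale D c x) = c *\<^sub>C \<psi> x) \<and>
     (\<forall>n X. (\<forall>i<n. \<forall>j<n. X i j \<in> S) \<and> mat_positive_in D n X
        \<longrightarrow> mat_positive n (\<lambda>i j. \<psi> (X i j)))"

definition injective_over :: "'d itself \<Rightarrow> 'b::unital_cstar_algebra itself \<Rightarrow> bool" where
  "injective_over _ _ \<longleftrightarrow>
     (\<forall>(D :: 'd cstar_struct) S (\<psi> :: 'd \<Rightarrow> 'b).
        cstar_structure D \<and> operator_system D S \<and> cp_on D S \<psi>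
        \<longrightarrow> (\<exists>\<Psi>. cp_on D (carrier D) \<Psi> \<and> (\<forall>s\<in>S. \<Psi> s = \<psi> s)))"

text \<open>
  A formula cannot quantify over types, so the ambient C*-algebras \<open>D\<close> are restricted to
  those carried by a subset of \<open>'b \<Rightarrow> 'b\<close>. This is no loss. Writing \<open>\<kappa>\<close> for the cardinality of
  \<open>'b\<close>, a family of \<open>\<kappa>\<close> states is enough to represent \<open>'b\<close> faithfully on a Hilbert space \<open>H\<close> of
  dimension at most \<open>\<kappa>\<close>; then \<open>\<bbbB>(H)\<close> has at most \<open>2\<^sup>\<kappa>\<close> elements and so does occur as a \<open>D\<close>.
  The identity of \<open>'b\<close> thus extends to a completely positive map \<open>\<bbbB>(H) \<Rightarrow> 'b\<close>, and injectivity
  with respect to all C*-algebras follows from that of \<open>\<bbbB>(H)\<close> (Arveson).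
\<close>

definition injective_cstar_algebra :: "'b::unital_cstar_algebra itself \<Rightarrow> bool" where
  "injective_cstar_algebra B \<longleftrightarrow> injective_over TYPE('b \<Rightarrow> 'b) B"


section \<open>Hilbert modules and adjointable maps\<close>

text \<open>
  A Hilbert module is carried by a subgroup of an abelian group. Complex multiples are not a
  separate part of the structure: over a unital algebra they are given by the action of the
  multiples of the unit.
\<close>

record ('b, 'e) hmodule =
  mcarrier :: "'e set"
  act :: "'e \<Rightarrow> 'b \<Rightarrow> 'e"
  ip :: "'e \<Rightarrow> 'e \<Rightarrow> 'b"

definition mscale ::
    "('b::unital_cstar_algebra, 'e::ab_group_add) hmodule \<Rightarrow> complex \<Rightarrow> 'e \<Rightarrow> 'e" where
  "mscale E c x = act E x (c *\<^sub>C 1)"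

definition mnorm ::
    "('b::unital_cstar_algebra, 'e::ab_group_add) hmodule \<Rightarrow> 'e \<Rightarrow> real" where
  "mnorm E x = sqrt (norm (ip E x x))"

definition hilbert_module ::
    "('b::unital_cstar_algebra, 'e::ab_group_add) hmodule \<Rightarrow> bool" where
  "hilbert_module E \<longleftrightarrow>
     0 \<in> mcarrier E \<and>
     (\<forall>x\<in>mcarrier E. \<forall>y\<in>mcarrier E. x + y \<in> mcarrier E) \<and>
     (\<forall>x\<in>mcarrier E. - x \<in> mcarrier E) \<and>
     (\<forall>x\<in>mcarrier E. \<forall>b. act E x b \<in> mcarrier E) \<and>
     (\<forall>x\<in>mcarrier E. \<forall>y\<in>mcarrier E. \<forall>b. act E (x + y) b = act E x b + act E y b) \<and>
     (\<forall>x\<in>mcarrier E. \<forall>b c. act E x (b + c) = act E x b + act E x c) \<and>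
     (\<forall>x\<in>mcarrier E. \<forall>b c. act E x (b * c) = act E (act E x b) c) \<and>
     (\<forall>x\<in>mcarrier E. act E x 1 = x) \<and>
     (\<forall>x\<in>mcarrier E. \<forall>y\<in>mcarrier E. \<forall>z\<in>mcarrier E. ip E x (y + z) = ip E x y + ip E x z) \<and>
     (\<forall>x\<in>mcarrier E. \<forall>y\<in>mcarrier E. \<forall>b. ip E x (act E y b) = ip E x y * b) \<and>
     (\<forall>x\<in>mcarrier E. \<forall>y\<in>mcarrier E. ip E y x = star (ip E x y)) \<and>
     (\<forall>x\<in>mcarrier E. \<exists>b. ip E x x = star b * b) \<and>
     (\<forall>x\<in>mcarrier E. ip E x x = 0 \<longrightarrow> x = 0) \<and>
     (\<forall>s. (\<forall>n. s n \<in> mcarrier E) \<and>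
          (\<forall>e>0. \<exists>N::nat. \<forall>m\<ge>N. \<forall>n\<ge>N. mnorm E (s m - s n) < e)
        \<longrightarrow> (\<exists>l\<in>mcarrier E. (\<lambda>n. mnorm E (s n - l)) \<longlonglongrightarrow> 0))"

definition adjointable ::
    "('b::unital_cstar_algebra, 'e::ab_group_add) hmodule \<Rightarrow> ('e \<Rightarrow> 'e) \<Rightarrow> bool" where
  "adjointable E T \<longleftrightarrow>
     (\<forall>x\<in>mcarrier E. T x \<in> mcarrier E) \<and>
     (\<exists>S. (\<forall>x\<in>mcarrier E. S x \<in> mcarrier E) \<and>
          (\<forall>x\<in>mcarrier E. \<forall>y\<in>mcarrier E. ip E (T x) y = ip E x (S y))) \<and>
     (\<exists>K. \<forall>x\<in>mcarrier E. mnorm E (T x) \<le> K * mnorm E x)"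

text \<open>Maps on \<open>E\<close> are identified when they agree on the carrier.\<close>

definition unital_star_hom ::
    "('b::unital_cstar_algebra, 'e::ab_group_add) hmodule \<Rightarrow>
     ('a::unital_cstar_algebra \<Rightarrow> 'e \<Rightarrow> 'e) \<Rightarrow> bool" where
  "unital_star_hom E \<sigma> \<longleftrightarrow>
     (\<forall>a. adjointable E (\<sigma> a)) \<and>
     (\<forall>a b. \<forall>x\<in>mcarrier E. \<sigma> (a + b) x = \<sigma> a x + \<sigma> b x) \<and>
     (\<forall>c a. \<forall>x\<in>mcarrier E. \<sigma> (c *\<^sub>C a) x = mscale E c (\<sigma> a x)) \<and>
     (\<forall>a b. \<forall>x\<in>mcarrier E. \<sigma> (a * b) x = \<sigma> a (\<sigma> b x)) \<and>
     (\<forall>x\<in>mcarrier E. \<sigma> 1 x = x) \<and>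
     (\<forall>a. \<forall>x\<in>mcarrier E. \<forall>y\<in>mcarrier E. ip E (\<sigma> (star a) x) y = ip E x (\<sigma> a y))"


section \<open>The completely bounded norm\<close>

text \<open>
  \<open>M\<^sub>n(\<^bold>B\<^sup>a(E))\<close> has the C*-norm of \<open>\<^bold>B\<^sup>a(E\<^sup>n)\<close>, where
  \<open>E\<^sup>n\<close> carries the inner product \<open>\<Sum>i<n. \<langle>v i, w i\<rangle>\<close>. The C*-norm of \<open>M\<^sub>n(A)\<close> is the special case
  \<open>E = A\<close>, since \<open>A = \<^bold>B\<^sup>a(A)\<close> acting by left multiplication.
\<close>

definition tuple_norm ::
    "('b::unital_cstar_algebra, 'e::ab_group_add) hmodule \<Rightarrow> nat \<Rightarrow> (nat \<Rightarrow> 'e) \<Rightarrow> real" where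
  "tuple_norm E n v = sqrt (norm (\<Sum>i<n. ip E (v i) (v i)))"

definition mat_op_norm ::
    "('b::unital_cstar_algebra, 'e::ab_group_add) hmodule \<Rightarrow> nat \<Rightarrow>
     (nat \<Rightarrow> nat \<Rightarrow> 'e \<Rightarrow> 'e) \<Rightarrow> ennreal" where
  "mat_op_norm E n T =
     (SUP v\<in>{v. (\<forall>i<n. v i \<in> mcarrier E) \<and> tuple_norm E n v \<le> 1}.
        ennreal (tuple_norm E n (\<lambda>i. \<Sum>j<n. T i j (v j))))"

definition self_module :: "('a::unital_cstar_algebra, 'a) hmodule" where
  "self_module = \<lparr>mcarrier = UNIV, act = (*), ip = (\<lambda>x y. star x * y)\<rparr>"

definition mat_norm :: "nat \<Rightarrow> (nat \<Rightarrow> nat \<Rightarrow> 'a::unital_cstar_algebra) \<Rightarrow> ennreal" where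
  "mat_norm n X = mat_op_norm self_module n (\<lambda>i j. (*) (X i j))"

definition cb_norm ::
    "('b::unital_cstar_algebra, 'e::ab_group_add) hmodule \<Rightarrow>
     ('a::unital_cstar_algebra \<Rightarrow> 'e \<Rightarrow> 'e) \<Rightarrow> ennreal" where
  "cb_norm E \<psi> =
     (SUP n. SUP X\<in>{X. mat_norm n X \<le> 1}. mat_op_norm E n (\<lambda>i j. \<psi> (X i j)))"


section \<open>Joint representation tuples\<close>

definition joint_rep ::
    "('a::unital_cstar_algebra \<Rightarrow> 'b::unital_cstar_algebra) \<Rightarrow> ('a \<Rightarrow> 'b) \<Rightarrow>
     ('b, 'e::ab_group_add) hmodule \<Rightarrow> ('a \<Rightarrow> 'e \<Rightarrow> 'e) \<Rightarrow> ('a \<Rightarrow> 'e \<Rightarrow> 'e) \<Rightarrow> 'e \<Rightarrow> bool" where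
  "joint_rep \<phi>1 \<phi>2 E \<sigma>1 \<sigma>2 x \<longleftrightarrow>
     hilbert_module E \<and> unital_star_hom E \<sigma>1 \<and> unital_star_hom E \<sigma>2 \<and>
     x \<in> mcarrier E \<and> ip E x x = 1 \<and>
     (\<forall>a. \<phi>1 a = ip E x (\<sigma>1 a x)) \<and> (\<forall>a. \<phi>2 a = ip E x (\<sigma>2 a x))"

definition gamma_over ::
    "'e::ab_group_add itself \<Rightarrow> ('a::unital_cstar_algebra \<Rightarrow> 'b::unital_cstar_algebra) \<Rightarrow>
     ('a \<Rightarrow> 'b) \<Rightarrow> ennreal" where
  "gamma_over _ \<phi>1 \<phi>2 =
     Inf {cb_norm E (\<lambda>a v. \<sigma>1 a v - \<sigma>2 a v) | (E :: ('b, 'e) hmodule) \<sigma>1 \<sigma>2 x.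
            joint_rep \<phi>1 \<phi>2 E \<sigma>1 \<sigma>2 x}"

text \<open>
  The modules are taken inside one fixed type that is large enough for the infimum over all
  modules. Restricting \<open>\<sigma>1\<close> and \<open>\<sigma>2\<close> to the closed submodule generated by the vectors
  \<open>w x\<close>, for \<open>w\<close> a product of operators \<open>\<sigma>1 a\<close> and \<open>\<sigma>2 a\<close> (encoded as a list over \<open>'a + 'a\<close>), does
  not increase the cb-norm, and that submodule embeds into the functions \<open>('a + 'a) list \<Rightarrow> 'b\<close>
  by \<open>y \<mapsto> (\<lambda>w. \<langle>w x, y\<rangle>)\<close>.
\<close>

type_synonym ('a, 'b) rep_space = "('a + 'a) list \<Rightarrow> 'b"

definition gamma ::
    "('a::unital_cstar_algebra \<Rightarrow> 'b::unital_cstar_algebra) \<Rightarrow> ('a \<Rightarrow> 'b) \<Rightarrow> ennreal" where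
  "gamma \<phi>1 \<phi>2 = gamma_over TYPE(('a, 'b) rep_space) \<phi>1 \<phi>2"

end

theory Submission
  imports Defs
begin

text \<open>
  A joint representation tuple is determined, up to its restriction to the submodule generated by \<open>x\<close>,
  by the \<open>'b\<close>-valued kernel \<open>K w w' = \<langle>w x, w' x\<rangle>\<close> on words \<open>w\<close>, \<open>w'\<close> in the operators \<open>\<sigma>1 a\<close>,
  \<open>\<sigma>2 a\<close>; conversely a positive kernel with the evident relations yields a tuple on a Hilbert module of
  functions. The bound \<open>\<parallel>\<sigma>1 - \<sigma>2\<parallel>\<^sub>c\<^sub>b \<le> c\<close> says that certain kernels, depending linearly on \<open>K\<close>, are
  positive. Hence the infimum is attained as soon as the kernels of a minimising sequence can be
  averaged by a linear map \<open>\<Psi>\<close> from bounded sequences in \<open>'b\<close> to \<open>'b\<close> that fixes constants, preserves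
  positivity of matrices and ignores finitely many terms. For a von Neumann algebra, \<open>\<Psi>\<close> is the weak
  operator limit along an ultrafilter. For an injective algebra, it is a completely positive extension of
  the eventual value from the eventually constant sequences to the C*-algebra of all bounded ones.
\<close>

section \<open>Positivity in unital C*-algebras\<close>

lemma star_zero: "star (0::'a::unital_cstar_algebra) = 0"
  by (metis add_cancel_right_right star_add)

lemma star_minus: "star (- x :: 'a::unital_cstar_algebra) = - star x"
  by (metis add.right_inverse add_eq_0_iff star_add star_zero)

lemma star_diff: "star (x - y :: 'a::unital_cstar_algebra) = star x - star y"
  by (metis diff_conv_add_uminus star_add star_minus)

lemma star_one: "star (1::'a::unital_cstar_algebra) = 1"
  by (metis mult.right_neutral star_mult star_star)

lemma star_scaleR: "star (r *\<^sub>R x :: 'a::unital_cstar_algebra) = r *\<^sub>R star x"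
  by (metis complex_cnj_complex_of_real scaleC_of_real star_scaleC)

lemma star_sum: "star (\<Sum>i\<in>I. f i :: 'a::unital_cstar_algebra) = (\<Sum>i\<in>I. star (f i))"
  by (induction I rule: infinite_finite_induct) (auto simp: star_zero star_add)

lemma norm_star: "norm (star x :: 'a::unital_cstar_algebra) = norm x"
proof -
  have le: "norm y \<le> norm (star y)" for y :: 'a
  proof (cases "norm y = 0")
    case False
    have "norm y * norm y \<le> norm (star y) * norm y"
      by (metis cstar_identity norm_mult_ineq power2_eq_square)
    then show ?thesis using False by simp
  qed auto
  show ?thesis using le[of x] le[of "star x"] by (simp add: star_star)
qed

lemma bounded_linear_star: "bounded_linear (star :: 'a::unital_cstar_algebra \<Rightarrow> 'a)"
  by (rule bounded_linear_intro[of _ 1]) (auto simp: star_add star_scaleR norm_star)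

lemmas star_simps = star_zero star_minus star_diff star_one star_scaleR star_add star_mult
  star_star star_scaleC

lemma scaleC_one [simp]: "(1::complex) *\<^sub>C x = x"
  using scaleC_of_real[of 1 x] by simp

lemma scaleC_zero [simp]: "(0::complex) *\<^sub>C x = 0"
  using scaleC_of_real[of 0 x] by simp

lemma scaleC_minus1: "(-1::complex) *\<^sub>C x = - x"
  using scaleC_of_real[of "-1" x] by simp

lemma scaleC_minus_left: "(- c) *\<^sub>C x = - (c *\<^sub>C x)"
  by (metis mult_minus1 scaleC_minus1 scaleC_scaleC)

lemma scaleC_zero_right [simp]: "c *\<^sub>C (0::'a::complex_banach) = 0"
  by (metis add_cancel_right_right scaleC_add_right)

lemma scaleC_minus_right: "c *\<^sub>C (- x) = - (c *\<^sub>C x)"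
  by (metis mult.commute scaleC_minus1 scaleC_scaleC)

lemma scaleC_diff_right: "c *\<^sub>C (x - y) = c *\<^sub>C x - c *\<^sub>C y"
  by (metis diff_conv_add_uminus scaleC_add_right scaleC_minus_right)

lemma scaleC_scaleR: "c *\<^sub>C (r *\<^sub>R x) = r *\<^sub>R (c *\<^sub>C x)"
  by (metis mult.commute scaleC_of_real scaleC_scaleC)

lemma scaleC_conv_mult: "c *\<^sub>C (x::'a::unital_cstar_algebra) = x * (c *\<^sub>C 1)"
  by (simp add: mult_scaleC_right)

text \<open>The iterates converge to the solution \<open>g = 1 - sqrt (1 - x)\<close> of \<open>2 g = x + g\<^sup>2\<close>;
  their increments are dominated by those for \<open>x = 1\<close> in the reals.\<close>

primrec sqrt_iter :: "'a::real_normed_algebra_1 \<Rightarrow> nat \<Rightarrow> 'a" where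
  "sqrt_iter x 0 = 0"
| "sqrt_iter x (Suc n) = (1/2) *\<^sub>R (x + sqrt_iter x n * sqrt_iter x n)"

lemma sqrt_iter_commute:
  assumes "y * x = x * y"
  shows "y * sqrt_iter x n = sqrt_iter x n * y"
proof (induction n)
  case (Suc n)
  have "y * (sqrt_iter x n * sqrt_iter x n) = sqrt_iter x n * sqrt_iter x n * y"
    by (metis Suc mult.assoc)
  then show ?case using assms by (simp add: algebra_simps)
qed simp

lemma sqrt_iter_real:
  "0 \<le> sqrt_iter (1::real) n" "sqrt_iter (1::real) n \<le> 1"
  "sqrt_iter (1::real) n \<le> sqrt_iter 1 (Suc n)"
proof -
  show 0: "0 \<le> sqrt_iter (1::real) n" for n by (induction n) auto
  show 1: "sqrt_iter (1::real) n \<le> 1" for n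
  proof (induction n)
    case (Suc n)
    then have "sqrt_iter (1::real) n * sqrt_iter 1 n \<le> 1 * 1" using 0 by (intro mult_mono) auto
    then show ?case by simp
  qed simp
  have "0 \<le> (1 - sqrt_iter (1::real) n)\<^sup>2" by simp
  then show "sqrt_iter (1::real) n \<le> sqrt_iter 1 (Suc n)"
    by (simp add: power2_eq_square algebra_simps)
qed

lemma norm_sqrt_iter:
  assumes "norm x \<le> 1"
  shows "norm (sqrt_iter x n) \<le> sqrt_iter 1 n"
proof (induction n)
  case (Suc n)
  have "norm (sqrt_iter x n * sqrt_iter x n) \<le> norm (sqrt_iter x n) * norm (sqrt_iter x n)"
    by (rule norm_mult_ineq)
  also have "\<dots> \<le> sqrt_iter 1 n * sqrt_iter 1 n"
    using Suc sqrt_iter_real(1)[of n] by (intro mult_mono) auto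
  finally have "norm (x + sqrt_iter x n * sqrt_iter x n) \<le> 1 + sqrt_iter 1 n * sqrt_iter 1 n"
    using assms norm_triangle_ineq[of x "sqrt_iter x n * sqrt_iter x n"] by simp
  then show ?case by simp
qed simp

lemma norm_sqrt_iter_diff:
  assumes "norm x \<le> 1"
  shows "norm (sqrt_iter x (Suc n) - sqrt_iter x n) \<le> sqrt_iter 1 (Suc n) - sqrt_iter 1 n"
proof (induction n)
  case 0
  then show ?case using assms by simp
next
  case (Suc n)
  let ?g = "sqrt_iter x" and ?t = "sqrt_iter (1::real)"
  have c: "?g n * ?g (Suc n) = ?g (Suc n) * ?g n"
    by (rule sqrt_iter_commute) (metis sqrt_iter_commute)
  have t: "?t (Suc (Suc n)) - ?t (Suc n) = (1/2) * ((?t (Suc n) - ?t n) * (?t (Suc n) + ?t n))"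
    by (simp add: algebra_simps)
  have "?g (Suc (Suc n)) - ?g (Suc n)
      = (1/2) *\<^sub>R (x + ?g (Suc n) * ?g (Suc n)) - (1/2) *\<^sub>R (x + ?g n * ?g n)"
    by (metis sqrt_iter.simps(2))
  also have "\<dots> = (1/2) *\<^sub>R (?g (Suc n) * ?g (Suc n) - ?g n * ?g n)"
    by (simp only: scaleR_right_diff_distrib[symmetric] add_diff_cancel_left)
  also have "?g (Suc n) * ?g (Suc n) - ?g n * ?g n = (?g (Suc n) - ?g n) * (?g (Suc n) + ?g n)"
    using c by (simp only: algebra_simps)
  finally have e: "?g (Suc (Suc n)) - ?g (Suc n) = (1/2) *\<^sub>R ((?g (Suc n) - ?g n) * (?g (Suc n) + ?g n))" .
  have "norm ((?g (Suc n) - ?g n) * (?g (Suc n) + ?g n)) \<le> norm (?g (Suc n) - ?g n) * norm (?g (Suc n) + ?g n)"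
    by (rule norm_mult_ineq)
  also have "\<dots> \<le> (?t (Suc n) - ?t n) * (?t (Suc n) + ?t n)"
    using Suc norm_triangle_le[OF add_mono[OF norm_sqrt_iter[OF assms, of "Suc n"] norm_sqrt_iter[OF assms, of n]]]
      sqrt_iter_real(3)[of n]
    by (intro mult_mono) (auto simp del: sqrt_iter.simps)
  finally show ?case unfolding e t by simp
qed

lemma sqrt_iter_limit:
  fixes x :: "'a::{real_normed_algebra_1,banach}"
  assumes "norm x \<le> 1"
  shows "\<exists>g. sqrt_iter x \<longlonglongrightarrow> g \<and> 2 *\<^sub>R g = x + g * g \<and> norm g \<le> 1"
proof -
  have mono: "incseq (sqrt_iter (1::real))"
    by (rule incseq_SucI) (rule sqrt_iter_real)
  have le: "norm (sqrt_iter x (n + k) - sqrt_iter x n) \<le> sqrt_iter 1 (n + k) - sqrt_iter 1 n" for n k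
  proof (induction k)
    case (Suc k)
    then show ?case
      using norm_sqrt_iter_diff[OF assms, of "n + k"]
        norm_triangle_ineq[of "sqrt_iter x (n + k) - sqrt_iter x n" "sqrt_iter x (Suc (n + k)) - sqrt_iter x (n + k)"]
      by (simp del: sqrt_iter.simps)
  qed simp
  have "convergent (sqrt_iter (1::real))"
    unfolding convergent_def using incseq_convergent[OF mono, of 1] sqrt_iter_real(2) by metis
  then have cau: "Cauchy (sqrt_iter (1::real))" by (rule convergent_Cauchy)
  have "Cauchy (sqrt_iter x)"
  proof (rule CauchyI)
    fix e :: real assume "e > 0"
    then obtain M where M: "\<And>m n. m \<ge> M \<Longrightarrow> n \<ge> M \<Longrightarrow> norm (sqrt_iter (1::real) m - sqrt_iter 1 n) < e"
      using CauchyD[OF cau] by blast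
    have *: "norm (sqrt_iter x n - sqrt_iter x m) < e" if "M \<le> m" "m \<le> n" for m n
      using le[of m "n - m"] M[of n m] that by simp
    have "norm (sqrt_iter x m - sqrt_iter x n) < e" if "m \<ge> M" "n \<ge> M" for m n
      using *[of m n] *[of n m] that by (cases "m \<le> n") (auto simp: norm_minus_commute)
    then show "\<exists>M. \<forall>m\<ge>M. \<forall>n\<ge>M. norm (sqrt_iter x m - sqrt_iter x n) < e" by blast
  qed
  then obtain g where g: "sqrt_iter x \<longlonglongrightarrow> g" using Cauchy_convergent convergentD by blast
  have "(\<lambda>n. sqrt_iter x (Suc n)) \<longlonglongrightarrow> (1/2) *\<^sub>R (x + g * g)"
    unfolding sqrt_iter.simps by (intro tendsto_intros g)
  then have "g = (1/2) *\<^sub>R (x + g * g)" using LIMSEQ_Suc[OF g] LIMSEQ_unique by blast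
  then have "2 *\<^sub>R g = x + g * g"
    by (metis scaleR_half_double scaleR_2 scaleR_right_distrib)
  moreover have "norm g \<le> 1"
    by (rule LIMSEQ_le_const2[OF tendsto_norm[OF g]])
      (meson norm_sqrt_iter[OF assms] sqrt_iter_real(2) order_trans)
  ultimately show ?thesis using g by blast
qed

text \<open>Positivity in terms of the norm, from which stability under sums and limits is evident.
  That it holds for all \<open>y\<^sup>* y\<close> is the theorem of Fukamiya and Kaplansky, \<open>npos_star_mult\<close>.\<close>

definition npos :: "'a::unital_cstar_algebra \<Rightarrow> bool" where
  "npos a \<longleftrightarrow> star a = a \<and> (\<exists>t\<ge>0. norm (t *\<^sub>R 1 - a) \<le> t)"

lemma sqrt_exists_unit:
  fixes x :: "'a::unital_cstar_algebra"
  assumes "norm x \<le> 1" "star x = x"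
  shows "\<exists>r. star r = r \<and> r * r = 1 - x \<and> norm (1 - r) \<le> 1 \<and> (\<forall>y. y * x = x * y \<longrightarrow> y * r = r * y)"
proof -
  obtain g where g: "sqrt_iter x \<longlonglongrightarrow> g" "2 *\<^sub>R g = x + g * g" "norm g \<le> 1"
    using sqrt_iter_limit[OF assms(1)] by blast
  have "star (sqrt_iter x n) = sqrt_iter x n" for n
    by (induction n) (auto simp: star_simps assms(2))
  then have "sqrt_iter x \<longlonglongrightarrow> star g"
    using bounded_linear.tendsto[OF bounded_linear_star g(1)] by simp
  then have sg: "star g = g" using g(1) LIMSEQ_unique by blast
  have cg: "y * g = g * y" if "y * x = x * y" for y
  proof -
    have "(\<lambda>n. y * sqrt_iter x n) \<longlonglongrightarrow> y * g" "(\<lambda>n. sqrt_iter x n * y) \<longlonglongrightarrow> g * y"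
      by (intro tendsto_intros g)+
    then show ?thesis using LIMSEQ_unique by (simp add: sqrt_iter_commute[OF that])
  qed
  have "(1 - g) * (1 - g) = 1 - x" using g(2) by (simp add: algebra_simps scaleR_2)
  moreover have "star (1 - g) = 1 - g" using sg by (simp add: star_simps)
  moreover have "y * (1 - g) = (1 - g) * y" if "y * x = x * y" for y
    using cg[OF that] by (simp only: right_diff_distrib left_diff_distrib mult_1_left mult_1_right)
  moreover have "norm (1 - (1 - g)) \<le> 1" using g(3) by simp
  ultimately show ?thesis by blast
qed

lemma norm_sa_square: "star s = s \<Longrightarrow> norm (s * s) = (norm (s::'a::unital_cstar_algebra))\<^sup>2"
  using cstar_identity[of s] by simp

lemma sqrt_exists:
  fixes a :: "'a::unital_cstar_algebra"
  assumes "npos a"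
  shows "\<exists>s. star s = s \<and> s * s = a \<and> npos s \<and> (\<forall>y. y * a = a * y \<longrightarrow> y * s = s * y)"
proof -
  obtain t where t: "t \<ge> 0" "norm (t *\<^sub>R 1 - a) \<le> t" and sa: "star a = a"
    using assms by (auto simp: npos_def)
  show ?thesis
  proof (cases "t = 0")
    case True
    then have "a = 0" using t by auto
    then show ?thesis by (auto simp: npos_def star_zero intro!: exI[of _ 0])
  next
    case False
    with t have tp: "t > 0" by simp
    define x where "x = 1 - (1/t) *\<^sub>R a"
    have xx: "x = (1/t) *\<^sub>R (t *\<^sub>R 1 - a)" using tp by (simp add: x_def algebra_simps)
    have "norm x \<le> 1" unfolding xx using t tp by (simp add: divide_simps)
    moreover have "star x = x" by (simp add: x_def star_simps sa)
    ultimately obtain r where r: "star r = r" "r * r = 1 - x" "norm (1 - r) \<le> 1"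
      "\<And>y. y * x = x * y \<Longrightarrow> y * r = r * y" using sqrt_exists_unit by blast
    define s where "s = sqrt t *\<^sub>R r"
    have "s * s = t *\<^sub>R (r * r)" using tp by (simp add: s_def)
    also have "\<dots> = a" using tp r(2) by (simp add: x_def)
    finally have "s * s = a" .
    moreover have "star s = s" by (simp add: s_def star_simps r)
    moreover have ns: "norm (sqrt t *\<^sub>R 1 - s) \<le> sqrt t"
    proof -
      have "sqrt t *\<^sub>R 1 - s = sqrt t *\<^sub>R (1 - r)" by (simp add: s_def algebra_simps)
      then show ?thesis using r(3) tp by (simp add: mult_left_le)
    qed
    moreover have "y * s = s * y" if "y * a = a * y" for y
      using r(4)[of y] that by (simp add: x_def s_def algebra_simps)
    moreover have "0 \<le> sqrt t" using tp by simp
    ultimately show ?thesis unfolding npos_def by blast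
  qed
qed

text \<open>If \<open>s\<close> and \<open>r\<close> commute then \<open>(s + i r) / sqrt t\<close> is unitary.\<close>

lemma norm_sa_le_of_squares:
  fixes s r :: "'a::unital_cstar_algebra"
  assumes "star s = s" "star r = r" "s * r = r * s" "s * s + r * r = t *\<^sub>R 1" "t \<ge> 0"
  shows "norm (s * s) \<le> t" "norm (r * r) \<le> t"
proof -
  define u where "u = s + \<i> *\<^sub>C r"
  have su: "star u = s - \<i> *\<^sub>C r"
    by (simp add: u_def star_simps assms scaleC_minus_left)
  have ii: "\<i> *\<^sub>C \<i> *\<^sub>C y = - y" for y :: 'a
    by (simp add: scaleC_scaleC scaleC_minus1)
  have "star u * u = s * s + r * r"
    unfolding su unfolding u_def using assms(3)
    by (simp add: algebra_simps mult_scaleC_left mult_scaleC_right scaleC_diff_right ii)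
  then have t: "(norm u)\<^sup>2 = t"
    using assms(4,5) cstar_identity[of u] by simp
  have "s = (1/2) *\<^sub>R (u + star u)" unfolding su by (simp add: u_def scaleR_2[symmetric])
  then have "norm s \<le> norm u" using norm_triangle_ineq[of u "star u"] by (simp add: norm_star)
  then show "norm (s * s) \<le> t" using t by (simp add: norm_sa_square assms(1) power_mono flip: t)
  have "\<i> *\<^sub>C r = (1/2) *\<^sub>R (u - star u)" unfolding su by (simp add: u_def scaleR_2[symmetric])
  then have "norm (\<i> *\<^sub>C r) \<le> norm u" using norm_triangle_ineq4[of u "star u"] by (simp add: norm_star)
  then have "norm r \<le> norm u" by (simp add: norm_scaleC)
  then show "norm (r * r) \<le> t" using t by (simp add: norm_sa_square assms(2) power_mono flip: t)
qed

lemma npos_sa_square: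
  fixes s :: "'a::unital_cstar_algebra"
  assumes "star s = s" "norm (s * s) \<le> t"
  shows "norm (t *\<^sub>R 1 - s * s) \<le> t"
proof (cases "t = 0")
  case False
  have t0: "t > 0" using assms(2) False norm_ge_zero[of "s * s"] by linarith
  define x where "x = (1/t) *\<^sub>R (s * s)"
  have "norm x \<le> 1" "star x = x" using assms t0 by (auto simp: x_def star_simps divide_simps)
  then obtain q where q: "star q = q" "q * q = 1 - x" "norm (1 - q) \<le> 1"
    "\<And>y. y * x = x * y \<Longrightarrow> y * q = q * y" using sqrt_exists_unit by blast
  have sq: "s * q = q * s" by (rule q(4)) (simp add: x_def mult.assoc)
  define r where "r = sqrt t *\<^sub>R q"
  have "r * r = t *\<^sub>R (q * q)" using t0 by (simp add: r_def)
  then have rr: "r * r = t *\<^sub>R 1 - s * s" unfolding q(2) using t0 by (simp add: x_def algebra_simps)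
  have "norm (r * r) \<le> t"
  proof (rule norm_sa_le_of_squares(2)[of s r])
    show "star r = r" "s * r = r * s" using q(1) sq by (simp_all add: r_def star_simps)
    show "s * s + r * r = t *\<^sub>R 1" unfolding rr by simp
  qed (use assms t0 in auto)
  then show ?thesis by (simp add: rr)
qed (use assms in auto)

lemma npos_square: "star s = s \<Longrightarrow> npos (s * s :: 'a::unital_cstar_algebra)"
  using npos_sa_square[of s "norm (s * s)"] by (auto simp: npos_def star_simps intro!: exI[of _ "norm (s * s)"])

lemma npos_iff_square: "npos a \<longleftrightarrow> (\<exists>s. star s = s \<and> a = s * s)"
  using npos_square sqrt_exists by metis

lemma npos_star: "npos a \<Longrightarrow> star a = a"
  by (simp add: npos_def)

lemma npos_norm_diff:
  assumes "npos a" "norm a \<le> t"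
  shows "norm (t *\<^sub>R 1 - a) \<le> t"
proof -
  obtain s where "star s = s" "a = s * s" using assms(1) npos_iff_square by blast
  then show ?thesis using npos_sa_square assms(2) by blast
qed

lemma npos_add: "npos a \<Longrightarrow> npos b \<Longrightarrow> npos (a + b)"
proof -
  assume a: "npos a" "npos b"
  then obtain t u where *: "t \<ge> 0" "u \<ge> 0" "norm (t *\<^sub>R 1 - a) \<le> t" "norm (u *\<^sub>R 1 - b) \<le> u"
    by (auto simp: npos_def)
  have "(t + u) *\<^sub>R 1 - (a + b) = (t *\<^sub>R 1 - a) + (u *\<^sub>R 1 - b)" by (simp add: algebra_simps)
  then have "norm ((t + u) *\<^sub>R 1 - (a + b)) \<le> t + u"
    using norm_triangle_ineq[of "t *\<^sub>R 1 - a" "u *\<^sub>R 1 - b"] *(3,4) by (smt (verit))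
  then show ?thesis using a * unfolding npos_def by (metis add_nonneg_nonneg star_add)
qed

lemma npos_scaleR: "npos a \<Longrightarrow> r \<ge> 0 \<Longrightarrow> npos (r *\<^sub>R a)"
proof -
  assume a: "npos a" and r: "r \<ge> 0"
  then obtain t where *: "t \<ge> 0" "norm (t *\<^sub>R 1 - a) \<le> t" by (auto simp: npos_def)
  have "(r * t) *\<^sub>R 1 - r *\<^sub>R a = r *\<^sub>R (t *\<^sub>R 1 - a)" by (simp add: algebra_simps)
  then have "norm ((r * t) *\<^sub>R 1 - r *\<^sub>R a) \<le> r * t"
    using * r by (simp add: mult_left_mono)
  then show ?thesis using a r * unfolding npos_def by (auto simp: star_simps intro!: exI[of _ "r * t"])
qed

lemma npos_zero [simp]: "npos 0"
  by (auto simp: npos_def star_zero)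

lemma npos_one [simp]: "npos 1"
  using npos_square[of 1] by (simp add: star_one)

lemma npos_sum: "(\<And>i. i \<in> I \<Longrightarrow> npos (f i)) \<Longrightarrow> npos (\<Sum>i\<in>I. f i)"
  by (induction I rule: infinite_finite_induct) (auto intro: npos_add)

lemma npos_limit:
  fixes f :: "'i \<Rightarrow> 'a::unital_cstar_algebra"
  assumes "(f \<longlongrightarrow> a) F" "\<forall>\<^sub>F n in F. npos (f n)" "F \<noteq> bot"
  shows "npos a"
proof -
  have "((\<lambda>n. star (f n)) \<longlongrightarrow> star a) F"
    using bounded_linear.tendsto[OF bounded_linear_star assms(1)] .
  moreover have "\<forall>\<^sub>F n in F. star (f n) = f n"
    using assms(2) by eventually_elim (rule npos_star)
  ultimately have "(f \<longlongrightarrow> star a) F" by (simp add: filterlim_cong)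
  then have sa: "star a = a" using assms tendsto_unique by blast
  have "((\<lambda>n. norm (norm (f n) *\<^sub>R 1 - f n)) \<longlongrightarrow> norm (norm a *\<^sub>R 1 - a)) F"
    by (intro tendsto_intros assms)
  moreover have "((\<lambda>n. norm (f n)) \<longlongrightarrow> norm a) F" by (intro tendsto_intros assms)
  ultimately have "norm (norm a *\<^sub>R 1 - a) \<le> norm a"
    using tendsto_le[OF assms(3)] assms(2) by (smt (verit, best) eventually_mono npos_norm_diff)
  then show ?thesis using sa unfolding npos_def by (metis norm_ge_zero)
qed

lemma npos_mult_commute:
  assumes "npos a" "npos b" "a * b = b * a"
  shows "npos (a * b)"
proof -
  obtain s where s: "star s = s" "s * s = a" "\<And>y. y * a = a * y \<Longrightarrow> y * s = s * y"
    using sqrt_exists[OF assms(1)] by blast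
  obtain r where r: "star r = r" "r * r = b" "\<And>y. y * b = b * y \<Longrightarrow> y * r = r * y"
    using sqrt_exists[OF assms(2)] by blast
  have "s * r = r * s" using s(3)[of b] r(3)[of s] assms(3) by metis
  moreover have "s * s * (r * r) = s * (s * r) * r" by (simp only: mult.assoc)
  ultimately have "a * b = (s * r) * (s * r)" using s(2) r(2) by (metis mult.assoc)
  moreover have "star (s * r) = s * r"
    using \<open>s * r = r * s\<close> s(1) r(1) star_mult by metis
  ultimately show ?thesis using npos_square by metis
qed

lemma npos_norm_le:
  assumes "npos a" "npos (t *\<^sub>R 1 - a)" "t \<ge> 0"
  shows "norm a \<le> t"
proof -
  obtain s where s: "star s = s" "s * s = a" "\<And>y. y * a = a * y \<Longrightarrow> y * s = s * y"
    using sqrt_exists[OF assms(1)] by blast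
  obtain r where r: "star r = r" "r * r = t *\<^sub>R 1 - a" "\<And>y. y * (t *\<^sub>R 1 - a) = (t *\<^sub>R 1 - a) * y \<Longrightarrow> y * r = r * y"
    using sqrt_exists[OF assms(2)] by blast
  have "s * a = a * s" unfolding s(2)[symmetric] by (simp add: mult.assoc)
  then have sr: "s * r = r * s" by (intro r(3)) (simp add: algebra_simps)
  have "s * s + r * r = t *\<^sub>R 1" using s(2) r(2) by simp
  then show ?thesis using norm_sa_le_of_squares(1)[OF s(1) r(1) sr _ assms(3)] s(2) by blast
qed

lemma npos_eq_zero:
  assumes "npos q" "npos (- q)"
  shows "q = 0"
proof -
  have "norm q \<le> 0" using npos_norm_le[of q 0] assms by simp
  then show ?thesis by simp
qed

lemma one_minus_invertible:
  fixes x :: "'a::{real_normed_algebra_1,banach}"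
  assumes "norm x < 1"
  shows "\<exists>v. v * (1 - x) = 1 \<and> (1 - x) * v = 1"
proof -
  have s: "summable (\<lambda>n. x ^ n)" by (rule complete_algebra_summable_geometric[OF assms])
  have h: "(\<Sum>n. x ^ n) = 1 + (\<Sum>n. x ^ Suc n)" using suminf_split_head[OF s] by simp
  have "x * (\<Sum>n. x ^ n) = (\<Sum>n. x ^ Suc n)" using suminf_mult[OF s, of x] by simp
  moreover have "(\<Sum>n. x ^ n) * x = (\<Sum>n. x ^ Suc n)"
    using suminf_mult2[OF s, of x] by (simp add: power_commutes)
  ultimately show ?thesis using h
    by (intro exI[of _ "\<Sum>n. x ^ n"]) (simp add: algebra_simps)
qed

lemma npos_add_invertible:
  assumes "npos a" "l > 0"
  shows "\<exists>v. v * (a + l *\<^sub>R 1) = 1 \<and> (a + l *\<^sub>R 1) * v = 1"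
proof -
  define T where "T = norm a + l"
  have T: "T > 0" using assms(2) by (simp add: T_def add_nonneg_pos)
  define x where "x = (1/T) *\<^sub>R (norm a *\<^sub>R 1 - a)"
  have "norm x \<le> norm a / T" using npos_norm_diff[OF assms(1) order_refl] T
    by (simp add: x_def divide_simps)
  also have "\<dots> < 1" using T assms(2) by (simp add: T_def)
  finally obtain v where v: "v * (1 - x) = 1" "(1 - x) * v = 1" using one_minus_invertible by blast
  have "T *\<^sub>R x = norm a *\<^sub>R 1 - a" using T by (simp add: x_def)
  then have "a + l *\<^sub>R 1 = T *\<^sub>R (1 - x)" by (simp add: T_def algebra_simps)
  then show ?thesis using v T by (intro exI[of _ "(1/T) *\<^sub>R v"]) simp
qed

lemma sa_inverse:
  fixes a v :: "'a::unital_cstar_algebra"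
  assumes "star a = a" "v * a = 1" "a * v = 1"
  shows "star v = v"
proof -
  have "a * star v = 1" using assms by (metis star_mult star_one)
  then show ?thesis by (metis assms(2) mult.assoc mult.left_neutral mult.right_neutral)
qed

lemma inverse_commute:
  fixes a v :: "'a::monoid_mult"
  assumes "v * a = 1" "a * v = 1" "y * a = a * y"
  shows "y * v = v * y"
  by (metis assms mult.assoc mult.left_neutral mult.right_neutral)

text \<open>The set of \<open>l \<ge> 0\<close> with \<open>h + l\<close> positive is closed, and open at points where \<open>h + l\<close> is
  invertible; this replaces the spectrum.\<close>

lemma npos_of_invertible:
  fixes h :: "'a::unital_cstar_algebra"
  assumes sa: "star h = h"
    and inv: "\<And>l. l > 0 \<Longrightarrow> \<exists>v. v * (h + l *\<^sub>R 1) = 1 \<and> (h + l *\<^sub>R 1) * v = 1"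
  shows "npos h"
proof -
  define S where "S = {l. l \<ge> 0 \<and> npos (h + l *\<^sub>R 1)}"
  have "norm h \<in> S" using sa by (auto simp: S_def npos_def star_simps intro!: exI[of _ "norm h"])
  moreover have bb: "bdd_below S" by (auto simp: S_def)
  moreover have "closed S"
  proof (unfold closed_sequential_limits, intro allI impI, elim conjE)
    fix x l assume x: "\<forall>n. x n \<in> S" "x \<longlonglongrightarrow> l"
    have "(\<lambda>n. h + x n *\<^sub>R 1) \<longlonglongrightarrow> h + l *\<^sub>R 1" by (intro tendsto_intros x)
    then have "npos (h + l *\<^sub>R 1)"
      by (rule npos_limit) (use x in \<open>auto simp: S_def\<close>)
    moreover have "l \<ge> 0" by (rule LIMSEQ_le_const[OF x(2)]) (use x in \<open>auto simp: S_def\<close>)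
    ultimately show "l \<in> S" by (simp add: S_def)
  qed
  ultimately have I: "Inf S \<in> S" by (intro closed_contains_Inf) auto
  define l where "l = Inf S"
  have l: "l \<ge> 0" "npos (h + l *\<^sub>R 1)" using I by (auto simp: l_def S_def)
  have "l = 0"
  proof (rule ccontr)
    assume "l \<noteq> 0"
    then have lp: "l > 0" using l by simp
    obtain v where v: "v * (h + l *\<^sub>R 1) = 1" "(h + l *\<^sub>R 1) * v = 1" using inv[OF lp] by blast
    define d where "d = min l (1 / (norm v + 1))"
    have nv: "norm v + 1 > 0" by (simp add: add_nonneg_pos)
    have d: "d > 0" "d \<le> l" using lp nv by (auto simp: d_def)
    have "d * norm v \<le> 1 / (norm v + 1) * norm v" by (intro mult_right_mono) (auto simp: d_def)
    also have "\<dots> \<le> 1" using nv by (simp add: divide_simps)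
    finally have "norm (d *\<^sub>R v) \<le> 1" using d by simp
    moreover have "star v = v" using sa_inverse[OF npos_star[OF l(2)] v] .
    ultimately have "npos (1 - d *\<^sub>R v)"
      by (auto simp: npos_def star_simps intro!: exI[of _ 1])
    moreover have e: "(h + l *\<^sub>R 1) * (1 - d *\<^sub>R v) = h + (l - d) *\<^sub>R 1"
      "(1 - d *\<^sub>R v) * (h + l *\<^sub>R 1) = h + (l - d) *\<^sub>R 1"
      using v by (simp_all add: right_diff_distrib left_diff_distrib scaleR_left_diff_distrib)
    ultimately have "npos (h + (l - d) *\<^sub>R 1)" using npos_mult_commute[OF l(2)] by metis
    then have "l - d \<in> S" using d by (simp add: S_def)
    then have "l \<le> l - d" unfolding l_def using cInf_lower[OF _ bb] by blast
    then show False using d by simp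
  qed
  then show ?thesis using l by simp
qed

lemma npos_half_diff:
  fixes h k :: "'a::unital_cstar_algebra"
  assumes "star h = h" "npos k" "k * k = h * h" "k * h = h * k"
  shows "npos ((1/2) *\<^sub>R (k - h))"
proof (rule npos_of_invertible)
  define n where "n = (1/2) *\<^sub>R (k - h)"
  show "star ((1/2) *\<^sub>R (k - h)) = (1/2) *\<^sub>R (k - h)"
    using assms npos_star by (simp add: star_simps)
  fix l :: real assume l: "l > 0"
  obtain v where v: "v * (k + l *\<^sub>R 1) = 1" "(k + l *\<^sub>R 1) * v = 1"
    using npos_add_invertible[OF assms(2) l] by blast
  have kn: "n * k = k * n" using assms(4) by (simp add: n_def algebra_simps)
  have "(k - h) * (k - h) = 2 *\<^sub>R (k * (k - h))"
    using assms(3,4) by (simp add: algebra_simps scaleR_2)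
  then have nn: "n * n = n * k" using kn unfolding n_def by simp
  have nv: "n * v = v * n" by (rule inverse_commute[OF v]) (simp add: algebra_simps kn)
  have "n * n * v + l *\<^sub>R (n * v) = n * ((k + l *\<^sub>R 1) * v)"
    by (simp add: nn algebra_simps)
  then have nnv: "n * n * v + l *\<^sub>R (n * v) = n" by (simp add: v)
  have *: "(n + l *\<^sub>R 1) * (1 - n * v) = l *\<^sub>R 1"
    using nnv by (simp add: algebra_simps)
  moreover have "(1 - n * v) * (n + l *\<^sub>R 1) = (n + l *\<^sub>R 1) * (1 - n * v)"
    using nv by (simp add: algebra_simps) (metis mult.assoc)
  ultimately show "\<exists>v. v * ((1/2) *\<^sub>R (k - h) + l *\<^sub>R 1) = 1 \<and> ((1/2) *\<^sub>R (k - h) + l *\<^sub>R 1) * v = 1"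
    using l unfolding n_def[symmetric] by (intro exI[of _ "(1/l) *\<^sub>R (1 - n * v)"]) simp
qed

lemma npos_decomposition:
  fixes h :: "'a::unital_cstar_algebra"
  assumes "star h = h"
  shows "\<exists>p n. npos p \<and> npos n \<and> h = p - n \<and> p * n = 0 \<and> n * p = 0"
proof -
  obtain k where k: "k * k = h * h" "npos k" "\<And>y. y * (h * h) = (h * h) * y \<Longrightarrow> y * k = k * y"
    using sqrt_exists[OF npos_square[OF assms]] by blast
  have kh: "k * h = h * k" using k(3)[of h] by (simp add: mult.assoc)
  have 1: "npos ((1/2) *\<^sub>R (k - h))" using npos_half_diff[OF assms k(2,1) kh] .
  have 2: "npos ((1/2) *\<^sub>R (k - (- h)))" by (rule npos_half_diff) (simp_all add: assms k(1,2) kh star_minus)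
  have 3: "h = (1/2) *\<^sub>R (k - (- h)) - (1/2) *\<^sub>R (k - h)"
    by (simp add: algebra_simps flip: scaleR_2)
  have "(k - (- h)) * (k - h) = 0" "(k - h) * (k - (- h)) = 0"
    using kh k(1) by (simp_all only: right_diff_distrib left_diff_distrib) simp_all
  then have "(1/2) *\<^sub>R (k - (- h)) * ((1/2) *\<^sub>R (k - h)) = 0"
    "(1/2) *\<^sub>R (k - h) * ((1/2) *\<^sub>R (k - (- h))) = 0" by simp_all
  then show ?thesis using 1 2 3 by blast
qed

lemma invertible_swap:
  fixes x y :: "'a::real_algebra_1"
  assumes "v * (x * y + l *\<^sub>R 1) = 1" "(x * y + l *\<^sub>R 1) * v = 1" "l \<noteq> 0"
  shows "\<exists>w. w * (y * x + l *\<^sub>R 1) = 1 \<and> (y * x + l *\<^sub>R 1) * w = 1"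
proof -
  define w where "w = (1/l) *\<^sub>R (1 - y * v * x)"
  have a: "v * x * y = 1 - l *\<^sub>R v" using assms(1) by (simp add: algebra_simps)
  have b: "x * y * v = 1 - l *\<^sub>R v" using assms(2) by (simp add: algebra_simps)
  have "(y * v * x) * (y * x) = y * (v * x * y) * x" by (simp add: mult.assoc)
  also have "\<dots> = y * x - l *\<^sub>R (y * v * x)" unfolding a by (simp add: algebra_simps)
  finally have 1: "(y * v * x) * (y * x) = y * x - l *\<^sub>R (y * v * x)" .
  have "(y * x) * (y * v * x) = y * (x * y * v) * x" by (simp add: mult.assoc)
  also have "\<dots> = y * x - l *\<^sub>R (y * v * x)" unfolding b by (simp add: algebra_simps)
  finally have 2: "(y * x) * (y * v * x) = y * x - l *\<^sub>R (y * v * x)" .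
  have "(1 - y * v * x) * (y * x + l *\<^sub>R 1) = l *\<^sub>R 1"
    using 1 by (simp only: left_diff_distrib distrib_left) simp
  moreover have "(y * x + l *\<^sub>R 1) * (1 - y * v * x) = l *\<^sub>R 1"
    using 2 by (simp only: right_diff_distrib distrib_right) simp
  ultimately show ?thesis using assms(3) by (intro exI[of _ w]) (simp add: w_def)
qed

lemma star_mult_add_swap:
  fixes z :: "'a::unital_cstar_algebra"
  shows "\<exists>u v. star u = u \<and> star v = v \<and> star z * z + z * star z = 2 *\<^sub>R (u * u + v * v)"
proof -
  define u v where "u = (1/2) *\<^sub>R (z + star z)" and "v = (-\<i>) *\<^sub>C (1/2) *\<^sub>R (z - star z)"
  have "star u = u" by (simp add: u_def star_simps add.commute)
  moreover have "star v = v"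
    by (simp add: v_def star_simps scaleC_minus_left scaleC_diff_right scaleR_diff_right scaleC_scaleR)
  moreover have vv: "v * v = - ((1/4) *\<^sub>R ((z - star z) * (z - star z)))"
    by (simp add: v_def mult_scaleC_left mult_scaleC_right scaleC_scaleC scaleC_minus1 scaleC_scaleR)
  have "star z * z + z * star z = 2 *\<^sub>R (u * u + v * v)"
    unfolding vv unfolding u_def by (simp add: algebra_simps flip: scaleR_2)
  ultimately show ?thesis by blast
qed

lemma npos_star_mult: "npos (star y * y)"
proof -
  define h where "h = star y * y"
  have sh: "star h = h" by (simp add: h_def star_simps)
  obtain p n where pn: "npos p" "npos n" "h = p - n" "p * n = 0" "n * p = 0"
    using npos_decomposition[OF sh] by blast
  define z where "z = y * n"
  have sn: "star n = n" using npos_star[OF pn(2)] .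
  have zz: "star z * z = - (n * n * n)"
  proof -
    have "star z * z = n * h * n" by (simp add: z_def star_simps sn h_def mult.assoc)
    then show ?thesis by (simp add: pn algebra_simps)
  qed
  have q: "npos (n * n * n)" by (intro npos_mult_commute npos_square pn sn) (simp add: mult.assoc)
  obtain u v where uv: "star u = u" "star v = v" "star z * z + z * star z = 2 *\<^sub>R (u * u + v * v)"
    using star_mult_add_swap by blast
  have "z * star z = 2 *\<^sub>R (u * u + v * v) + n * n * n"
    using uv(3) zz by (simp add: algebra_simps)
  then have pz: "npos (z * star z)"
    using q uv by (metis npos_add npos_scaleR npos_square zero_le_numeral)
  have "npos (star z * z)"
  proof (rule npos_of_invertible)
    fix l :: real assume l: "l > 0"
    show "\<exists>v. v * (star z * z + l *\<^sub>R 1) = 1 \<and> (star z * z + l *\<^sub>R 1) * v = 1"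
      using npos_add_invertible[OF pz l] invertible_swap[of _ z "star z" l] l by blast
  qed (simp add: star_simps)
  then have "n * n * n = 0" using npos_eq_zero[OF q] zz by simp
  then have "norm ((n * n) * (n * n)) = 0" by (simp add: mult.assoc)
  then have "n = 0" using norm_sa_square[of "n * n"] norm_sa_square[of n] sn by (simp add: star_simps)
  then show ?thesis using pn h_def by simp
qed

lemma npos_iff: "npos a \<longleftrightarrow> (\<exists>y. a = star y * y)"
  by (metis npos_star_mult npos_iff_square)

lemma npos_conj:
  assumes "npos a"
  shows "npos (star b * a * b)"
proof -
  obtain y where "a = star y * y" using assms npos_iff by blast
  then have "star b * a * b = star (y * b) * (y * b)" by (simp add: star_simps mult.assoc)
  then show ?thesis by (simp add: npos_star_mult)
qed

lemma npos_norm_minus: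
  assumes "star a = a" "norm a \<le> t"
  shows "npos (t *\<^sub>R 1 - a)"
proof -
  have "t \<ge> 0" using assms(2) norm_ge_zero[of a] by linarith
  then show ?thesis using assms by (auto simp: npos_def star_simps intro!: exI[of _ t])
qed

lemma npos_conj_le:
  assumes "star a = a" "norm a \<le> t"
  shows "npos (t *\<^sub>R (star b * b) - star b * a * b)"
  using npos_conj[OF npos_norm_minus[OF assms], of b] by (simp add: algebra_simps)

lemma npos_norm_mono:
  assumes "npos a" "npos (b - a)"
  shows "norm a \<le> norm b"
proof (rule npos_norm_le)
  have "star b = b" using npos_star[OF npos_add[OF assms]] by simp
  then have "npos (norm b *\<^sub>R 1 - b)" by (rule npos_norm_minus) simp
  from npos_add[OF this assms(2)] show "npos (norm b *\<^sub>R 1 - a)" by simp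
qed (use assms in auto)

lemma sq_norm_minus_exists:
  fixes a :: "'a::unital_cstar_algebra"
  shows "\<exists>s. star s = s \<and> star a * a + s * s = (norm a)\<^sup>2 *\<^sub>R 1"
proof -
  have "npos ((norm a)\<^sup>2 *\<^sub>R 1 - star a * a)"
    by (rule npos_norm_minus) (simp_all add: star_simps cstar_identity)
  then obtain s where "star s = s" "(norm a)\<^sup>2 *\<^sub>R 1 - star a * a = s * s"
    using npos_iff_square by blast
  then show ?thesis by (metis add.commute diff_add_cancel)
qed

section \<open>Positive matrices\<close>

definition qform :: "nat \<Rightarrow> (nat \<Rightarrow> nat \<Rightarrow> 'a::unital_cstar_algebra) \<Rightarrow> (nat \<Rightarrow> 'a) \<Rightarrow> 'a" where
  "qform N M b = (\<Sum>i<N. \<Sum>j<N. star (b i) * M i j * b j)"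

definition posform :: "nat \<Rightarrow> (nat \<Rightarrow> nat \<Rightarrow> 'a::unital_cstar_algebra) \<Rightarrow> bool" where
  "posform N M \<longleftrightarrow> (\<forall>b. npos (qform N M b))"

lemma qform_cong:
  "(\<And>i j. i < N \<Longrightarrow> j < N \<Longrightarrow> M i j = M' i j) \<Longrightarrow> qform N M b = qform N M' b"
  by (simp add: qform_def)

lemma posform_cong:
  "(\<And>i j. i < N \<Longrightarrow> j < N \<Longrightarrow> M i j = M' i j) \<Longrightarrow> posform N M = posform N M'"
  by (simp add: posform_def cong: qform_cong)

lemma qform_add: "qform N (\<lambda>i j. M i j + M' i j) b = qform N M b + qform N M' b"
  by (simp add: qform_def distrib_left distrib_right sum.distrib)

lemma posform_add: "posform N M \<Longrightarrow> posform N M' \<Longrightarrow> posform N (\<lambda>i j. M i j + M' i j)"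
  by (simp add: posform_def qform_add npos_add)

lemma qform_gram:
  "qform N (\<lambda>i j. \<Sum>k\<in>I. star (Y k i) * Y k j) b
    = (\<Sum>k\<in>I. star (\<Sum>i<N. Y k i * b i) * (\<Sum>i<N. Y k i * b i))"
proof -
  have "qform N (\<lambda>i j. \<Sum>k\<in>I. star (Y k i) * Y k j) b
      = (\<Sum>i<N. \<Sum>j<N. \<Sum>k\<in>I. star (Y k i * b i) * (Y k j * b j))"
    by (simp add: qform_def sum_distrib_left sum_distrib_right star_mult mult.assoc)
  also have "\<dots> = (\<Sum>k\<in>I. \<Sum>i<N. \<Sum>j<N. star (Y k i * b i) * (Y k j * b j))"
    by (subst (2) sum.swap, subst sum.swap) (rule refl)
  finally show ?thesis by (simp add: star_sum sum_product)
qed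

lemma posform_gram: "posform N (\<lambda>i j. \<Sum>k\<in>I. star (Y k i) * Y k j)"
  unfolding posform_def qform_gram by (intro allI npos_sum npos_star_mult)

lemma mat_positive_imp_posform: "mat_positive N M \<Longrightarrow> posform N M"
  unfolding mat_positive_def using posform_gram posform_cong by (smt (verit, best))

lemma posform_reindex:
  assumes "posform N M" and f: "\<And>i. i < m \<Longrightarrow> f i < N"
  shows "posform m (\<lambda>i j. M (f i) (f j))"
proof -
  have "qform m (\<lambda>i j. M (f i) (f j)) b = qform N M (\<lambda>k. \<Sum>i | i \<in> {..<m} \<and> f i = k. b i)" for b
  proof -
    have im: "f ` {..<m} \<subseteq> {..<N}" using f by auto
    let ?F = "\<lambda>k. {i. i \<in> {..<m} \<and> f i = k}"
    have "qform N M (\<lambda>k. \<Sum>i\<in>?F k. b i)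
        = (\<Sum>k<N. \<Sum>l<N. \<Sum>i\<in>?F k. \<Sum>j\<in>?F l. star (b i) * M k l * b j)"
      unfolding qform_def star_sum sum_distrib_right sum_distrib_left
      by (intro sum.cong refl sum.swap)
    also have "\<dots> = (\<Sum>k<N. \<Sum>i\<in>?F k. \<Sum>l<N. \<Sum>j\<in>?F l. star (b i) * M k l * b j)"
      by (intro sum.cong refl sum.swap)
    also have "\<dots> = (\<Sum>k<N. \<Sum>i\<in>?F k. \<Sum>l<N. \<Sum>j\<in>?F l. star (b i) * M (f i) (f j) * b j)"
      by (intro sum.cong refl) auto
    also have "\<dots> = (\<Sum>k<N. \<Sum>i\<in>?F k. \<Sum>j<m. star (b i) * M (f i) (f j) * b j)"
      by (rule sum.cong[OF refl], rule sum.cong[OF refl], rule sum.group[OF _ _ im]) auto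
    also have "\<dots> = qform m (\<lambda>i j. M (f i) (f j)) b"
      unfolding qform_def by (rule sum.group[OF _ _ im]) auto
    finally show ?thesis by simp
  qed
  then show ?thesis using assms(1) by (simp add: posform_def)
qed

lemma posform_diag:
  assumes "posform N M" "i < N"
  shows "npos (M i i)"
proof -
  have "posform 1 (\<lambda>k l. M i i)" using posform_reindex[OF assms(1), of 1 "\<lambda>_. i"] assms(2) by simp
  then have "npos (qform 1 (\<lambda>k l. M i i) (\<lambda>_. 1))" by (simp add: posform_def)
  then show ?thesis by (simp add: qform_def star_one)
qed

lemma posform_two:
  assumes "posform N M" "i < N" "j < N"
  shows "npos (star a * M i i * a + star a * M i j * b + star b * M j i * a + star b * M j j * b)"
proof -
  let ?f = "\<lambda>k::nat. if k = 0 then i else j"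
  have "posform 2 (\<lambda>k l. M (?f k) (?f l))"
    by (rule posform_reindex[OF assms(1)]) (use assms in auto)
  then have "npos (qform 2 (\<lambda>k l. M (?f k) (?f l)) (\<lambda>k. if k = 0 then a else b))"
    by (simp add: posform_def)
  then show ?thesis by (simp add: qform_def numeral_2_eq_2 algebra_simps)
qed

lemma posform_hermitian:
  assumes "posform N M" "i < N" "j < N"
  shows "M j i = star (M i j)"
proof -
  have d: "star (M i i) = M i i" "star (M j j) = M j j"
    using npos_star posform_diag[OF assms(1)] assms by blast+
  have 1: "M i j + M j i = star (M i j) + star (M j i)"
    using npos_star[OF posform_two[OF assms, of 1 1]] d by (simp add: star_simps algebra_simps)
  have "\<i> *\<^sub>C M i j - \<i> *\<^sub>C M j i = \<i> *\<^sub>C star (M j i) - \<i> *\<^sub>C star (M i j)"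
    using npos_star[OF posform_two[OF assms, of 1 "\<i> *\<^sub>C 1"]] d
    by (simp add: star_simps mult_scaleC_left mult_scaleC_right scaleC_scaleC scaleC_minus_left
        scaleC_minus_right algebra_simps)
  then have "(- \<i>) *\<^sub>C \<i> *\<^sub>C (M i j - M j i) = (- \<i>) *\<^sub>C \<i> *\<^sub>C (star (M j i) - star (M i j))"
    by (simp add: scaleC_diff_right)
  then have "M i j - M j i = star (M j i) - star (M i j)" by (simp add: scaleC_scaleC)
  with 1 have "(M i j + M j i) - (M i j - M j i)
      = (star (M i j) + star (M j i)) - (star (M j i) - star (M i j))" by (simp only:)
  then have "2 *\<^sub>R M j i = 2 *\<^sub>R star (M i j)" unfolding scaleR_2 by simp
  then show ?thesis by simp
qed

lemma posform_cauchy_schwarz: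
  assumes "posform N M" "i < N" "j < N"
  shows "(norm (M i j))\<^sup>2 \<le> norm (M i i) * norm (M j j)"
proof -
  have h: "M j i = star (M i j)" using posform_hermitian[OF assms] .
  have *: "(norm (M i j))\<^sup>2 \<le> t * norm (M j j)" if t: "t > 0" "t \<ge> norm (M i i)" for t
  proof -
    define m where "m = M i j"
    have si: "star (M i i) = M i i" using npos_star posform_diag[OF assms(1,2)] by blast
    have 1: "npos (star m * M i i * m - t *\<^sub>R (star m * m) - t *\<^sub>R (star m * m) + (t * t) *\<^sub>R M j j)"
      using posform_two[OF assms, of "m" "(-t) *\<^sub>R 1"] h
      by (simp add: star_simps m_def algebra_simps)
    have 2: "npos (t *\<^sub>R (star m * m) - star m * M i i * m)"
      by (rule npos_conj_le[OF si t(2)])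
    have "npos ((1/t) *\<^sub>R ((t * t) *\<^sub>R M j j - t *\<^sub>R (star m * m)))"
      using npos_add[OF 1 2] t by (intro npos_scaleR) (auto simp: algebra_simps)
    then have "npos (t *\<^sub>R M j j - star m * m)" using t by (simp add: algebra_simps)
    then have "norm (star m * m) \<le> norm (t *\<^sub>R M j j)" by (intro npos_norm_mono npos_star_mult)
    then show ?thesis using t by (simp add: cstar_identity m_def)
  qed
  show ?thesis
  proof (rule field_le_epsilon)
    fix e :: real assume e: "e > 0"
    define d where "d = e / (norm (M j j) + 1)"
    have n1: "norm (M j j) + 1 > 0" by (simp add: add_nonneg_pos)
    have "d > 0" using e n1 by (simp add: d_def)
    moreover have "d * norm (M j j) \<le> e"
    proof -
      have "d * norm (M j j) \<le> d * (norm (M j j) + 1)" using \<open>d > 0\<close> by (intro mult_left_mono) auto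
      also have "\<dots> = e" using n1 by (simp add: d_def)
      finally show ?thesis .
    qed
    ultimately show "(norm (M i j))\<^sup>2 \<le> norm (M i i) * norm (M j j) + e"
      using *[of "norm (M i i) + d"] by (simp add: add_nonneg_pos distrib_right)
  qed
qed

lemma npos_inverse_sqrt:
  fixes a :: "'a::unital_cstar_algebra"
  assumes "npos a" "e > 0"
  shows "\<exists>w. star w = w \<and> (a + e *\<^sub>R 1) * (w * w) = 1 \<and> (w * w) * (a + e *\<^sub>R 1) = 1 \<and>
    w * (a + e *\<^sub>R 1) * w = 1"
proof -
  define P where "P = a + e *\<^sub>R 1"
  have "npos P" unfolding P_def using assms by (intro npos_add npos_scaleR) auto
  then obtain s where s: "star s = s" "s * s = P" using sqrt_exists by blast
  obtain v where v: "v * P = 1" "P * v = 1" using npos_add_invertible[OF assms] P_def by blast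
  have sv: "s * v = v * s" by (rule inverse_commute[OF v]) (simp add: mult.assoc flip: s(2))
  have vs: "star v = v" using sa_inverse[OF _ v] npos_star[OF \<open>npos P\<close>] by blast
  have 1: "star (s * v) = s * v" using sv s vs by (simp add: star_mult)
  have 2: "(s * v) * (s * v) = v"
    by (metis mult.assoc mult.left_neutral s(2) sv v(1))
  have 3: "(s * v) * P * (s * v) = 1"
    by (metis mult.assoc mult.right_neutral s(2) sv v(1) v(2))
  show ?thesis using 1 2 3 v unfolding P_def by (intro exI[of _ "s * v"]) auto
qed

lemma qform_Suc:
  "qform (Suc n) M b = qform n M b + (\<Sum>i<n. star (b i) * M i n) * b n
    + star (b n) * (\<Sum>j<n. M n j * b j) + star (b n) * M n n * b n"
  by (simp add: qform_def sum.distrib sum_distrib_left sum_distrib_right mult.assoc)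

text \<open>Cholesky decomposition: a form bounded below can be eliminated one index at a time by
  Schur complements, so that square roots are only needed in the algebra itself.\<close>

lemma cholesky:
  fixes M :: "nat \<Rightarrow> nat \<Rightarrow> 'a::unital_cstar_algebra"
  assumes "e > 0" "\<And>b. npos (qform N M b - e *\<^sub>R (\<Sum>i<N. star (b i) * b i))"
  shows "mat_positive N M"
  using assms(2)
proof (induction N arbitrary: M)
  case 0
  then show ?case by (simp add: mat_positive_def)
next
  case (Suc n)
  have "npos (e *\<^sub>R (\<Sum>i<Suc n. star (b i) * b i))" for b :: "nat \<Rightarrow> 'a"
    using assms(1) by (intro npos_scaleR npos_sum npos_star_mult) auto
  then have "npos (qform (Suc n) M b)" for b
    using npos_add[OF Suc.prems[of b], of "e *\<^sub>R (\<Sum>i<Suc n. star (b i) * b i)"]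
    by (simp only: diff_add_cancel)
  then have pf: "posform (Suc n) M" by (auto simp: posform_def)
  have her: "M j i = star (M i j)" if "i \<le> n" "j \<le> n" for i j
    by (rule posform_hermitian[OF pf]) (use that in auto)
  let ?d = "\<lambda>i. if i = n then 1 else 0 :: 'a"
  have "npos (qform (Suc n) M ?d - e *\<^sub>R (\<Sum>i<Suc n. star (?d i) * ?d i))" by (rule Suc.prems)
  moreover have "qform (Suc n) M ?d = M n n" by (simp add: qform_def star_simps)
  ultimately have "npos (M n n - e *\<^sub>R 1)" by (simp add: star_simps)
  from npos_inverse_sqrt[OF this assms(1)]
  obtain w where w: "star w = w" "M n n * (w * w) = 1" "(w * w) * M n n = 1" by auto
  define v where "v = w * w"
  have v: "star v = v" "M n n * v = 1" "v * M n n = 1" using w by (simp_all add: v_def star_simps)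
  define M' where "M' = (\<lambda>i j. M i j - M i n * v * M n j)"
  have "mat_positive n M'"
  proof (rule Suc.IH)
    fix b :: "nat \<Rightarrow> 'a"
    define c where "c = (\<Sum>j<n. M n j * b j)"
    define b' where "b' = b(n := - (v * c))"
    have sc: "(\<Sum>i<n. star (b i) * M i n) = star c"
      unfolding c_def star_sum
    proof (rule sum.cong[OF refl])
      fix i assume "i \<in> {..<n}"
      then have "M i n = star (M n i)" by (intro her) auto
      then show "star (b i) * M i n = star (M n i * b i)" by (simp only: star_mult)
    qed
    have bi: "\<And>i. i < n \<Longrightarrow> b' i = b i" and bn: "b' n = - (v * c)" by (auto simp: b'_def)
    have "qform (Suc n) M b' = qform n M b + (\<Sum>i<n. star (b i) * M i n) * b' n
        + star (b' n) * c + star (b' n) * M n n * b' n"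
      unfolding qform_Suc c_def by (simp add: bi qform_def)
    also have "\<dots> = qform n M b - star c * v * c"
    proof -
      have "star c * v * M n n * v * c = star c * v * c" by (metis mult.assoc mult.right_neutral v(2))
      then show ?thesis unfolding sc bn by (simp add: star_minus star_mult v(1) mult.assoc)
    qed
    also have "star c * v * c = qform n (\<lambda>i j. M i n * v * M n j) b"
      unfolding sc[symmetric] unfolding c_def qform_def
      by (simp add: sum_distrib_left sum_distrib_right mult.assoc) (rule sum.swap)
    also have "qform n M b - \<dots> = qform n M' b"
      by (simp add: qform_def M'_def algebra_simps sum_subtractf)
    finally have q: "qform (Suc n) M b' = qform n M' b" .
    have "npos (qform n M' b - e *\<^sub>R ((\<Sum>i<n. star (b i) * b i) + star (b' n) * b' n))"
      using Suc.prems[of b'] bi by (simp add: q)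
    from npos_add[OF this npos_scaleR[OF npos_star_mult[of "b' n"], of e]]
    show "npos (qform n M' b - e *\<^sub>R (\<Sum>i<n. star (b i) * b i))"
      using assms(1) by (simp add: algebra_simps)
  qed
  then obtain Y where Y: "\<And>i j. i < n \<Longrightarrow> j < n \<Longrightarrow> M' i j = (\<Sum>k<n. star (Y k i) * Y k j)"
    unfolding mat_positive_def by blast
  define Z where "Z = (\<lambda>k i. if k = n then w * M n i else if i < n then Y k i else 0)"
  show ?case unfolding mat_positive_def
  proof (intro exI[of _ Z] allI impI)
    fix i j assume ij: "i < Suc n" "j < Suc n"
    have "star (Z n i) * Z n j = M i n * v * M n j"
      using ij by (simp add: Z_def star_mult w(1) v_def her[of n i, symmetric] mult.assoc)
    then have *: "(\<Sum>k<Suc n. star (Z k i) * Z k j) = (\<Sum>k<n. star (Z k i) * Z k j) + M i n * v * M n j"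
      by simp
    show "M i j = (\<Sum>k<Suc n. star (Z k i) * Z k j)"
    proof (cases "i < n \<and> j < n")
      case True
      then have "(\<Sum>k<n. star (Z k i) * Z k j) = M' i j" by (simp add: Z_def Y)
      then show ?thesis unfolding * by (simp add: M'_def)
    next
      case False
      then have "(\<Sum>k<n. star (Z k i) * Z k j) = 0" by (intro sum.neutral) (auto simp: Z_def star_zero)
      moreover have "M i n * v * M n j = M i j"
      proof (cases "i = n")
        case False
        then have "j = n" using ij \<open>\<not> (i < n \<and> j < n)\<close> by auto
        then show ?thesis by (simp add: mult.assoc v)
      qed (simp add: v)
      ultimately show ?thesis unfolding * by simp
    qed
  qed
qed

lemma posform_add_diag_mat_positive:
  assumes "posform N M" "e > 0"
  shows "mat_positive N (\<lambda>i j. M i j + (if i = j then e *\<^sub>R 1 else 0))"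
proof (rule cholesky[OF assms(2)])
  fix b :: "nat \<Rightarrow> 'a"
  have "qform N (\<lambda>i j. if i = j then e *\<^sub>R 1 else 0) b = e *\<^sub>R (\<Sum>i<N. star (b i) * b i)"
    by (simp add: qform_def if_distrib[of "\<lambda>x. _ * x"] if_distrib[of "\<lambda>x. x * _"] scaleR_sum_right cong: if_cong)
  then show "npos (qform N (\<lambda>i j. M i j + (if i = j then e *\<^sub>R 1 else 0)) b - e *\<^sub>R (\<Sum>i<N. star (b i) * b i))"
    using assms(1) by (simp add: qform_add posform_def)
qed

lemma mat_positive_norm_factor:
  fixes N :: nat
  assumes "\<forall>i<N. \<forall>j<N. M i j = (\<Sum>k<N. star (Y k i) * Y k j)" "k < N" "i < N"
  shows "(norm (Y k i))\<^sup>2 \<le> norm (M i i)"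
proof -
  have "M i i = (\<Sum>k<N. star (Y k i) * Y k i)" using assms by blast
  also have "\<dots> = star (Y k i) * Y k i + (\<Sum>k\<in>{..<N} - {k}. star (Y k i) * Y k i)"
    by (rule sum.remove) (use assms(2) in auto)
  finally have "M i i = star (Y k i) * Y k i + (\<Sum>k\<in>{..<N} - {k}. star (Y k i) * Y k i)" .
  then have "npos (M i i - star (Y k i) * Y k i)" by (simp add: npos_sum npos_star_mult)
  then show ?thesis using npos_norm_mono[OF npos_star_mult] by (metis cstar_identity)
qed

lemma posform_limit:
  assumes "\<And>i j. i < N \<Longrightarrow> j < N \<Longrightarrow> ((\<lambda>m. M m i j) \<longlongrightarrow> L i j) F"
    and "\<forall>\<^sub>F m in F. posform N (M m)" "F \<noteq> bot"
  shows "posform N L"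
  unfolding posform_def
proof
  fix b
  have "((\<lambda>m. qform N (M m) b) \<longlongrightarrow> qform N L b) F"
    unfolding qform_def by (intro tendsto_intros assms(1)) auto
  then show "npos (qform N L b)"
    by (rule npos_limit) (use assms(2,3) in \<open>auto simp: posform_def elim: eventually_mono\<close>)
qed

section \<open>Completely positive Banach limits: injective algebras\<close>

text \<open>Positivity of matrices is only required for almost all terms, so that finitely many terms do not
  matter.\<close>

definition gen_limit :: "((nat \<Rightarrow> 'b::unital_cstar_algebra) \<Rightarrow> 'b) \<Rightarrow> bool" where
  "gen_limit \<Psi> \<longleftrightarrow>
     (\<forall>f g. Bseq f \<and> Bseq g \<longrightarrow> \<Psi> (\<lambda>m. f m + g m) = \<Psi> f + \<Psi> g) \<and>
     (\<forall>c f. Bseq f \<longrightarrow> \<Psi> (\<lambda>m. c *\<^sub>C f m) = c *\<^sub>C \<Psi> f) \<and>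
     (\<forall>b. \<Psi> (\<lambda>_. b) = b) \<and>
     (\<forall>N M. (\<forall>i<N. \<forall>j<N. Bseq (\<lambda>m. M m i j)) \<and> (\<forall>\<^sub>F m in sequentially. posform N (M m))
        \<longrightarrow> posform N (\<lambda>i j. \<Psi> (\<lambda>m. M m i j)))"

lemma Bseq_add_seq:
  fixes f g :: "nat \<Rightarrow> 'v::real_normed_vector"
  assumes "Bseq f" "Bseq g"
  shows "Bseq (\<lambda>m. f m + g m)"
proof -
  obtain K K' where "\<And>m. norm (f m) \<le> K" "\<And>m. norm (g m) \<le> K'" using assms unfolding Bseq_def by metis
  then show ?thesis by (intro BseqI'[of _ "K + K'"] norm_triangle_le add_mono)
qed

lemma Bseq_scaleR_seq:
  fixes f :: "nat \<Rightarrow> 'v::real_normed_vector"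
  assumes "Bseq f"
  shows "Bseq (\<lambda>m. r *\<^sub>R f m)"
proof -
  obtain K where "\<And>m. norm (f m) \<le> K" using assms unfolding Bseq_def by metis
  then show ?thesis by (intro BseqI'[of _ "\<bar>r\<bar> * K"]) (simp add: mult_left_mono)
qed

lemma Bseq_diff_seq:
  fixes f g :: "nat \<Rightarrow> 'v::real_normed_vector"
  assumes "Bseq f" "Bseq g"
  shows "Bseq (\<lambda>m. f m - g m)"
  using Bseq_add_seq[OF assms(1) Bseq_scaleR_seq[OF assms(2), of "-1"]] by simp

lemma Bseq_sum_seq:
  fixes f :: "'k \<Rightarrow> nat \<Rightarrow> 'v::real_normed_vector"
  assumes "\<And>k. k \<in> I \<Longrightarrow> Bseq (f k)"
  shows "Bseq (\<lambda>m. \<Sum>k\<in>I. f k m)"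
  using assms by (induction I rule: infinite_finite_induct) (auto intro: Bseq_add_seq)

lemmas Bseq_seq = Bseq_add_seq Bseq_scaleR_seq Bseq_diff_seq Bseq_sum_seq

definition linf :: "('i \<Rightarrow> 'b::unital_cstar_algebra) cstar_struct" where
  "linf = \<lparr>carrier = {f. \<exists>B. \<forall>x. norm (f x) \<le> B}, mult = (\<lambda>f g x. f x * g x), one = (\<lambda>_. 1),
     zero = (\<lambda>_. 0), add = (\<lambda>f g x. f x + g x), cs_scale = (\<lambda>c f x. c *\<^sub>C f x),
     cs_star = (\<lambda>f x. star (f x)), cs_norm = (\<lambda>f. SUP x. norm (f x))\<rparr>"

lemma linf_simps:
  "carrier linf = {f. \<exists>B. \<forall>x. norm (f x) \<le> B}"
  "f \<otimes>\<^bsub>linf\<^esub> g = (\<lambda>x. f x * g x)" "\<one>\<^bsub>linf\<^esub> = (\<lambda>_. 1)" "\<zero>\<^bsub>linf\<^esub> = (\<lambda>_. 0)"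
  "f \<oplus>\<^bsub>linf\<^esub> g = (\<lambda>x. f x + g x)" "cs_scale linf c f = (\<lambda>x. c *\<^sub>C f x)"
  "cs_star linf f = (\<lambda>x. star (f x))" "cs_norm linf f = (SUP x. norm (f x))"
  by (simp_all add: linf_def)

lemma linf_carrierI: "(\<And>x. norm (f x) \<le> B) \<Longrightarrow> f \<in> carrier linf"
  by (auto simp: linf_simps)

lemma linf_norm_bound: "f \<in> carrier linf \<Longrightarrow> norm (f x) \<le> cs_norm linf f"
  by (auto simp: linf_simps intro!: cSUP_upper bdd_aboveI)

lemma linf_norm_le: "(\<And>x. norm (f x) \<le> t) \<Longrightarrow> cs_norm linf f \<le> t"
  by (auto simp: linf_simps intro!: cSUP_least)

lemma linf_closed:
  assumes "f \<in> carrier linf" "g \<in> carrier linf"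
  shows "(\<lambda>x. f x + g x) \<in> carrier linf" "(\<lambda>x. f x * g x) \<in> carrier linf" "(\<lambda>x. - f x) \<in> carrier linf"
    "(\<lambda>x. c *\<^sub>C f x) \<in> carrier linf" "(\<lambda>x. star (f x)) \<in> carrier linf" "(\<lambda>x. f x - g x) \<in> carrier linf"
proof -
  note nf = linf_norm_bound[OF assms(1)] and ng = linf_norm_bound[OF assms(2)]
  show "(\<lambda>x. f x + g x) \<in> carrier linf"
    by (rule linf_carrierI, rule norm_triangle_le, rule add_mono[OF nf ng])
  show "(\<lambda>x. f x - g x) \<in> carrier linf"
    by (rule linf_carrierI, rule order_trans[OF norm_triangle_ineq4 add_mono[OF nf ng]])
  show "(\<lambda>x. f x * g x) \<in> carrier linf"
    by (rule linf_carrierI, rule order_trans[OF norm_mult_ineq mult_mono[OF nf ng]])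
      (use norm_ge_zero nf order_trans in \<open>blast+\<close>)
  show "(\<lambda>x. - f x) \<in> carrier linf" "(\<lambda>x. star (f x)) \<in> carrier linf"
    by (rule linf_carrierI[of _ "cs_norm linf f"], simp add: nf norm_star)+
  show "(\<lambda>x. c *\<^sub>C f x) \<in> carrier linf"
    by (rule linf_carrierI[of _ "cmod c * cs_norm linf f"]) (simp add: nf norm_scaleC mult_left_mono)
qed

lemma linf_const: "(\<lambda>_. b) \<in> carrier linf"
  by (rule linf_carrierI[of _ "norm b"]) simp

lemma linf_ring: "ring (linf :: ('i \<Rightarrow> 'b::unital_cstar_algebra) cstar_struct)"
proof (rule ringI)
  show "abelian_group (linf :: ('i \<Rightarrow> 'b) cstar_struct)"
  proof (rule abelian_groupI)
    fix f :: "'i \<Rightarrow> 'b" assume "f \<in> carrier linf"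
    then show "\<exists>g\<in>carrier linf. g \<oplus>\<^bsub>linf\<^esub> f = \<zero>\<^bsub>linf\<^esub>"
      by (intro bexI[of _ "\<lambda>x. - f x"]) (auto simp: linf_simps(2-) intro: linf_closed)
  qed (simp_all only: linf_simps(2-) linf_closed linf_const ac_simps add_0_left)
  show "Group.monoid (linf :: ('i \<Rightarrow> 'b) cstar_struct)"
    by (rule Group.monoidI)
      (simp_all only: linf_simps(2-) linf_closed linf_const mult.assoc mult_1_left mult_1_right)
qed (simp_all only: linf_simps(2-) distrib_left distrib_right)

lemma linf_minus:
  fixes f g :: "'i \<Rightarrow> 'b::unital_cstar_algebra"
  assumes "f \<in> carrier linf" "g \<in> carrier linf"
  shows "f \<ominus>\<^bsub>linf\<^esub> g = (\<lambda>x. f x - g x)"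
proof -
  interpret ring "linf :: ('i \<Rightarrow> 'b) cstar_struct" by (rule linf_ring)
  have "\<ominus>\<^bsub>linf\<^esub> g = (\<lambda>x. - g x)"
    by (rule minus_equality) (auto simp: linf_simps(2-) assms linf_closed(3)[OF assms(2,2)])
  then show ?thesis by (simp add: a_minus_def linf_simps(2-))
qed

lemma linf_finsum:
  fixes F :: "'k \<Rightarrow> 'i \<Rightarrow> 'b::unital_cstar_algebra"
  assumes "finite A" "\<And>k. k \<in> A \<Longrightarrow> F k \<in> carrier linf"
  shows "(\<Oplus>\<^bsub>linf\<^esub>k\<in>A. F k) = (\<lambda>x. \<Sum>k\<in>A. F k x)"
proof -
  interpret ring "linf :: ('i \<Rightarrow> 'b) cstar_struct" by (rule linf_ring)
  show ?thesis using assms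
  proof (induction A)
    case empty
    show ?case by (simp only: finsum_empty sum.empty linf_simps(4))
  next
    case (insert k A)
    have "(\<Oplus>\<^bsub>linf\<^esub>k\<in>insert k A. F k) = F k \<oplus>\<^bsub>linf\<^esub> (\<Oplus>\<^bsub>linf\<^esub>k\<in>A. F k)"
      using insert by (intro finsum_insert) auto
    then show ?case using insert by (simp add: linf_simps(5))
  qed
qed

lemma linf_complete:
  fixes s :: "nat \<Rightarrow> 'i \<Rightarrow> 'b::unital_cstar_algebra"
  assumes s: "\<And>n. s n \<in> carrier linf"
    and cau: "\<forall>e>0. \<exists>N::nat. \<forall>m\<ge>N. \<forall>n\<ge>N. cs_norm linf (s m \<ominus>\<^bsub>linf\<^esub> s n) < e"
  shows "\<exists>l\<in>carrier linf. (\<lambda>n. cs_norm linf (s n \<ominus>\<^bsub>linf\<^esub> l)) \<longlonglongrightarrow> 0"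
proof -
  have pt: "norm (s m x - s n x) \<le> cs_norm linf (s m \<ominus>\<^bsub>linf\<^esub> s n)" for m n x
    using linf_norm_bound[of "\<lambda>x. s m x - s n x" x] by (simp add: linf_minus s linf_closed)
  have "Cauchy (\<lambda>n. s n x)" for x
  proof (rule CauchyI)
    fix e :: real assume "e > 0"
    with cau show "\<exists>M. \<forall>m\<ge>M. \<forall>n\<ge>M. norm (s m x - s n x) < e" by (meson pt order_le_less_trans)
  qed
  then have "\<exists>l. \<forall>x. (\<lambda>n. s n x) \<longlonglongrightarrow> l x"
    by (intro choice allI) (meson Cauchy_convergent convergentD)
  then obtain l where l: "\<And>x. (\<lambda>n. s n x) \<longlonglongrightarrow> l x" by blast
  have close: "\<exists>N. \<forall>n\<ge>N. \<forall>x. norm (s n x - l x) \<le> e" if e: "e > 0" for e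
  proof -
    obtain N where N: "\<And>m n. m \<ge> N \<Longrightarrow> n \<ge> N \<Longrightarrow> cs_norm linf (s m \<ominus>\<^bsub>linf\<^esub> s n) < e"
      using cau e by blast
    have "norm (s n x - l x) \<le> e" if n: "n \<ge> N" for n x
    proof (rule LIMSEQ_le_const2)
      show "(\<lambda>m. norm (s n x - s m x)) \<longlonglongrightarrow> norm (s n x - l x)" by (intro tendsto_intros l)
      show "\<exists>M. \<forall>m\<ge>M. norm (s n x - s m x) \<le> e"
        using N[OF n] pt by (meson less_imp_le order_trans)
    qed
    then show ?thesis by blast
  qed
  obtain N where N: "\<And>x. norm (s N x - l x) \<le> 1" using close[of 1] by auto
  have "norm (l x) \<le> cs_norm linf (s N) + 1" for x
    using linf_norm_bound[OF s, of N x] N[of x] norm_triangle_ineq4[of "s N x" "s N x - l x"] by simp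
  then have lc: "l \<in> carrier linf" by (rule linf_carrierI)
  have "(\<lambda>n. cs_norm linf (s n \<ominus>\<^bsub>linf\<^esub> l)) \<longlonglongrightarrow> 0"
  proof (rule LIMSEQ_I)
    fix e :: real assume e: "e > 0"
    obtain N where N: "\<And>n x. n \<ge> N \<Longrightarrow> norm (s n x - l x) \<le> e / 2" using close[of "e/2"] e by auto
    have "norm (cs_norm linf (s n \<ominus>\<^bsub>linf\<^esub> l) - 0) < e" if "n \<ge> N" for n
    proof -
      have "cs_norm linf (\<lambda>x. s n x - l x) \<le> e / 2" using N that by (intro linf_norm_le) auto
      moreover have "0 \<le> cs_norm linf (\<lambda>x. s n x - l x)"
        using linf_norm_bound[OF linf_closed(6)[OF s lc]] norm_ge_zero order_trans by blast
      ultimately show ?thesis using e by (simp add: linf_minus s lc)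
    qed
    then show "\<exists>N. \<forall>n\<ge>N. norm (cs_norm linf (s n \<ominus>\<^bsub>linf\<^esub> l) - 0) < e" by blast
  qed
  then show ?thesis using lc by blast
qed

lemma linf_norm_eqI:
  assumes "\<And>x. norm (f x) \<le> t" "\<And>u. (\<And>x. norm (f x) \<le> u) \<Longrightarrow> t \<le> u"
  shows "cs_norm linf f = t"
  by (rule antisym) (auto intro!: linf_norm_le assms linf_norm_bound linf_carrierI[of f t])

lemma linf_cstar: "cstar_structure (linf :: ('i \<Rightarrow> 'b::unital_cstar_algebra) cstar_struct)"
proof -
  have nn: "0 \<le> cs_norm linf f" if "f \<in> carrier linf" for f :: "'i \<Rightarrow> 'b"
    using linf_norm_bound[OF that] norm_ge_zero order_trans by blast
  have z: "cs_norm linf f = 0 \<longleftrightarrow> f = \<zero>\<^bsub>linf\<^esub>" if "f \<in> carrier linf" for f :: "'i \<Rightarrow> 'b"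
  proof
    assume "cs_norm linf f = 0"
    then have "\<And>x. norm (f x) \<le> 0" using linf_norm_bound[OF that] by metis
    then show "f = \<zero>\<^bsub>linf\<^esub>" by (auto simp: linf_simps(4))
  next
    assume "f = \<zero>\<^bsub>linf\<^esub>"
    then have "cs_norm linf f \<le> 0" by (intro linf_norm_le) (simp add: linf_simps(4))
    then show "cs_norm linf f = 0" using nn[OF that] by simp
  qed
  have sc: "cs_norm linf (cs_scale linf c f) = cmod c * cs_norm linf f" if "f \<in> carrier linf" for c and f :: "'i \<Rightarrow> 'b"
  proof (rule linf_norm_eqI)
    show "norm (cs_scale linf c f x) \<le> cmod c * cs_norm linf f" for x
      using linf_norm_bound[OF that] by (simp add: linf_simps(6) norm_scaleC mult_left_mono)
    fix u assume u: "\<And>x. norm (cs_scale linf c f x) \<le> u"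
    then have u': "\<And>x. cmod c * norm (f x) \<le> u" by (simp add: linf_simps(6) norm_scaleC)
    show "cmod c * cs_norm linf f \<le> u"
    proof (cases "c = 0")
      case True
      then show ?thesis using u'[of undefined] by simp
    next
      case False
      then have "cs_norm linf f \<le> u / cmod c" using u' by (intro linf_norm_le) (simp add: field_simps)
      then show ?thesis using False by (simp add: field_simps)
    qed
  qed
  have add: "cs_norm linf (f \<oplus>\<^bsub>linf\<^esub> g) \<le> cs_norm linf f + cs_norm linf g"
    if "f \<in> carrier linf" "g \<in> carrier linf" for f g :: "'i \<Rightarrow> 'b"
    by (rule linf_norm_le) (simp only: linf_simps(5), rule norm_triangle_le, rule add_mono[OF linf_norm_bound[OF that(1)] linf_norm_bound[OF that(2)]])
  have mlt: "cs_norm linf (f \<otimes>\<^bsub>linf\<^esub> g) \<le> cs_norm linf f * cs_norm linf g"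
    if "f \<in> carrier linf" "g \<in> carrier linf" for f g :: "'i \<Rightarrow> 'b"
    by (rule linf_norm_le) (simp only: linf_simps(2), rule order_trans[OF norm_mult_ineq
      mult_mono[OF linf_norm_bound[OF that(1)] linf_norm_bound[OF that(2)] nn[OF that(1)] norm_ge_zero]])
  have cs: "cs_norm linf (cs_star linf f \<otimes>\<^bsub>linf\<^esub> f) = (cs_norm linf f)\<^sup>2"
    if "f \<in> carrier linf" for f :: "'i \<Rightarrow> 'b"
  proof (rule linf_norm_eqI)
    have e: "norm ((cs_star linf f \<otimes>\<^bsub>linf\<^esub> f) x) = (norm (f x))\<^sup>2" for x
      by (simp add: linf_simps(2-) cstar_identity)
    show "norm ((cs_star linf f \<otimes>\<^bsub>linf\<^esub> f) x) \<le> (cs_norm linf f)\<^sup>2" for x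
      unfolding e by (intro power_mono linf_norm_bound that norm_ge_zero)
    fix u assume u: "\<And>x. norm ((cs_star linf f \<otimes>\<^bsub>linf\<^esub> f) x) \<le> u"
    then have "cs_norm linf f \<le> sqrt u" unfolding e by (intro linf_norm_le real_le_rsqrt)
    moreover have "u \<ge> 0" using u norm_ge_zero order_trans by blast
    ultimately show "(cs_norm linf f)\<^sup>2 \<le> u" using nn[OF that]
      by (metis power_mono real_sqrt_pow2)
  qed
  show ?thesis unfolding cstar_structure_def
  proof (intro conjI allI ballI impI linf_ring)
    fix s :: "nat \<Rightarrow> 'i \<Rightarrow> 'b"
    assume "(\<forall>n. s n \<in> carrier linf) \<and> (\<forall>e>0. \<exists>N::nat. \<forall>m\<ge>N. \<forall>n\<ge>N. cs_norm linf (s m \<ominus>\<^bsub>linf\<^esub> s n) < e)"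
    then show "\<exists>l\<in>carrier linf. (\<lambda>n. cs_norm linf (s n \<ominus>\<^bsub>linf\<^esub> l)) \<longlonglongrightarrow> 0"
      using linf_complete by blast
  qed (simp_all add: nn z sc add mlt cs, simp_all only: linf_simps(2-) linf_closed scaleC_add_right scaleC_add_left
      scaleC_scaleC scaleC_one mult_scaleC_left mult_scaleC_right star_simps)
qed

lemma mat_positive_in_linf:
  fixes X :: "nat \<Rightarrow> nat \<Rightarrow> 'i \<Rightarrow> 'b::unital_cstar_algebra"
  assumes X: "\<And>i. i < n \<Longrightarrow> X i i \<in> carrier linf"
    and pos: "\<And>x. mat_positive n (\<lambda>i j. X i j x)"
  shows "mat_positive_in linf n X"
proof -
  have "\<exists>Y. \<forall>x. \<forall>i<n. \<forall>j<n. X i j x = (\<Sum>k<n. star (Y x k i) * Y x k j)"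
    using pos unfolding mat_positive_def by (intro choice allI)
  then obtain Y where Y: "\<And>x. \<forall>i<n. \<forall>j<n. X i j x = (\<Sum>k<n. star (Y x k i) * Y x k j)" by blast
  define Z where "Z = (\<lambda>k i x. Y x k i)"
  have Zc: "Z k i \<in> carrier linf" if "k < n" "i < n" for k i
  proof (rule linf_carrierI)
    fix x
    have "(norm (Y x k i))\<^sup>2 \<le> norm (X i i x)"
      using mat_positive_norm_factor[of n "\<lambda>i j. X i j x" "Y x", OF Y that] .
    also have "\<dots> \<le> cs_norm linf (X i i)" by (rule linf_norm_bound[OF X[OF that(2)]])
    finally show "norm (Z k i x) \<le> sqrt (cs_norm linf (X i i))" unfolding Z_def by (rule real_le_rsqrt)
  qed
  show ?thesis unfolding mat_positive_in_def
  proof (intro exI[of _ Z] conjI allI impI)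
    fix i j assume ij: "i < n" "j < n"
    have "(\<Oplus>\<^bsub>linf\<^esub>k\<in>{..<n}. cs_star linf (Z k i) \<otimes>\<^bsub>linf\<^esub> Z k j) = (\<lambda>x. \<Sum>k<n. star (Z k i x) * Z k j x)"
      by (subst linf_finsum) (auto simp: linf_simps(2-) ij intro!: linf_closed(2)[of "\<lambda>x. star (Z _ _ x)"] linf_closed(5) Zc)
    then show "X i j = (\<Oplus>\<^bsub>linf\<^esub>k\<in>{..<n}. cs_star linf (Z k i) \<otimes>\<^bsub>linf\<^esub> Z k j)"
      using Y ij by (auto simp: Z_def)
  qed (rule Zc)
qed

lemma mat_positive_in_linf_point:
  assumes "mat_positive_in linf n X"
  shows "mat_positive n (\<lambda>i j. X i j x)"
proof -
  obtain Y where Y: "\<forall>k<n. \<forall>i<n. Y k i \<in> carrier linf"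
    "\<forall>i<n. \<forall>j<n. X i j = (\<Oplus>\<^bsub>linf\<^esub>k\<in>{..<n}. cs_star linf (Y k i) \<otimes>\<^bsub>linf\<^esub> Y k j)"
    using assms unfolding mat_positive_in_def by blast
  show ?thesis unfolding mat_positive_def
  proof (intro exI[of _ "\<lambda>k i. Y k i x"] allI impI)
    fix i j assume ij: "i < n" "j < n"
    have "(\<Oplus>\<^bsub>linf\<^esub>k\<in>{..<n}. cs_star linf (Y k i) \<otimes>\<^bsub>linf\<^esub> Y k j) = (\<lambda>x. \<Sum>k<n. star (Y k i x) * Y k j x)"
      by (subst linf_finsum) (use Y(1) in \<open>auto simp: linf_simps(2-) ij intro!: linf_closed(2)[of "\<lambda>x. star (Y _ _ x)"] linf_closed(5)\<close>)
    then show "X i j x = (\<Sum>k<n. star (Y k i x) * Y k j x)" using Y(2) ij by simp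
  qed
qed

text \<open>For injective \<open>'b\<close> we extend the eventual value of eventually constant sequences: this is a
  completely positive map for trivial reasons, and it forgets finitely many terms. Sequences are
  functions on \<open>'b\<close> through \<open>of_nat\<close>.\<close>

definition ev_value :: "('b::unital_cstar_algebra \<Rightarrow> 'b) \<Rightarrow> 'b \<Rightarrow> bool" where
  "ev_value f c \<longleftrightarrow> (\<forall>\<^sub>F m in sequentially. f (of_nat m) = c)"

definition nat_ext :: "(nat \<Rightarrow> 'b::unital_cstar_algebra) \<Rightarrow> 'b \<Rightarrow> 'b" where
  "nat_ext f x = (if x \<in> range of_nat then f (inv_into UNIV of_nat x) else 0)"

lemma nat_ext_of_nat [simp]: "nat_ext f (of_nat m) = f m"
  by (simp add: nat_ext_def inv_f_f inj_of_nat)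

lemma nat_ext_carrier: "Bseq f \<Longrightarrow> nat_ext f \<in> carrier linf"
  by (auto simp: Bseq_def nat_ext_def linf_simps(1) intro: less_imp_le)

lemma ev_value_unique: "ev_value f c \<Longrightarrow> ev_value f d \<Longrightarrow> c = d"
  unfolding ev_value_def using eventually_happens[OF eventually_conj] by fastforce

lemma posform_zero: "posform N (\<lambda>i j. 0)"
  by (simp add: posform_def qform_def)

lemma gen_limit_injective:
  assumes inj: "injective_cstar_algebra TYPE('b::unital_cstar_algebra)"
  shows "\<exists>\<Psi> :: (nat \<Rightarrow> 'b) \<Rightarrow> 'b. gen_limit \<Psi>"
proof -
  let ?D = "linf :: ('b \<Rightarrow> 'b) cstar_struct"
  define S where "S = {f \<in> carrier ?D. \<exists>c. ev_value f c}"
  define \<psi> where "\<psi> = (\<lambda>f :: 'b \<Rightarrow> 'b. SOME c. ev_value f c)"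
  have \<psi>: "\<psi> f = c" if "ev_value f c" for f c
    unfolding \<psi>_def by (intro some_equality that) (rule ev_value_unique[OF _ that])
  have ev: "ev_value f (\<psi> f)" if "f \<in> S" for f using that \<psi> by (auto simp: S_def)
  have ev_add: "ev_value (\<lambda>x. f x + g x) (c + d)" if "ev_value f c" "ev_value g d" for f g :: "'b \<Rightarrow> 'b" and c d
    using that unfolding ev_value_def by eventually_elim simp
  have ev_scale: "ev_value (\<lambda>x. z *\<^sub>C f x) (z *\<^sub>C c)" if "ev_value f c" for z and f :: "'b \<Rightarrow> 'b" and c
    using that unfolding ev_value_def by eventually_elim simp
  have ev_star: "ev_value (\<lambda>x. star (f x)) (star c)" if "ev_value f c" for f :: "'b \<Rightarrow> 'b" and c
    using that unfolding ev_value_def by eventually_elim simp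
  have ev_const: "ev_value (\<lambda>_. c) c" for c :: 'b by (simp add: ev_value_def)
  have os: "operator_system ?D S"
    unfolding operator_system_def
    by (auto simp: S_def linf_simps(2-) intro: linf_closed linf_const ev_add ev_scale ev_star ev_const)
  have cp: "cp_on ?D S \<psi>"
    unfolding cp_on_def
  proof (intro conjI ballI allI impI)
    show "\<psi> (f \<oplus>\<^bsub>?D\<^esub> g) = \<psi> f + \<psi> g" if "f \<in> S" "g \<in> S" for f g
      using \<psi>[OF ev_add[OF ev[OF that(1)] ev[OF that(2)]]] by (simp add: linf_simps(5))
    show "\<psi> (cs_scale ?D c f) = c *\<^sub>C \<psi> f" if "f \<in> S" for c f
      using \<psi>[OF ev_scale[OF ev[OF that]]] by (simp add: linf_simps(6))
    fix n X assume X: "(\<forall>i<n. \<forall>j<n. X i j \<in> S) \<and> mat_positive_in ?D n X"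
    have "\<forall>\<^sub>F m in sequentially. \<forall>i\<in>{..<n}. \<forall>j\<in>{..<n}. X i j (of_nat m) = \<psi> (X i j)"
      using X ev unfolding ev_value_def by (intro eventually_ball_finite ballI) auto
    then obtain m where m: "\<And>i j. i < n \<Longrightarrow> j < n \<Longrightarrow> X i j (of_nat m) = \<psi> (X i j)"
      using eventually_happens by fastforce
    have "mat_positive n (\<lambda>i j. X i j (of_nat m))" using X by (intro mat_positive_in_linf_point) auto
    then show "mat_positive n (\<lambda>i j. \<psi> (X i j))" unfolding mat_positive_def using m by simp
  qed
  obtain \<Phi> where \<Phi>: "cp_on ?D (carrier ?D) \<Phi>" "\<And>s. s \<in> S \<Longrightarrow> \<Phi> s = \<psi> s"
    using inj linf_cstar os cp unfolding injective_cstar_algebra_def injective_over_def by blast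
  have \<Phi>_add: "\<Phi> (\<lambda>x. f x + g x) = \<Phi> f + \<Phi> g" if "f \<in> carrier ?D" "g \<in> carrier ?D" for f g
    using \<Phi>(1) that unfolding cp_on_def by (simp add: linf_simps(2-))
  have \<Phi>_scale: "\<Phi> (\<lambda>x. c *\<^sub>C f x) = c *\<^sub>C \<Phi> f" if "f \<in> carrier ?D" for c f
    using \<Phi>(1) that unfolding cp_on_def by (simp add: linf_simps(2-))
  have \<Phi>_ev: "\<Phi> f = c" if "ev_value f c" "f \<in> carrier ?D" for f c
    using \<Phi>(2)[of f] \<psi>[OF that(1)] that by (auto simp: S_def)
  define \<Psi> where "\<Psi> = (\<lambda>f. \<Phi> (nat_ext f))"
  have "posform N (\<lambda>i j. \<Psi> (\<lambda>m. M m i j))"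
    if bd: "\<forall>i<N. \<forall>j<N. Bseq (\<lambda>m. M m i j)" and pf: "\<forall>\<^sub>F m in sequentially. posform N (M m)" for N M
  proof -
    have *: "posform N (\<lambda>i j. \<Psi> (\<lambda>m. M m i j) + (if i = j then e *\<^sub>R 1 else 0))" if e: "e > 0" for e
    proof -
      define M' where "M' = (\<lambda>m i j. if posform N (M m) then M m i j else 0)"
      have pM': "posform N (M' m)" for m
        by (cases "posform N (M m)") (simp_all add: M'_def posform_zero)
      define d where "d = (\<lambda>i j::nat. if i = j then e *\<^sub>R 1 else (0::'b))"
      define X where "X = (\<lambda>i j x. nat_ext (\<lambda>m. M' m i j) x + d i j)"
      have bM': "Bseq (\<lambda>m. M' m i j)" if ij: "i < N" "j < N" for i j
      proof -
        obtain K where K: "K > 0" "\<And>m. norm (M m i j) \<le> K" using bd ij unfolding Bseq_def by blast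
        then show ?thesis by (intro BseqI[of K]) (auto simp: M'_def)
      qed
      have Xc: "X i j \<in> carrier ?D" if "i < N" "j < N" for i j
        unfolding X_def by (intro linf_closed(1) nat_ext_carrier bM' that linf_const)
      have "mat_positive N (\<lambda>i j. X i j x)" for x
        unfolding X_def d_def
      proof (rule posform_add_diag_mat_positive[OF _ e])
        show "posform N (\<lambda>i j. nat_ext (\<lambda>m. M' m i j) x)"
          by (cases "x \<in> range of_nat") (simp_all add: nat_ext_def pM' posform_zero)
      qed
      then have "mat_positive_in ?D N X" using Xc by (intro mat_positive_in_linf)
      then have "mat_positive N (\<lambda>i j. \<Phi> (X i j))" using \<Phi>(1) Xc unfolding cp_on_def by blast
      moreover have "\<Phi> (X i j) = \<Psi> (\<lambda>m. M m i j) + d i j" if ij: "i < N" "j < N" for i j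
      proof -
        define g where "g = (\<lambda>x. nat_ext (\<lambda>m. M' m i j) x - nat_ext (\<lambda>m. M m i j) x)"
        have bc: "nat_ext (\<lambda>m. M m i j) \<in> carrier ?D" using bd ij by (intro nat_ext_carrier) auto
        have gc: "g \<in> carrier ?D" unfolding g_def by (intro linf_closed(6) nat_ext_carrier bM' ij bc)
        have "ev_value g 0" unfolding ev_value_def g_def
          using pf by eventually_elim (simp add: M'_def)
        then have "\<Phi> g = 0" using \<Phi>_ev gc by blast
        moreover have "X i j = (\<lambda>x. (nat_ext (\<lambda>m. M m i j) x + g x) + d i j)"
          by (auto simp: X_def g_def)
        ultimately show ?thesis
          by (simp add: \<Phi>_add bc gc linf_closed(1) linf_const \<Phi>_ev[OF ev_const linf_const] \<Psi>_def)
      qed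
      ultimately show ?thesis using mat_positive_imp_posform posform_cong unfolding d_def
        by (smt (verit, ccfv_threshold))
    qed
    show ?thesis
    proof (rule posform_limit[of N "\<lambda>k i j. \<Psi> (\<lambda>m. M m i j) + (if i = j then (1 / Suc k) *\<^sub>R 1 else 0)" _ sequentially])
      fix i j
      have "(\<lambda>k. \<Psi> (\<lambda>m. M m i j) + (1 / Suc k) *\<^sub>R 1) \<longlonglongrightarrow> \<Psi> (\<lambda>m. M m i j) + 0 *\<^sub>R 1"
        by (intro tendsto_intros LIMSEQ_Suc lim_1_over_n)
      then show "(\<lambda>k. \<Psi> (\<lambda>m. M m i j) + (if i = j then (1 / Suc k) *\<^sub>R 1 else 0)) \<longlonglongrightarrow> \<Psi> (\<lambda>m. M m i j)"
        by (cases "i = j") auto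
      show "\<forall>\<^sub>F k in sequentially. posform N (\<lambda>i j. \<Psi> (\<lambda>m. M m i j) + (if i = j then (1 / Suc k) *\<^sub>R 1 else 0))"
        by (intro always_eventually allI *) simp
    qed simp
  qed
  moreover have "\<Psi> (\<lambda>m. f m + g m) = \<Psi> f + \<Psi> g" if "Bseq f" "Bseq g" for f g
  proof -
    have "nat_ext (\<lambda>m. f m + g m) = (\<lambda>x. nat_ext f x + nat_ext g x)" by (auto simp: nat_ext_def)
    then show ?thesis unfolding \<Psi>_def using \<Phi>_add[OF nat_ext_carrier nat_ext_carrier, OF that] by (simp only:)
  qed
  moreover have "\<Psi> (\<lambda>m. c *\<^sub>C f m) = c *\<^sub>C \<Psi> f" if "Bseq f" for c f
  proof -
    have "nat_ext (\<lambda>m. c *\<^sub>C f m) = (\<lambda>x. c *\<^sub>C nat_ext f x)" by (auto simp: nat_ext_def)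
    then show ?thesis unfolding \<Psi>_def using \<Phi>_scale[OF nat_ext_carrier, OF that] by (simp only:)
  qed
  moreover have "\<Psi> (\<lambda>_. b) = b" for b
    unfolding \<Psi>_def by (rule \<Phi>_ev) (auto simp: ev_value_def nat_ext_carrier)
  ultimately show ?thesis unfolding gen_limit_def by blast
qed

section \<open>Completely positive Banach limits: von Neumann algebras\<close>

definition ultrafilter_on_type :: "'i filter \<Rightarrow> bool" where
  "ultrafilter_on_type U \<longleftrightarrow> U \<noteq> bot \<and> (\<forall>P. eventually P U \<or> eventually (\<lambda>x. \<not> P x) U)"

lemma ultrafilter_exists:
  assumes "F \<noteq> (bot :: 'i filter)"
  shows "\<exists>U\<le>F. ultrafilter_on_type U"
proof -
  define A where "A = {G. G \<le> F \<and> G \<noteq> bot}"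
  have "\<exists>m\<in>A. \<forall>a\<in>A. m \<ge> a \<longrightarrow> a = m"
  proof (rule predicate_Zorn)
    show "partial_order_on A (relation_of (\<ge>) A)"
      by (rule partial_order_on_relation_ofI) auto
    fix C assume C: "C \<in> Chains (relation_of (\<ge>) A)"
    then have CA: "C \<subseteq> A" by (rule Chains_relation_of)
    show "\<exists>u\<in>A. \<forall>a\<in>C. a \<ge> u"
    proof (cases "C = {}")
      case True
      then show ?thesis using assms by (auto simp: A_def)
    next
      case False
      have "Inf C \<noteq> bot"
      proof (rule Inf_filter_not_bot)
        fix X assume X: "X \<subseteq> C" "finite X"
        show "Inf X \<noteq> bot"
        proof (cases "X = {}")
          case True
          have "F \<le> Inf X" unfolding True by simp
          then show ?thesis using assms bot.extremum_uniqueI by fastforce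
        next
          case False
          from X(2) False X(1) have "Inf X \<in> X"
          proof (induction X rule: finite_ne_induct)
            case (insert x X)
            then have "Inf X \<in> C" "x \<in> C" by auto
            then have "x \<le> Inf X \<or> Inf X \<le> x" using C by (auto simp: Chains_def relation_of_def)
            then show ?case using insert by (auto simp: inf_absorb1 inf_absorb2)
          qed simp
          then show ?thesis using X CA by (auto simp: A_def)
        qed
      qed
      moreover have "Inf C \<le> F" using False CA by (auto simp: A_def intro: Inf_lower2)
      ultimately show ?thesis by (auto simp: A_def intro!: bexI[of _ "Inf C"] Inf_lower)
    qed
  qed
  then obtain U where U: "U \<le> F" "U \<noteq> bot" "\<And>G. G \<le> F \<Longrightarrow> G \<noteq> bot \<Longrightarrow> G \<le> U \<Longrightarrow> G = U"
    unfolding A_def by blast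
  have "eventually P U \<or> eventually (\<lambda>x. \<not> P x) U" for P
  proof (rule disjCI)
    assume n: "\<not> eventually (\<lambda>x. \<not> P x) U"
    define G where "G = inf U (principal {x. P x})"
    have ev: "eventually Q G \<longleftrightarrow> eventually (\<lambda>x. P x \<longrightarrow> Q x) U" for Q
      unfolding G_def eventually_inf_principal by simp
    have "G \<noteq> bot" using n ev[of "\<lambda>_. False"] by (auto simp: trivial_limit_def)
    moreover have "G \<le> U" by (simp add: G_def)
    ultimately have "G = U" using U by (meson order_trans)
    then show "eventually P U" using ev[of P] by simp
  qed
  then show ?thesis using U unfolding ultrafilter_on_type_def by blast
qed

lemma ultrafilter_bounded_tendsto:
  fixes f :: "'i \<Rightarrow> complex"
  assumes U: "ultrafilter_on_type U" and bd: "\<And>i. norm (f i) \<le> C"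
  shows "\<exists>l. (f \<longlongrightarrow> l) U"
proof -
  have "filtermap f U \<noteq> bot" "eventually (\<lambda>x. x \<in> cball 0 C) (filtermap f U)"
    using U bd by (auto simp: ultrafilter_on_type_def filtermap_bot_iff eventually_filtermap)
  then obtain l where l: "inf (nhds l) (filtermap f U) \<noteq> bot"
    using compact_cball[of "0::complex" C] unfolding compact_filter by blast
  have "(f \<longlongrightarrow> l) U"
  proof (rule topological_tendstoI, rule ccontr)
    fix S assume S: "open S" "l \<in> S" and "\<not> eventually (\<lambda>x. f x \<in> S) U"
    then have "eventually (\<lambda>x. f x \<notin> S) U" using U unfolding ultrafilter_on_type_def by blast
    then have "eventually (\<lambda>x. x \<notin> S) (filtermap f U)" by (simp add: eventually_filtermap)
    moreover have "eventually (\<lambda>x. x \<in> S) (nhds l)" using S eventually_nhds by blast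
    ultimately have "eventually (\<lambda>_. False) (inf (nhds l) (filtermap f U))"
      unfolding eventually_inf by blast
    then show False using l by (simp add: trivial_limit_def)
  qed
  then show ?thesis by blast
qed

lemma cinner_add_left: "cinner (x + y) z = cinner x z + cinner y (z::'g::complex_hilbert_space)"
  by (metis cinner_add_right cinner_commute complex_cnj_add)

lemma cinner_scaleC_left: "cinner (c *\<^sub>C x) y = cnj c * cinner x (y::'g::complex_hilbert_space)"
  by (metis cinner_commute cinner_scaleC_right complex_cnj_mult)

lemma cinner_zero_right [simp]: "cinner x (0::'g::complex_hilbert_space) = 0"
  by (metis add_cancel_right_right cinner_add_right)

lemma cinner_zero_left [simp]: "cinner (0::'g::complex_hilbert_space) x = 0"
  by (metis add_cancel_right_right cinner_add_left)

lemma cinner_scaleR_right: "cinner x (r *\<^sub>R y) = of_real r * cinner x (y::'g::complex_hilbert_space)"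
  by (metis cinner_scaleC_right scaleC_of_real)

lemma cinner_scaleR_left: "cinner (r *\<^sub>R x) y = of_real r * cinner x (y::'g::complex_hilbert_space)"
  by (metis cinner_scaleC_left scaleC_of_real complex_cnj_complex_of_real)

lemma cinner_minus_right: "cinner x (- y) = - cinner x (y::'g::complex_hilbert_space)"
  by (metis add.right_inverse add_eq_0_iff cinner_add_right cinner_zero_right)

lemma cinner_minus_left: "cinner (- x) y = - cinner x (y::'g::complex_hilbert_space)"
  by (metis add.right_inverse add_eq_0_iff cinner_add_left cinner_zero_left)

lemma cinner_diff_right: "cinner x (y - z) = cinner x y - cinner x (z::'g::complex_hilbert_space)"
  by (metis cinner_add_right cinner_minus_right diff_conv_add_uminus)

lemma cinner_diff_left: "cinner (x - y) z = cinner x z - cinner y (z::'g::complex_hilbert_space)"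
  by (metis cinner_add_left cinner_minus_left diff_conv_add_uminus)

lemmas cinner_simps = cinner_add_left cinner_add_right cinner_diff_left cinner_diff_right
  cinner_scaleC_left cinner_scaleC_right cinner_scaleR_left cinner_scaleR_right

lemma cinner_sum_right: "cinner x (\<Sum>i\<in>I. f i) = (\<Sum>i\<in>I. cinner x (f i :: 'g::complex_hilbert_space))"
  by (induction I rule: infinite_finite_induct) (auto simp: cinner_add_right)

lemma norm_add_sq:
  "(norm (x + y))\<^sup>2 = (norm x)\<^sup>2 + 2 * Re (cinner x y) + (norm (y::'g::complex_hilbert_space))\<^sup>2"
proof -
  have "complex_of_real ((norm (x + y))\<^sup>2) = cinner (x + y) (x + y)" by (simp only: cinner_self)
  also have "\<dots> = cinner x x + cinner x y + cinner y x + cinner y y" by (simp add: cinner_simps)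
  also have "\<dots> = complex_of_real ((norm x)\<^sup>2 + 2 * Re (cinner x y) + (norm y)\<^sup>2)"
    by (simp add: cinner_self cinner_commute[of y x] complex_eq_iff)
  finally show ?thesis by (simp only: of_real_eq_iff)
qed

lemma Re_cinner_le: "Re (cinner x y) \<le> norm x * norm (y::'g::complex_hilbert_space)"
proof (cases "norm x = 0 \<or> norm y = 0")
  case False
  have "0 \<le> (norm (norm y *\<^sub>R x - norm x *\<^sub>R y))\<^sup>2" by simp
  also have "\<dots> = 2 * (norm x * norm y) * (norm x * norm y - Re (cinner x y))"
    using norm_add_sq[of "norm y *\<^sub>R x" "- (norm x *\<^sub>R y)"]
    by (simp add: cinner_simps cinner_minus_right power2_eq_square algebra_simps)
  finally have "0 \<le> norm x * norm y - Re (cinner x y)"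
    using False by (metis mult_nonneg_nonneg mult_pos_pos norm_ge_zero order_less_le zero_le_mult_iff zero_less_numeral linorder_not_less)
  then show ?thesis by simp
qed auto

lemma cmod_cinner_le: "cmod (cinner x y) \<le> norm x * norm (y::'g::complex_hilbert_space)"
proof -
  obtain u where u: "cmod u = 1" "cmod (cinner x y) = u * cinner x y"
  proof (cases "cinner x y = 0")
    case False
    then show ?thesis
      by (intro that[of "cnj (cinner x y) / cmod (cinner x y)"])
        (auto simp: norm_divide complex_norm_square[symmetric] power2_eq_square mult.commute)
  qed (rule that[of 1], auto)
  have "cmod (cinner x y) = Re (cinner x (u *\<^sub>C y))" using u(2) by (metis Re_complex_of_real cinner_scaleC_right)
  also have "\<dots> \<le> norm x * norm (u *\<^sub>C y)" by (rule Re_cinner_le)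
  finally show ?thesis by (simp add: norm_scaleC u)
qed

lemma quadratic_nonneg_imp_zero:
  fixes a b :: real
  assumes "\<And>t. 0 \<le> t\<^sup>2 * a + 2 * t * b"
  shows "b = 0"
proof (rule ccontr)
  assume b: "b \<noteq> 0"
  define c where "c = \<bar>a\<bar> + 1"
  have c: "c > 0" "a < c" by (auto simp: c_def)
  have "0 \<le> (- b / c)\<^sup>2 * a + 2 * (- b / c) * b" by (rule assms)
  also have "\<dots> = (b\<^sup>2 / c) * (a / c - 2)" using c by (simp add: power2_eq_square field_simps)
  finally have "0 \<le> (b\<^sup>2 / c) * (a / c - 2)" .
  moreover have "b\<^sup>2 / c > 0" using b c by simp
  moreover have "a / c - 2 < 0" using c by (simp add: field_simps)
  ultimately show False by (metis mult_pos_neg not_le)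
qed

text \<open>The representing vector minimises \<open>|z|\<^sup>2 - 2 Re (f z)\<close>.\<close>

lemma riesz:
  fixes f :: "'g::complex_hilbert_space \<Rightarrow> complex"
  assumes add: "\<And>x y. f (x + y) = f x + f y" and scale: "\<And>c x. f (c *\<^sub>C x) = c * f x"
    and bd: "\<And>x. cmod (f x) \<le> C * norm x"
  shows "\<exists>z. \<forall>x. f x = cinner z x"
proof -
  have fR: "f (r *\<^sub>R x) = of_real r * f x" for r x by (metis scale scaleC_of_real)
  define J where "J = (\<lambda>z. (norm z)\<^sup>2 - 2 * Re (f z))"
  have lower: "J z \<ge> - C\<^sup>2" for z
  proof -
    have "Re (f z) \<le> C * norm z" using complex_Re_le_cmod bd order_trans by blast
    moreover have "0 \<le> (norm z - C)\<^sup>2" by simp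
    ultimately show ?thesis by (simp add: J_def power2_eq_square algebra_simps)
  qed
  have bb: "bdd_below (range J)" using lower by (intro bdd_belowI) auto
  define d where "d = Inf (range J)"
  have dJ: "d \<le> J z" for z unfolding d_def by (intro cInf_lower bb) auto
  have "\<exists>z. J z < d + 1 / Suc n" for n
    using cInf_lessD[of "range J" "d + 1 / Suc n"] by (auto simp: d_def)
  then obtain z where z: "\<And>n. J (z n) < d + 1 / Suc n" by metis
  have par: "(norm (x - y))\<^sup>2 = 2 * J x + 2 * J y - 4 * J ((1/2) *\<^sub>R (x + y))" for x y
  proof -
    have "(norm ((1/2) *\<^sub>R (x + y)))\<^sup>2 = (1/4) * (norm (x + y))\<^sup>2" by (simp add: power2_eq_square)
    then show ?thesis
      using norm_add_sq[of x y] norm_add_sq[of x "- y"]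
      by (simp add: J_def fR add cinner_minus_right algebra_simps)
  qed
  have cz: "(norm (z m - z n))\<^sup>2 \<le> 2 / Suc m + 2 / Suc n" for m n
    using par[of "z m" "z n"] z[of m] z[of n] dJ[of "(1/2) *\<^sub>R (z m + z n)"] by (simp add: algebra_simps)
  have "Cauchy z"
  proof (rule CauchyI)
    fix e :: real assume e: "e > 0"
    obtain M where M: "1 / Suc M < e\<^sup>2 / 4" using nat_approx_posE[of "e\<^sup>2/4"] e by auto
    have "norm (z m - z n) < e" if "m \<ge> M" "n \<ge> M" for m n
    proof -
      have "1 / Suc m \<le> 1 / real (Suc M)" "1 / Suc n \<le> 1 / real (Suc M)" using that by (auto simp: frac_le)
      then have "(norm (z m - z n))\<^sup>2 < e\<^sup>2" using cz[of m n] M by simp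
      then show ?thesis using e by (metis less_imp_le power_less_imp_less_base)
    qed
    then show "\<exists>M. \<forall>m\<ge>M. \<forall>n\<ge>M. norm (z m - z n) < e" by blast
  qed
  then obtain l where l: "z \<longlonglongrightarrow> l" using Cauchy_convergent convergentD by blast
  have "bounded_linear f"
    by (rule bounded_linear_intro[of _ C]) (simp_all add: add fR scaleR_conv_of_real bd mult.commute)
  then have "(\<lambda>n. f (z n)) \<longlonglongrightarrow> f l" using l by (rule bounded_linear.tendsto)
  then have "(\<lambda>n. J (z n)) \<longlonglongrightarrow> J l" unfolding J_def by (intro tendsto_intros l)
  moreover have "(\<lambda>n. d + 1 / Suc n) \<longlonglongrightarrow> d + 0"
    by (intro tendsto_intros LIMSEQ_Suc lim_1_over_n)
  ultimately have "J l \<le> d + 0" by (rule LIMSEQ_le) (use z less_imp_le in blast)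
  then have min: "J l \<le> J y" for y using dJ[of y] by simp
  have re: "Re (cinner l y) = Re (f y)" for y
  proof -
    have "0 \<le> t\<^sup>2 * (norm y)\<^sup>2 + 2 * t * (Re (cinner l y) - Re (f y))" for t
      using min[of "l + t *\<^sub>R y"] norm_add_sq[of l "t *\<^sub>R y"]
      by (simp add: J_def add fR cinner_simps power_mult_distrib algebra_simps)
    from quadratic_nonneg_imp_zero[OF this] show ?thesis by simp
  qed
  have "f y = cinner l y" for y
    using re[of y] re[of "\<i> *\<^sub>C y"] by (simp add: complex_eq_iff scale cinner_simps)
  then show ?thesis by blast
qed

text \<open>A minimiser of the distance to \<open>T\<close> on \<open>F\<close> is at distance zero, since the residual is almost
  orthogonal to the \<open>S m - S\<close> while \<open>S m\<close> tends to \<open>T\<close> weakly.\<close>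

lemma weak_limit_strong_closure:
  fixes T :: "'g::complex_hilbert_space \<Rightarrow> 'g"
  assumes affine: "\<And>A B t. A \<in> R \<Longrightarrow> B \<in> R \<Longrightarrow> (\<lambda>x. A x + t *\<^sub>R (B x - A x)) \<in> R"
    and S: "\<And>m. S m \<in> R" "\<And>m x. norm (S m x) \<le> C * norm x"
    and U: "U \<noteq> bot" "\<And>x y. ((\<lambda>m. cinner y (S m x)) \<longlongrightarrow> cinner y (T x)) U"
    and F: "finite F" and e: "e > 0"
  shows "\<exists>A\<in>R. \<forall>x\<in>F. norm (A x - T x) < e"
proof -
  define Q where "Q = (\<lambda>A. \<Sum>x\<in>F. (norm (A x - T x))\<^sup>2)"
  have Q0: "0 \<le> Q A" for A by (simp add: Q_def sum_nonneg)
  define d where "d = Inf (Q ` R)"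
  have bb: "bdd_below (Q ` R)" using Q0 by (intro bdd_belowI) auto
  have dQ: "d \<le> Q A" if "A \<in> R" for A unfolding d_def using that by (intro cInf_lower bb) auto
  have ne: "Q ` R \<noteq> {}" using S(1) by auto
  have d0: "d \<ge> 0" unfolding d_def using Q0 by (intro cInf_greatest ne) auto
  have ex: "\<exists>A\<in>R. Q A < d + b" if "b > 0" for b
    using cInf_lessD[OF ne, of "d + b"] that by (auto simp: d_def)
  have "d = 0"
  proof (rule ccontr)
    assume "d \<noteq> 0"
    then have dp: "d > 0" using d0 by simp
    define C' where "C' = (\<Sum>x\<in>F. (C * norm x + norm (T x))\<^sup>2)"
    have "norm (S m x - T x) \<le> C * norm x + norm (T x)" for m x
      using S(2)[of m x] norm_triangle_ineq4[of "S m x" "T x"] by linarith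
    then have QS: "Q (S m) \<le> C'" for m unfolding Q_def C'_def
      by (intro sum_mono power_mono norm_ge_zero)
    define N where "N = 2 * C' + 2 * (d + 1)"
    have N: "N > 0" using QS[of undefined] Q0[of "S undefined"] d0 by (simp add: N_def)
    define t where "t = d / (2 * N)"
    have t: "t > 0" using dp N by (simp add: t_def)
    define b where "b = min 1 (d * t / 2)"
    have b: "b > 0" "b \<le> 1" "b \<le> d * t / 2" using dp t by (auto simp: b_def)
    obtain A where A: "A \<in> R" "Q A < d + b" using ex[OF b(1)] by blast
    define B where "B = (\<lambda>m. \<Sum>x\<in>F. Re (cinner (A x - T x) (S m x - A x)))"
    have Bge: "- (3/4) * d \<le> B m" for m
    proof -
      have sq: "(\<Sum>x\<in>F. (norm (S m x - A x))\<^sup>2) \<le> N"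
      proof -
        have "(norm (S m x - A x))\<^sup>2 \<le> 2 * (norm (S m x - T x))\<^sup>2 + 2 * (norm (A x - T x))\<^sup>2" for x
        proof -
          define u v where "u = S m x - T x" and "v = A x - T x"
          have "S m x - A x = u + - v" by (simp add: u_def v_def)
          then have "(norm (S m x - A x))\<^sup>2 = (norm u)\<^sup>2 - 2 * Re (cinner u v) + (norm v)\<^sup>2"
            using norm_add_sq[of u "- v"] by (simp add: cinner_minus_right)
          then show ?thesis using norm_add_sq[of u v] zero_le_power2[of "norm (u + v)"]
            unfolding u_def[symmetric] v_def[symmetric] by linarith
        qed
        then have "(\<Sum>x\<in>F. (norm (S m x - A x))\<^sup>2) \<le> (\<Sum>x\<in>F. 2 * (norm (S m x - T x))\<^sup>2 + 2 * (norm (A x - T x))\<^sup>2)"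
          by (intro sum_mono)
        also have "\<dots> = 2 * Q (S m) + 2 * Q A" by (simp add: Q_def sum.distrib sum_distrib_left)
        also have "\<dots> \<le> N" using QS[of m] A(2) b(2) by (simp add: N_def)
        finally show ?thesis .
      qed
      have "d \<le> Q (\<lambda>x. A x + t *\<^sub>R (S m x - A x))" by (intro dQ affine A S)
      also have "\<dots> = (\<Sum>x\<in>F. (norm (A x - T x))\<^sup>2 + 2 * t * Re (cinner (A x - T x) (S m x - A x)) + t\<^sup>2 * (norm (S m x - A x))\<^sup>2)"
        unfolding Q_def
      proof (rule sum.cong[OF refl])
        fix x
        have "A x + t *\<^sub>R (S m x - A x) - T x = (A x - T x) + t *\<^sub>R (S m x - A x)" by simp
        then show "(norm (A x + t *\<^sub>R (S m x - A x) - T x))\<^sup>2 = (norm (A x - T x))\<^sup>2 + 2 * t * Re (cinner (A x - T x) (S m x - A x)) + t\<^sup>2 * (norm (S m x - A x))\<^sup>2"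
          using norm_add_sq[of "A x - T x" "t *\<^sub>R (S m x - A x)"]
          by (simp only: cinner_scaleR_right) (simp add: power_mult_distrib)
      qed
      also have "\<dots> = Q A + 2 * t * B m + t\<^sup>2 * (\<Sum>x\<in>F. (norm (S m x - A x))\<^sup>2)"
        by (simp add: Q_def B_def sum.distrib sum_distrib_left)
      also have "\<dots> \<le> (d + d * t / 2) + 2 * t * B m + t\<^sup>2 * N"
        using A(2) b sq t by (intro add_mono mult_left_mono) auto
      finally have "0 \<le> t * (d / 2 + 2 * B m + t * N)" by (simp add: power2_eq_square algebra_simps)
      then have "0 \<le> d / 2 + 2 * B m + t * N" using t by (simp add: zero_le_mult_iff)
      then show ?thesis using N dp by (simp add: t_def)
    qed
    have "((\<lambda>m. B m) \<longlongrightarrow> (\<Sum>x\<in>F. Re (cinner (A x - T x) (T x - A x)))) U"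
      unfolding B_def cinner_diff_right by (intro tendsto_intros U)
    moreover have "(\<Sum>x\<in>F. Re (cinner (A x - T x) (T x - A x))) = - Q A"
    proof -
      have "Re (cinner (A x - T x) (T x - A x)) = - (norm (A x - T x))\<^sup>2" for x
        using cinner_minus_right[of "A x - T x" "A x - T x"] cinner_self[of "A x - T x"] by simp
      then show ?thesis by (simp add: Q_def sum_negf)
    qed
    ultimately have "(B \<longlongrightarrow> - Q A) U" by simp
    then have "- (3/4) * d \<le> - Q A" using tendsto_lowerbound U(1) Bge by (metis (mono_tags, lifting) always_eventually)
    then show False using dQ[OF A(1)] dp by simp
  qed
  then obtain A where A: "A \<in> R" "Q A < e\<^sup>2" using ex[of "e\<^sup>2"] e by auto
  have "norm (A x - T x) < e" if "x \<in> F" for x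
  proof -
    have "(norm (A x - T x))\<^sup>2 \<le> Q A" unfolding Q_def using F that by (intro member_le_sum) auto
    then have "(norm (A x - T x))\<^sup>2 < e\<^sup>2" using A by simp
    then show ?thesis using e by (metis less_imp_le power_less_imp_less_base)
  qed
  then show ?thesis using A by blast
qed

lemma isometric_unital_repD:
  assumes "isometric_unital_rep (\<pi> :: 'b::unital_cstar_algebra \<Rightarrow> 'g::complex_hilbert_space \<Rightarrow> 'g)"
  shows "bounded_linear (\<pi> b)" "\<pi> b (c *\<^sub>C x) = c *\<^sub>C \<pi> b x" "\<pi> b (x + y) = \<pi> b x + \<pi> b y"
    "\<pi> (a + b) x = \<pi> a x + \<pi> b x" "\<pi> (c *\<^sub>C b) x = c *\<^sub>C \<pi> b x" "\<pi> (a * b) x = \<pi> a (\<pi> b x)"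
    "\<pi> 1 x = x" "cinner (\<pi> (star b) x) y = cinner x (\<pi> b y)" "norm (\<pi> b x) \<le> norm b * norm x"
    "\<pi> (a - b) x = \<pi> a x - \<pi> b x" "(\<And>x. \<pi> b x = 0) \<Longrightarrow> b = 0" "cinner x (\<pi> (star b) y) = cinner (\<pi> b x) y"
proof -
  note A = assms[unfolded isometric_unital_rep_def bounded_clinear_op_def]
  show bl: "bounded_linear (\<pi> b)" using A by blast
  show "\<pi> b (c *\<^sub>C x) = c *\<^sub>C \<pi> b x" "\<pi> (c *\<^sub>C b) x = c *\<^sub>C \<pi> b x" "\<pi> (a * b) x = \<pi> a (\<pi> b x)"
    "\<pi> 1 x = x" using A by blast+
  show add: "\<pi> (a + b) x = \<pi> a x + \<pi> b x" for a b using A by blast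
  show adj: "cinner (\<pi> (star b) x) y = cinner x (\<pi> b y)" for b x y using A by blast
  show "\<pi> b (x + y) = \<pi> b x + \<pi> b y"
    using bl by (simp add: linear_add bounded_linear.linear)
  show bd: "norm (\<pi> b x) \<le> norm b * norm x" using onorm[OF bl, of x] A by simp
  show "\<pi> (a - b) x = \<pi> a x - \<pi> b x" using add[of "a - b" b] by simp
  show "b = 0" if "\<And>x. \<pi> b x = 0"
  proof -
    have "\<pi> b = (\<lambda>_. 0)" using that by auto
    then have "norm b = onorm (\<lambda>_::'g. 0::'g)" using A by metis
    then show ?thesis by (simp add: onorm_zero)
  qed
  show "cinner x (\<pi> (star b) y) = cinner (\<pi> b x) y"
    using adj[of "star b"] by (simp add: star_star)
qed

lemma isometric_unital_rep_sum:
  assumes "isometric_unital_rep \<pi>"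
  shows "\<pi> (\<Sum>i\<in>I. f i) x = (\<Sum>i\<in>I. \<pi> (f i) x)"
proof -
  have "\<pi> 0 x = 0" using isometric_unital_repD(10)[OF assms, of 0 0 x] by simp
  then show ?thesis
    by (induction I rule: infinite_finite_induct) (auto simp: isometric_unital_repD(4)[OF assms])
qed

lemma npos_rep:
  assumes \<pi>: "isometric_unital_rep \<pi>"
  shows "npos a \<longleftrightarrow> (\<forall>x. Im (cinner x (\<pi> a x)) = 0 \<and> 0 \<le> Re (cinner x (\<pi> a x)))"
proof
  note R = isometric_unital_repD[OF \<pi>]
  have sq: "cinner x (\<pi> (star w * w) x) = complex_of_real ((norm (\<pi> w x))\<^sup>2)" for w x
    by (simp add: R(6,12) cinner_self)
  {
    assume "npos a"
    then obtain w where "a = star w * w" using npos_iff by blast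
    then show "\<forall>x. Im (cinner x (\<pi> a x)) = 0 \<and> 0 \<le> Re (cinner x (\<pi> a x))"
      by (simp only: sq) simp
  }
  assume pos: "\<forall>x. Im (cinner x (\<pi> a x)) = 0 \<and> 0 \<le> Re (cinner x (\<pi> a x))"
  define d where "d = a - star a"
  have q: "cinner x (\<pi> d x) = 0" for x
  proof -
    have "cinner x (\<pi> (star a) x) = cnj (cinner x (\<pi> a x))"
      by (simp add: R(12) cinner_commute[of "\<pi> a x" x])
    then show ?thesis using pos by (simp add: d_def R(10) cinner_diff_right complex_eq_iff)
  qed
  have "cinner x (\<pi> d y) = 0" for x y
  proof -
    have 1: "cinner x (\<pi> d y) + cinner y (\<pi> d x) = 0"
      using q[of "x + y"] q[of x] q[of y] by (simp add: R(3) cinner_simps add.commute)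
    have "\<i> * (cinner x (\<pi> d y) - cinner y (\<pi> d x)) = 0"
      using q[of "x + \<i> *\<^sub>C y"] q[of x] q[of y] by (simp add: R(2,3) cinner_simps algebra_simps)
    then have "cinner x (\<pi> d y) - cinner y (\<pi> d x) = 0" by simp
    with 1 show ?thesis by simp
  qed
  then have "cinner (\<pi> d y) (\<pi> d y) = 0" for y by blast
  then have "\<pi> d y = 0" for y by (simp add: cinner_self)
  then have "d = 0" by (rule R(11))
  then have sa: "star a = a" by (simp add: d_def)
  obtain p n where pn: "npos p" "npos n" "a = p - n" "p * n = 0" "n * p = 0"
    using npos_decomposition[OF sa] by blast
  have sn: "star n = n" using npos_star[OF pn(2)] .
  have "npos (n * n * n)" by (intro npos_mult_commute npos_square pn sn) (simp add: mult.assoc)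
  then obtain w where w: "n * n * n = star w * w" using npos_iff by blast
  have nan: "star n * a * n = - (n * n * n)" by (simp add: sn pn algebra_simps)
  have "\<pi> w x = 0" for x
  proof -
    have "cinner (\<pi> n x) (\<pi> a (\<pi> n x)) = cinner x (\<pi> (star n * a * n) x)"
      by (simp add: R(6,12))
    also have "\<dots> = - cinner x (\<pi> (star w * w) x)"
      unfolding nan w using R(10)[of 0 "star w * w" x] R(10)[of 0 0 x] by (simp add: cinner_minus_right)
    finally have "Re (cinner (\<pi> n x) (\<pi> a (\<pi> n x))) = - (norm (\<pi> w x))\<^sup>2" by (simp only: sq) simp
    then have "0 \<le> - (norm (\<pi> w x))\<^sup>2" using pos by metis
    then show ?thesis by simp
  qed
  then have "w = 0" by (rule R(11))
  then have "n * n * n = 0" using w by (simp add: star_zero)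
  then have "norm ((n * n) * (n * n)) = 0" by (simp add: mult.assoc)
  then have "n = 0" using norm_sa_square[of "n * n"] norm_sa_square[of n] sn by (simp add: star_simps)
  then show "npos a" using pn by simp
qed

lemma gen_limit_von_neumann:
  assumes vN: "von_neumann_algebra_on TYPE('g::complex_hilbert_space) TYPE('b::unital_cstar_algebra)"
  shows "\<exists>\<Psi> :: (nat \<Rightarrow> 'b) \<Rightarrow> 'b. gen_limit \<Psi>"
proof -
  obtain \<pi> :: "'b \<Rightarrow> 'g \<Rightarrow> 'g" where \<pi>: "isometric_unital_rep \<pi>" and cl: "strongly_closed (range \<pi>)"
    using vN unfolding von_neumann_algebra_on_def by blast
  note R = isometric_unital_repD[OF \<pi>]
  obtain U :: "nat filter" where U: "U \<le> sequentially" "ultrafilter_on_type U"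
    using ultrafilter_exists[OF sequentially_bot] by blast
  have Ub: "U \<noteq> bot" using U(2) by (simp add: ultrafilter_on_type_def)
  define wlim where "wlim = (\<lambda>(f :: nat \<Rightarrow> 'b) b. \<forall>x y. ((\<lambda>m. cinner y (\<pi> (f m) x)) \<longlongrightarrow> cinner y (\<pi> b x)) U)"
  have unique: "b = c" if "wlim f b" "wlim f c" for f b c
  proof -
    have "cinner y (\<pi> b x) = cinner y (\<pi> c x)" for x y
      using that tendsto_unique[OF Ub] unfolding wlim_def by blast
    then have "cinner y (\<pi> (b - c) x) = 0" for x y by (simp add: R(10) cinner_diff_right)
    then have "cinner (\<pi> (b - c) x) (\<pi> (b - c) x) = 0" for x by blast
    then have "\<pi> (b - c) x = 0" for x by (simp add: cinner_self)
    then have "b - c = 0" by (rule R(11))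
    then show ?thesis by simp
  qed
  have ex: "\<exists>b. wlim f b" if bs: "Bseq f" for f
  proof -
    obtain C where C: "C > 0" "\<And>m. norm (f m) \<le> C" using bs unfolding Bseq_def by blast
    have bd: "norm (\<pi> (f m) x) \<le> C * norm x" for m x
      using R(9) C(2) by (meson mult_right_mono norm_ge_zero order_trans)
    have cbd: "cmod (cinner y (\<pi> (f m) x)) \<le> norm y * (C * norm x)" for x y m
      using cmod_cinner_le bd by (meson mult_left_mono norm_ge_zero order_trans)
    define l where "l = (\<lambda>x y. SOME z. ((\<lambda>m. cinner y (\<pi> (f m) x)) \<longlongrightarrow> z) U)"
    have l: "((\<lambda>m. cinner y (\<pi> (f m) x)) \<longlongrightarrow> l x y) U" for x y
      unfolding l_def by (rule someI_ex, rule ultrafilter_bounded_tendsto[OF U(2) cbd])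
    have lbd: "cmod (l x y) \<le> norm y * (C * norm x)" for x y
      by (rule tendsto_upperbound[OF tendsto_norm[OF l]]) (auto simp: cbd Ub)
    have "\<exists>z. \<forall>y. cnj (l x y) = cinner z y" for x
    proof (rule riesz)
      show "cnj (l x (y + y')) = cnj (l x y) + cnj (l x y')" for y y'
      proof -
        have "((\<lambda>m. cinner (y + y') (\<pi> (f m) x)) \<longlongrightarrow> l x y + l x y') U"
          unfolding cinner_add_left by (intro tendsto_intros l)
        then show ?thesis using tendsto_unique[OF Ub _ l] by (metis complex_cnj_add)
      qed
      show "cnj (l x (c *\<^sub>C y)) = c * cnj (l x y)" for c y
      proof -
        have "((\<lambda>m. cinner (c *\<^sub>C y) (\<pi> (f m) x)) \<longlongrightarrow> cnj c * l x y) U"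
          unfolding cinner_scaleC_left by (intro tendsto_intros l)
        then show ?thesis using tendsto_unique[OF Ub _ l] by (metis complex_cnj_cnj complex_cnj_mult)
      qed
      show "cmod (cnj (l x y)) \<le> (C * norm x) * norm y" for y using lbd[of x y] by (simp add: mult.commute)
    qed
    then obtain T where T': "\<And>x y. cnj (l x y) = cinner (T x) y" by metis
    have T: "cinner y (T x) = l x y" for x y using T'[of x y] by (metis cinner_commute complex_cnj_cnj)
    have Teq: "u = T x" if "\<And>y. cinner y u = l x y" for u x
    proof -
      have "cinner (u - T x) (u - T x) = 0" unfolding cinner_diff_right that T by simp
      then show ?thesis by (simp add: cinner_self)
    qed
    have Tadd: "T (x + y) = T x + T y" for x y
    proof (rule Teq[symmetric])
      fix z
      have "((\<lambda>m. cinner z (\<pi> (f m) (x + y))) \<longlongrightarrow> l x z + l y z) U"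
        unfolding R(3) cinner_add_right by (intro tendsto_intros l)
      then show "cinner z (T x + T y) = l (x + y) z"
        using tendsto_unique[OF Ub _ l] by (simp add: cinner_add_right T)
    qed
    have Tscale: "T (c *\<^sub>C x) = c *\<^sub>C T x" for c x
    proof (rule Teq[symmetric])
      fix z
      have "((\<lambda>m. cinner z (\<pi> (f m) (c *\<^sub>C x))) \<longlongrightarrow> c * l x z) U"
        unfolding R(2) cinner_scaleC_right by (intro tendsto_intros l)
      then show "cinner z (c *\<^sub>C T x) = l (c *\<^sub>C x) z"
        using tendsto_unique[OF Ub _ l] by (simp add: cinner_scaleC_right T)
    qed
    have Tbd: "norm (T x) \<le> norm x * C" for x
    proof (cases "T x = 0")
      case False
      have "(norm (T x))\<^sup>2 = cmod (cinner (T x) (T x))" unfolding cinner_self by (simp only: norm_of_real) simp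
      also have "\<dots> \<le> norm (T x) * (C * norm x)" unfolding T by (rule lbd)
      finally have "norm (T x) * norm (T x) \<le> norm (T x) * (norm x * C)"
        by (simp add: power2_eq_square mult.commute)
      then show ?thesis using False by simp
    qed (use C in simp)
    have "bounded_linear T"
      by (rule bounded_linear_intro[OF Tadd _ Tbd]) (metis Tscale scaleC_of_real)
    then have "bounded_clinear_op T" using Tscale by (simp add: bounded_clinear_op_def)
    moreover have "\<exists>S\<in>range \<pi>. \<forall>x\<in>F. norm (S x - T x) < e" if "finite F" "e > 0" for F e
    proof (rule weak_limit_strong_closure[where S="\<lambda>m. \<pi> (f m)"])
      show "(\<lambda>x. A x + t *\<^sub>R (B x - A x)) \<in> range \<pi>" if AB: "A \<in> range \<pi>" "B \<in> range \<pi>" for A B t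
      proof -
        obtain a b where "A = \<pi> a" "B = \<pi> b" using AB by blast
        then have "(\<lambda>x. A x + t *\<^sub>R (B x - A x)) = \<pi> (a + of_real t *\<^sub>C (b - a))"
          by (simp only: R(4,5,10) scaleC_of_real[symmetric] fun_eq_iff) simp
        then show ?thesis by simp
      qed
      show "((\<lambda>m. cinner y (\<pi> (f m) x)) \<longlongrightarrow> cinner y (T x)) U" for x y unfolding T by (rule l)
    qed (use bd Ub that in auto)
    ultimately have "T \<in> range \<pi>" using cl unfolding strongly_closed_def by blast
    then obtain b where "T = \<pi> b" by blast
    then show ?thesis using l unfolding wlim_def by (intro exI[of _ b]) (simp flip: T)
  qed
  define \<Psi> where "\<Psi> = (\<lambda>f. SOME b. wlim f b)"
  have \<Psi>: "wlim f (\<Psi> f)" if "Bseq f" for f unfolding \<Psi>_def using someI_ex[OF ex[OF that]] .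
  have \<Psi>_eq: "\<Psi> f = b" if "Bseq f" "wlim f b" for f b using unique[OF \<Psi>] that by blast
  have "\<Psi> (\<lambda>m. f m + g m) = \<Psi> f + \<Psi> g" if bs: "Bseq f" "Bseq g" for f g
  proof (rule \<Psi>_eq)
    show "Bseq (\<lambda>m. f m + g m)" using bs by (rule Bseq_add_seq)
    show "wlim (\<lambda>m. f m + g m) (\<Psi> f + \<Psi> g)"
      using \<Psi>[OF bs(1)] \<Psi>[OF bs(2)] unfolding wlim_def R(4) cinner_add_right by (auto intro: tendsto_add)
  qed
  moreover have "\<Psi> (\<lambda>m. c *\<^sub>C f m) = c *\<^sub>C \<Psi> f" if bs: "Bseq f" for c f
  proof (rule \<Psi>_eq)
    obtain K where "K > 0" "\<And>m. norm (f m) \<le> K" using bs unfolding Bseq_def by blast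
    then show "Bseq (\<lambda>m. c *\<^sub>C f m)" by (intro BseqI'[of _ "cmod c * K"]) (simp add: norm_scaleC mult_left_mono)
    show "wlim (\<lambda>m. c *\<^sub>C f m) (c *\<^sub>C \<Psi> f)"
      using \<Psi>[OF bs] unfolding wlim_def R(5) cinner_scaleC_right by (auto intro: tendsto_mult)
  qed
  moreover have "\<Psi> (\<lambda>_. b) = b" for b by (rule \<Psi>_eq) (auto simp: wlim_def)
  moreover have "posform N (\<lambda>i j. \<Psi> (\<lambda>m. M m i j))"
    if bd: "\<forall>i<N. \<forall>j<N. Bseq (\<lambda>m. M m i j)" and pf: "\<forall>\<^sub>F m in sequentially. posform N (M m)" for N M
    unfolding posform_def npos_rep[OF \<pi>]
  proof (intro allI)
    fix b x
    have q: "cinner x (\<pi> (qform N X b) x) = (\<Sum>i<N. \<Sum>j<N. cinner (\<pi> (b i) x) (\<pi> (X i j) (\<pi> (b j) x)))" for X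
      by (simp add: qform_def isometric_unital_rep_sum[OF \<pi>] cinner_sum_right R(6,12))
    have lim: "((\<lambda>m. cinner x (\<pi> (qform N (M m) b) x)) \<longlongrightarrow> cinner x (\<pi> (qform N (\<lambda>i j. \<Psi> (\<lambda>m. M m i j)) b) x)) U"
      unfolding q using \<Psi> bd unfolding wlim_def by (intro tendsto_sum) auto
    have ev: "\<forall>\<^sub>F m in U. posform N (M m)" using pf U(1) by (rule filter_leD[rotated])
    have e1: "\<forall>\<^sub>F m in U. Im (cinner x (\<pi> (qform N (M m) b) x)) = 0"
      and e2: "\<forall>\<^sub>F m in U. 0 \<le> Re (cinner x (\<pi> (qform N (M m) b) x))"
      using ev by (eventually_elim; simp add: posform_def npos_rep[OF \<pi>])+
    have "((\<lambda>m. Im (cinner x (\<pi> (qform N (M m) b) x))) \<longlongrightarrow> 0) U"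
      using tendsto_eventually[OF e1] .
    then have "Im (cinner x (\<pi> (qform N (\<lambda>i j. \<Psi> (\<lambda>m. M m i j)) b) x)) = 0"
      using tendsto_unique[OF Ub tendsto_Im[OF lim]] by simp
    moreover have "0 \<le> Re (cinner x (\<pi> (qform N (\<lambda>i j. \<Psi> (\<lambda>m. M m i j)) b) x))"
      by (rule tendsto_lowerbound[OF tendsto_Re[OF lim] e2 Ub])
    ultimately show "Im (cinner x (\<pi> (qform N (\<lambda>i j. \<Psi> (\<lambda>m. M m i j)) b) x)) = 0 \<and>
      0 \<le> Re (cinner x (\<pi> (qform N (\<lambda>i j. \<Psi> (\<lambda>m. M m i j)) b) x))" by blast
  qed
  ultimately show ?thesis unfolding gen_limit_def by blast
qed

section \<open>The Hilbert module of a positive kernel\<close>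

definition pos_kernel :: "'i set \<Rightarrow> ('i \<Rightarrow> 'i \<Rightarrow> 'b::unital_cstar_algebra) \<Rightarrow> bool" where
  "pos_kernel S K \<longleftrightarrow> (\<forall>N f. (\<forall>i<N. f i \<in> S) \<longrightarrow> posform N (\<lambda>i j. K (f i) (f j)))"

lemma pos_kernel_pair:
  assumes "pos_kernel S K" "x \<in> S" "y \<in> S"
  shows "posform 2 (\<lambda>i j. K (if i = 0 then x else y) (if j = 0 then x else y))"
  using assms(1)[unfolded pos_kernel_def, rule_format, of 2 "\<lambda>i. if i = 0 then x else y"] assms(2,3)
  by simp

lemma pos_kernel_hermitian:
  assumes "pos_kernel S K" "x \<in> S" "y \<in> S"
  shows "K y x = star (K x y)"
  using posform_hermitian[OF pos_kernel_pair[OF assms], of 0 1] by simp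

lemma pos_kernel_diag:
  assumes "pos_kernel S K" "x \<in> S"
  shows "npos (K x x)"
proof -
  have "posform 1 (\<lambda>i j. K x x)" using assms unfolding pos_kernel_def by auto
  from posform_diag[OF this, of 0] show ?thesis by simp
qed

lemma pos_kernel_cauchy_schwarz:
  assumes "pos_kernel S K" "x \<in> S" "y \<in> S"
  shows "(norm (K x y))\<^sup>2 \<le> norm (K x x) * norm (K y y)"
  using posform_cauchy_schwarz[OF pos_kernel_pair[OF assms], of 0 1] by simp

definition lform :: "('w \<Rightarrow> 'w \<Rightarrow> 'b::unital_cstar_algebra) \<Rightarrow> ('w \<times> 'b) list \<Rightarrow> ('w \<times> 'b) list \<Rightarrow> 'b" where
  "lform M L L' = (\<Sum>(w, b)\<leftarrow>L. \<Sum>(w', b')\<leftarrow>L'. star b * M w w' * b')"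

lemma pos_kernel_lform:
  assumes "pos_kernel S M" "fst ` set L \<subseteq> S"
  shows "npos (lform M L L)"
proof -
  let ?f = "\<lambda>i. fst (L ! i)" and ?b = "\<lambda>i. snd (L ! i)"
  have "posform (length L) (\<lambda>i j. M (?f i) (?f j))"
    using assms unfolding pos_kernel_def by (auto simp: image_subset_iff)
  then have "npos (qform (length L) (\<lambda>i j. M (?f i) (?f j)) ?b)" by (simp add: posform_def)
  then show ?thesis
    by (simp add: lform_def qform_def sum_list_sum_nth atLeast0LessThan case_prod_beta)
qed

definition smulr :: "('w \<times> 'b::times) list \<Rightarrow> 'b \<Rightarrow> ('w \<times> 'b) list" where
  "smulr L c = map (\<lambda>(w, b). (w, b * c)) L"

definition mapi :: "('w \<Rightarrow> 'v) \<Rightarrow> ('w \<times> 'b) list \<Rightarrow> ('v \<times> 'b) list" where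
  "mapi \<tau> L = map (\<lambda>(w, b). (\<tau> w, b)) L"

text \<open>The pairing of \<open>\<Sum> k\<^sub>w b\<close> with a function, where \<open>k\<^sub>w\<close> reproduces the value at \<open>w\<close>.\<close>

definition ip0 :: "('w \<times> 'b::unital_cstar_algebra) list \<Rightarrow> ('w \<Rightarrow> 'b) \<Rightarrow> 'b" where
  "ip0 L g = (\<Sum>(w, b)\<leftarrow>L. star b * g w)"

lemma ip0_simps [simp]:
  "ip0 [] g = 0" "ip0 ((w, b) # L) g = star b * g w + ip0 L g" "ip0 (L @ L') g = ip0 L g + ip0 L' g"
  by (simp_all add: ip0_def)

lemma ip0_smulr: "ip0 (smulr L c) g = star c * ip0 L g"
  by (induction L) (auto simp: smulr_def star_mult algebra_simps)

lemma ip0_mapi: "ip0 (mapi \<tau> L) g = ip0 L (\<lambda>w. g (\<tau> w))"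
  by (induction L) (auto simp: mapi_def)

lemma ip0_add: "ip0 L (\<lambda>w. f w + g w) = ip0 L f + ip0 L g"
  by (induction L) (auto simp: algebra_simps)

lemma ip0_diff: "ip0 L (\<lambda>w. f w - g w) = ip0 L f - ip0 L g"
  by (induction L) (auto simp: algebra_simps)

lemma ip0_mult: "ip0 L (\<lambda>w. f w * c) = ip0 L f * c"
  by (induction L) (auto simp: algebra_simps)

lemma ip0_tendsto:
  assumes "\<And>w. ((\<lambda>n. f n w) \<longlongrightarrow> g w) F"
  shows "((\<lambda>n. ip0 L (f n)) \<longlongrightarrow> ip0 L g) F"
  by (induction L) (auto intro!: tendsto_intros assms)

lemma small_factor:
  fixes e s :: real
  assumes "0 < e" "0 \<le> s"
  shows "\<exists>d>0. s * d < e"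
proof -
  have "s * (e / (s + 1)) = e - e / (s + 1)" using assms by (simp add: field_simps)
  moreover have "e / (s + 1) > 0" using assms by simp
  ultimately show ?thesis by (intro exI[of _ "e / (s + 1)"]) simp
qed

locale pos_kernel_space =
  fixes K :: "'w \<Rightarrow> 'w \<Rightarrow> 'b::unital_cstar_algebra"
  assumes pos: "pos_kernel UNIV K"
begin

definition kv :: "('w \<times> 'b) list \<Rightarrow> 'w \<Rightarrow> 'b" where
  "kv L u = (\<Sum>(w, b)\<leftarrow>L. K u w * b)"

lemma kv_simps [simp]:
  "kv [] u = 0" "kv ((w, b) # L) u = K u w * b + kv L u" "kv (L @ L') u = kv L u + kv L' u"
  by (simp_all add: kv_def)

lemma kv_smulr: "kv (smulr L c) u = kv L u * c"
  by (induction L) (auto simp: smulr_def algebra_simps)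

lemma K_herm: "K y x = star (K x y)"
  using pos_kernel_hermitian[OF pos] by blast

lemma ip0_kv: "ip0 L (kv L') = lform K L L'"
proof -
  have "star b * kv L' w = (\<Sum>(w', b')\<leftarrow>L'. star b * K w w' * b')" for w b
    by (induction L') (auto simp: algebra_simps)
  then show ?thesis by (simp add: ip0_def lform_def)
qed

lemma ip0_kv_herm: "ip0 L (kv L') = star (ip0 L' (kv L))"
proof (induction L)
  case Nil
  have "ip0 L' (\<lambda>_. 0) = 0" by (induction L') auto
  moreover have "kv [] = (\<lambda>_. 0)" by auto
  ultimately show ?case by (simp add: star_zero)
next
  case (Cons p L)
  obtain w b where p: "p = (w, b)" by force
  have 1: "ip0 L' (\<lambda>u. K u w * b) = star (star b * kv L' w)"
    by (induction L') (auto simp: star_simps algebra_simps K_herm[of w])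
  have "kv (p # L) = (\<lambda>u. K u w * b + kv L u)" by (auto simp: p)
  then have 2: "ip0 L' (kv (p # L)) = star (star b * kv L' w) + ip0 L' (kv L)"
    using 1 by (simp only: ip0_add)
  show ?case unfolding 2 star_add star_star using Cons by (simp add: p)
qed

lemma ip0_kv_pos: "npos (ip0 L (kv L))"
  unfolding ip0_kv by (rule pos_kernel_lform[OF pos]) simp

definition snorm :: "('w \<times> 'b) list \<Rightarrow> real" where
  "snorm L = sqrt (norm (ip0 L (kv L)))"

lemma snorm_nonneg [simp]: "0 \<le> snorm L"
  by (simp add: snorm_def)

lemma snorm_sq: "norm (ip0 L (kv L)) = (snorm L)\<^sup>2"
  by (simp add: snorm_def)

lemma ip0_cauchy_schwarz: "norm (ip0 L (kv L')) \<le> snorm L * snorm L'"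
proof -
  let ?L = "\<lambda>i::nat. if i = 0 then L else L'"
  have "posform 2 (\<lambda>i j. ip0 (?L i) (kv (?L j)))"
    unfolding posform_def
  proof
    fix b :: "nat \<Rightarrow> 'b"
    let ?M = "smulr L (b 0) @ smulr L' (b 1)"
    have "kv ?M = (\<lambda>u. kv L u * b 0 + kv L' u * b 1)" by (auto simp: kv_smulr)
    then have "ip0 ?M (kv ?M) = qform 2 (\<lambda>i j. ip0 (?L i) (kv (?L j))) b"
      by (simp add: qform_def numeral_2_eq_2 ip0_smulr ip0_add ip0_mult algebra_simps)
    then show "npos (qform 2 (\<lambda>i j. ip0 (?L i) (kv (?L j))) b)" by (metis ip0_kv_pos)
  qed
  from posform_cauchy_schwarz[OF this, of 0 1]
  have "(norm (ip0 L (kv L')))\<^sup>2 \<le> (snorm L * snorm L')\<^sup>2"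
    by (simp add: snorm_sq power_mult_distrib)
  then show ?thesis by (rule power2_le_imp_le) simp
qed

text \<open>A function is measured as a functional on the span of the \<open>k\<^sub>w\<close>. The module \<open>E\<close> is the closure
  of this span among the bounded functionals, so that its completion consists of functions again.\<close>

definition rnorm_le :: "('w \<Rightarrow> 'b) \<Rightarrow> real \<Rightarrow> bool" where
  "rnorm_le g t \<longleftrightarrow> (\<forall>L. norm (ip0 L g) \<le> t * snorm L)"

lemma rnorm_leD: "rnorm_le g t \<Longrightarrow> norm (ip0 L g) \<le> t * snorm L"
  by (simp add: rnorm_le_def)

lemma rnorm_le_kv: "rnorm_le (kv L) (snorm L)"
  unfolding rnorm_le_def using ip0_cauchy_schwarz by (simp add: mult.commute)

lemma rnorm_le_kvD:
  assumes "rnorm_le (kv L) t" "t \<ge> 0"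
  shows "snorm L \<le> t"
proof (cases "snorm L = 0")
  case False
  then have "snorm L > 0" using snorm_nonneg[of L] by linarith
  moreover have "snorm L * snorm L \<le> t * snorm L"
    using rnorm_leD[OF assms(1), of L] unfolding snorm_sq power2_eq_square .
  ultimately show ?thesis by (rule mult_right_le_imp_le[rotated])
qed (use assms in simp)

lemma rnorm_le_add: "rnorm_le f s \<Longrightarrow> rnorm_le g t \<Longrightarrow> rnorm_le (\<lambda>w. f w + g w) (s + t)"
  unfolding rnorm_le_def ip0_add distrib_right by (meson add_mono norm_triangle_le)

lemma rnorm_le_diff: "rnorm_le f s \<Longrightarrow> rnorm_le g t \<Longrightarrow> rnorm_le (\<lambda>w. f w - g w) (s + t)"
  unfolding rnorm_le_def ip0_diff distrib_right by (meson add_mono norm_triangle_ineq4 order_trans)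

lemma rnorm_le_mult:
  assumes "rnorm_le f s"
  shows "rnorm_le (\<lambda>w. f w * c) (s * norm c)"
  unfolding rnorm_le_def ip0_mult
proof
  fix L
  have "norm (ip0 L f * c) \<le> norm (ip0 L f) * norm c" by (rule norm_mult_ineq)
  also have "\<dots> \<le> s * snorm L * norm c" by (intro mult_right_mono rnorm_leD assms norm_ge_zero)
  finally show "norm (ip0 L f * c) \<le> s * norm c * snorm L" by (simp add: ac_simps)
qed

lemma rnorm_le_mono: "rnorm_le f s \<Longrightarrow> s \<le> t \<Longrightarrow> rnorm_le f t"
  unfolding rnorm_le_def by (meson mult_right_mono order_trans snorm_nonneg)

lemma rnorm_le_point: "rnorm_le f t \<Longrightarrow> norm (f w) \<le> t * snorm [(w, 1)]"
  using rnorm_leD[of f t "[(w, 1)]"] by (simp add: star_one)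

definition E :: "('w \<Rightarrow> 'b) set" where
  "E = {f. \<forall>e>0. \<exists>L. rnorm_le (\<lambda>w. f w - kv L w) e}"

definition apx :: "(nat \<Rightarrow> ('w \<times> 'b) list) \<Rightarrow> ('w \<Rightarrow> 'b) \<Rightarrow> bool" where
  "apx Ls f \<longleftrightarrow> (\<forall>e>0. \<forall>\<^sub>F n in sequentially. rnorm_le (\<lambda>w. f w - kv (Ls n) w) e)"

lemma apx_exists: "f \<in> E \<Longrightarrow> \<exists>Ls. apx Ls f"
proof -
  assume f: "f \<in> E"
  have "\<exists>L. rnorm_le (\<lambda>w. f w - kv L w) (1 / Suc n)" for n
    using f by (simp add: E_def)
  then obtain Ls where Ls: "\<And>n. rnorm_le (\<lambda>w. f w - kv (Ls n) w) (1 / Suc n)" by metis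
  have "apx Ls f" unfolding apx_def
  proof (intro allI impI)
    fix e :: real assume e: "e > 0"
    then obtain N where N: "1 / Suc N < e" using nat_approx_posE by blast
    have "rnorm_le (\<lambda>w. f w - kv (Ls n) w) e" if "n \<ge> N" for n
    proof (rule rnorm_le_mono[OF Ls])
      have "1 / real (Suc n) \<le> 1 / Suc N" using that by (simp add: frac_le)
      then show "1 / real (Suc n) \<le> e" using N by simp
    qed
    then show "\<forall>\<^sub>F n in sequentially. rnorm_le (\<lambda>w. f w - kv (Ls n) w) e"
      unfolding eventually_sequentially by blast
  qed
  then show ?thesis by blast
qed

lemma apx_E: "apx Ls f \<Longrightarrow> f \<in> E"
  unfolding apx_def E_def using eventually_happens by fastforce

lemma rnorm_le_zero: "rnorm_le (\<lambda>_. 0) 0"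
proof -
  have "ip0 L (\<lambda>_. 0) = 0" for L :: "('w \<times> 'b) list" by (induction L) auto
  then show ?thesis by (simp add: rnorm_le_def)
qed

lemma apx_kv: "apx (\<lambda>_. L) (kv L)"
  unfolding apx_def using rnorm_le_zero rnorm_le_mono by (auto intro!: always_eventually)

lemma kv_E: "kv L \<in> E"
  using apx_kv apx_E by blast

lemma E_bounded: "f \<in> E \<Longrightarrow> \<exists>s\<ge>0. rnorm_le f s"
proof -
  assume "f \<in> E"
  then obtain L where "rnorm_le (\<lambda>w. f w - kv L w) 1"
    unfolding E_def mem_Collect_eq using zero_less_one by blast
  from rnorm_le_add[OF this rnorm_le_kv[of L]] show ?thesis
    by (intro exI[of _ "1 + snorm L"]) (auto simp: add_nonneg_nonneg)
qed

lemma apx_pairing_close: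
  assumes f: "rnorm_le (\<lambda>w. f w - kv L w) d" "rnorm_le (\<lambda>w. f w - kv L' w) e" and g: "rnorm_le g s"
    and nn: "0 \<le> d" "0 \<le> e" "0 \<le> s"
  shows "norm (ip0 L g - ip0 L' g) \<le> s * (d + e)"
proof -
  let ?M = "L @ smulr L' (- 1)"
  have "kv ?M = (\<lambda>w. (f w - kv L' w) - (f w - kv L w))" by (auto simp: kv_smulr)
  then have "rnorm_le (kv ?M) (e + d)" using rnorm_le_diff[OF f(2,1)] by simp
  then have "snorm ?M \<le> d + e" using rnorm_le_kvD[of ?M] nn by (simp add: add.commute)
  moreover have "norm (ip0 ?M g) \<le> s * snorm ?M" using g by (rule rnorm_leD)
  moreover have "ip0 ?M g = ip0 L g - ip0 L' g" by (simp add: ip0_smulr star_simps)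
  ultimately show ?thesis using nn(3) by (metis mult_left_mono order_trans)
qed

definition ipE :: "('w \<Rightarrow> 'b) \<Rightarrow> ('w \<Rightarrow> 'b) \<Rightarrow> 'b" where
  "ipE f g = lim (\<lambda>n. ip0 ((SOME Ls. apx Ls f) n) g)"

lemma apx_Cauchy:
  assumes "apx Ls f" "g \<in> E"
  shows "Cauchy (\<lambda>n. ip0 (Ls n) g)"
proof (rule CauchyI)
  fix e :: real assume e: "e > 0"
  obtain s where s: "s \<ge> 0" "rnorm_le g s" using E_bounded[OF assms(2)] by blast
  obtain d where d: "d > 0" "s * (d + d) < e" using small_factor[of e "2 * s"] e s by auto
  obtain N where N: "\<And>n. n \<ge> N \<Longrightarrow> rnorm_le (\<lambda>w. f w - kv (Ls n) w) d"
    using assms(1) d(1) unfolding apx_def eventually_sequentially by blast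
  have "norm (ip0 (Ls m) g - ip0 (Ls n) g) < e" if "m \<ge> N" "n \<ge> N" for m n
    using apx_pairing_close[OF N[OF that(1)] N[OF that(2)] s(2)] d s by simp
  then show "\<exists>M. \<forall>m\<ge>M. \<forall>n\<ge>M. norm (ip0 (Ls m) g - ip0 (Ls n) g) < e" by blast
qed

lemma ipE_lim:
  assumes "apx Ls f" "g \<in> E"
  shows "(\<lambda>n. ip0 (Ls n) g) \<longlonglongrightarrow> ipE f g"
proof -
  define Ms where "Ms = (SOME Ls. apx Ls f)"
  have Ms: "apx Ms f" unfolding Ms_def by (rule someI[of "\<lambda>Ls. apx Ls f", OF assms(1)])
  have M: "(\<lambda>n. ip0 (Ms n) g) \<longlonglongrightarrow> ipE f g"
    using apx_Cauchy[OF Ms assms(2)] unfolding ipE_def Ms_def[symmetric]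
    by (simp add: Cauchy_convergent_iff convergent_LIMSEQ_iff)
  obtain s where s: "s \<ge> 0" "rnorm_le g s" using E_bounded[OF assms(2)] by blast
  have "(\<lambda>n. ip0 (Ls n) g - ip0 (Ms n) g) \<longlonglongrightarrow> 0"
  proof (rule LIMSEQ_I)
    fix e :: real assume e: "e > 0"
    obtain d where d: "d > 0" "s * (d + d) < e" using small_factor[of e "2 * s"] e s by auto
    have "\<forall>\<^sub>F n in sequentially. rnorm_le (\<lambda>w. f w - kv (Ls n) w) d \<and> rnorm_le (\<lambda>w. f w - kv (Ms n) w) d"
      using assms(1) Ms d(1) unfolding apx_def by (intro eventually_conj) blast+
    then have "\<forall>\<^sub>F n in sequentially. norm (ip0 (Ls n) g - ip0 (Ms n) g - 0) < e"
    proof eventually_elim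
      case (elim n)
      then show ?case using apx_pairing_close[of f "Ls n" d "Ms n" d g s] d s by simp
    qed
    then show "\<exists>N. \<forall>n\<ge>N. norm (ip0 (Ls n) g - ip0 (Ms n) g - 0) < e"
      by (simp add: eventually_sequentially)
  qed
  from tendsto_add[OF this M] show ?thesis by simp
qed

lemma ipE_kv: "g \<in> E \<Longrightarrow> ipE (kv L) g = ip0 L g"
  using ipE_lim[OF apx_kv[of L]] LIMSEQ_unique tendsto_const by blast

lemma apx_snorm_bounded:
  assumes "apx Ls f"
  shows "\<exists>C. \<forall>\<^sub>F n in sequentially. snorm (Ls n) \<le> C"
proof -
  obtain s where s: "s \<ge> 0" "rnorm_le f s" using E_bounded[OF apx_E[OF assms]] by blast
  have "\<forall>\<^sub>F n in sequentially. rnorm_le (\<lambda>w. f w - kv (Ls n) w) 1" using assms by (simp add: apx_def)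
  then have "\<forall>\<^sub>F n in sequentially. snorm (Ls n) \<le> s + 1"
  proof eventually_elim
    case (elim n)
    from rnorm_le_diff[OF s(2) elim] have "rnorm_le (kv (Ls n)) (s + 1)" by simp
    then show ?case using s by (intro rnorm_le_kvD) auto
  qed
  then show ?thesis by blast
qed

lemma ipE_lim2:
  assumes "apx Ls f" "apx Ms g"
  shows "(\<lambda>n. ip0 (Ls n) (kv (Ms n))) \<longlonglongrightarrow> ipE f g"
proof -
  obtain C where C: "\<forall>\<^sub>F n in sequentially. snorm (Ls n) \<le> C" using apx_snorm_bounded[OF assms(1)] by blast
  have "(\<lambda>n. ip0 (Ls n) g - ip0 (Ls n) (kv (Ms n))) \<longlonglongrightarrow> 0"
  proof (rule LIMSEQ_I)
    fix e :: real assume e: "e > 0"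
    obtain d where d: "d > 0" "d * \<bar>C\<bar> < e"
      using small_factor[OF e, of "\<bar>C\<bar>"] by (auto simp: mult.commute)
    have "\<forall>\<^sub>F n in sequentially. rnorm_le (\<lambda>w. g w - kv (Ms n) w) d" using assms(2) d by (simp add: apx_def)
    with C have "\<forall>\<^sub>F n in sequentially. norm (ip0 (Ls n) g - ip0 (Ls n) (kv (Ms n)) - 0) < e"
    proof eventually_elim
      case (elim n)
      have "norm (ip0 (Ls n) g - ip0 (Ls n) (kv (Ms n))) \<le> d * snorm (Ls n)"
        using rnorm_leD[OF elim(2), of "Ls n"] by (simp add: ip0_diff)
      also have "\<dots> \<le> d * \<bar>C\<bar>" using elim(1) d by (intro mult_left_mono) auto
      finally show ?case using d by simp
    qed
    then show "\<exists>N. \<forall>n\<ge>N. norm (ip0 (Ls n) g - ip0 (Ls n) (kv (Ms n)) - 0) < e"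
      by (simp add: eventually_sequentially)
  qed
  from tendsto_diff[OF ipE_lim[OF assms(1) apx_E[OF assms(2)]] this] show ?thesis by simp
qed

lemma ipE_herm:
  assumes "f \<in> E" "g \<in> E"
  shows "ipE g f = star (ipE f g)"
proof -
  obtain Ls Ms where L: "apx Ls f" "apx Ms g" using apx_exists assms by blast
  have "(\<lambda>n. star (ip0 (Ls n) (kv (Ms n)))) \<longlonglongrightarrow> star (ipE f g)"
    by (rule bounded_linear.tendsto[OF bounded_linear_star ipE_lim2[OF L]])
  moreover have "(\<lambda>n. star (ip0 (Ls n) (kv (Ms n)))) \<longlonglongrightarrow> ipE g f"
    using ipE_lim2[OF L(2,1)] by (simp flip: ip0_kv_herm)
  ultimately show ?thesis using LIMSEQ_unique by blast
qed

lemma ipE_pos: "f \<in> E \<Longrightarrow> npos (ipE f f)"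
proof -
  assume "f \<in> E"
  then obtain Ls where "apx Ls f" using apx_exists by blast
  from ipE_lim2[OF this this] show ?thesis by (rule npos_limit) (auto simp: ip0_kv_pos)
qed

lemma E_add: "f \<in> E \<Longrightarrow> g \<in> E \<Longrightarrow> (\<lambda>w. f w + g w) \<in> E"
proof -
  assume fg: "f \<in> E" "g \<in> E"
  show "(\<lambda>w. f w + g w) \<in> E" unfolding E_def mem_Collect_eq
  proof (intro allI impI)
    fix e :: real assume "e > 0"
    then obtain L L' where "rnorm_le (\<lambda>w. f w - kv L w) (e/2)" "rnorm_le (\<lambda>w. g w - kv L' w) (e/2)"
      using fg unfolding E_def mem_Collect_eq by (meson half_gt_zero)
    from rnorm_le_add[OF this] have "rnorm_le (\<lambda>w. f w + g w - kv (L @ L') w) e"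
      by (simp add: algebra_simps)
    then show "\<exists>L. rnorm_le (\<lambda>w. f w + g w - kv L w) e" by blast
  qed
qed

lemma E_mult: "f \<in> E \<Longrightarrow> (\<lambda>w. f w * c) \<in> E"
proof -
  assume f: "f \<in> E"
  show "(\<lambda>w. f w * c) \<in> E" unfolding E_def mem_Collect_eq
  proof (intro allI impI)
    fix e :: real assume e: "e > 0"
    have n: "norm c + 1 > 0" by (simp add: add_nonneg_pos)
    obtain L where L: "rnorm_le (\<lambda>w. f w - kv L w) (e / (norm c + 1))"
      using f e n unfolding E_def mem_Collect_eq by (meson divide_pos_pos)
    have "e / (norm c + 1) * norm c \<le> e" using e n by (simp add: field_simps)
    then have "rnorm_le (\<lambda>w. f w * c - kv (smulr L c) w) e"
      using rnorm_le_mono[OF rnorm_le_mult[OF L]] by (simp add: kv_smulr left_diff_distrib)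
    then show "\<exists>L. rnorm_le (\<lambda>w. f w * c - kv L w) e" by blast
  qed
qed

lemma E_minus: "f \<in> E \<Longrightarrow> (\<lambda>w. - f w) \<in> E"
  using E_mult[of f "-1"] by simp

lemma E_diff: "f \<in> E \<Longrightarrow> g \<in> E \<Longrightarrow> (\<lambda>w. f w - g w) \<in> E"
  using E_add[OF _ E_minus, of f g] by simp

lemma E_zero: "(\<lambda>_. 0) \<in> E"
  using kv_E[of "[]"] by (simp add: kv_def[abs_def])

lemma ipE_add: "f \<in> E \<Longrightarrow> g \<in> E \<Longrightarrow> h \<in> E \<Longrightarrow> ipE f (\<lambda>w. g w + h w) = ipE f g + ipE f h"
proof -
  assume *: "f \<in> E" "g \<in> E" "h \<in> E"
  then obtain Ls where L: "apx Ls f" using apx_exists by blast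
  have "(\<lambda>n. ip0 (Ls n) g + ip0 (Ls n) h) \<longlonglongrightarrow> ipE f g + ipE f h"
    by (intro tendsto_add ipE_lim L *)
  moreover have "(\<lambda>n. ip0 (Ls n) g + ip0 (Ls n) h) \<longlonglongrightarrow> ipE f (\<lambda>w. g w + h w)"
    using ipE_lim[OF L E_add[OF *(2,3)]] by (simp add: ip0_add)
  ultimately show ?thesis using LIMSEQ_unique by blast
qed

lemma ipE_mult: "f \<in> E \<Longrightarrow> g \<in> E \<Longrightarrow> ipE f (\<lambda>w. g w * c) = ipE f g * c"
proof -
  assume *: "f \<in> E" "g \<in> E"
  then obtain Ls where L: "apx Ls f" using apx_exists by blast
  have "(\<lambda>n. ip0 (Ls n) g * c) \<longlonglongrightarrow> ipE f g * c"
    by (intro tendsto_intros ipE_lim L *)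
  moreover have "(\<lambda>n. ip0 (Ls n) g * c) \<longlonglongrightarrow> ipE f (\<lambda>w. g w * c)"
    using ipE_lim[OF L E_mult[OF *(2)]] by (simp add: ip0_mult)
  ultimately show ?thesis using LIMSEQ_unique by blast
qed

definition nrm :: "('w \<Rightarrow> 'b) \<Rightarrow> real" where
  "nrm f = sqrt (norm (ipE f f))"

lemma apx_snorm: "apx Ls f \<Longrightarrow> (\<lambda>n. snorm (Ls n)) \<longlonglongrightarrow> nrm f"
  unfolding snorm_def nrm_def by (intro tendsto_intros ipE_lim2)

lemma apx_point:
  assumes "apx Ls f"
  shows "(\<lambda>n. kv (Ls n) w) \<longlonglongrightarrow> f w"
proof (rule LIMSEQ_I)
  fix e :: real assume e: "e > 0"
  define s where "s = snorm [(w, 1)]"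
  have s: "s \<ge> 0" by (simp add: s_def)
  obtain d where d: "d > 0" "d * s < e" using small_factor[OF e s] by (auto simp: mult.commute)
  have "\<forall>\<^sub>F n in sequentially. rnorm_le (\<lambda>w. f w - kv (Ls n) w) d" using assms d by (simp add: apx_def)
  then have "\<forall>\<^sub>F n in sequentially. norm (kv (Ls n) w - f w) < e"
  proof eventually_elim
    case (elim n)
    from rnorm_le_point[OF elim, of w] show ?case using d by (simp add: s_def norm_minus_commute)
  qed
  then show "\<exists>N. \<forall>n\<ge>N. norm (kv (Ls n) w - f w) < e" by (simp add: eventually_sequentially)
qed

lemma rnorm_le_nrm: "f \<in> E \<Longrightarrow> rnorm_le f (nrm f)"
proof -
  assume "f \<in> E"
  then obtain Ls where L: "apx Ls f" using apx_exists by blast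
  show ?thesis unfolding rnorm_le_def
  proof
    fix M
    have 1: "(\<lambda>n. norm (ip0 M (kv (Ls n)))) \<longlonglongrightarrow> norm (ip0 M f)"
      by (intro tendsto_norm ip0_tendsto apx_point L)
    have 2: "(\<lambda>n. snorm M * snorm (Ls n)) \<longlonglongrightarrow> snorm M * nrm f"
      by (intro tendsto_intros apx_snorm L)
    show "norm (ip0 M f) \<le> nrm f * snorm M"
      using LIMSEQ_le[OF 1 2] ip0_cauchy_schwarz by (simp add: mult.commute)
  qed
qed

lemma nrm_nonneg [simp]: "0 \<le> nrm f"
  by (simp add: nrm_def)

lemma nrm_le: "f \<in> E \<Longrightarrow> rnorm_le f t \<Longrightarrow> t \<ge> 0 \<Longrightarrow> nrm f \<le> t"
proof -
  assume f: "f \<in> E" "rnorm_le f t" "t \<ge> 0"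
  then obtain Ls where L: "apx Ls f" using apx_exists by blast
  have 1: "(\<lambda>n. norm (ip0 (Ls n) f)) \<longlonglongrightarrow> norm (ipE f f)" by (intro tendsto_norm ipE_lim L f)
  have 2: "(\<lambda>n. t * snorm (Ls n)) \<longlonglongrightarrow> t * nrm f" by (intro tendsto_intros apx_snorm L)
  have "norm (ipE f f) \<le> t * nrm f" using LIMSEQ_le[OF 1 2] f(2) by (auto simp: rnorm_le_def)
  then have "nrm f * nrm f \<le> t * nrm f" by (simp add: nrm_def)
  moreover have "nrm f > 0" if "nrm f \<noteq> 0" using nrm_nonneg[of f] that by linarith
  ultimately show ?thesis using f(3) by (cases "nrm f = 0") (simp_all add: mult_le_cancel_right)
qed

definition H :: "('b, 'w \<Rightarrow> 'b) hmodule" where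
  "H = \<lparr>mcarrier = E, act = (\<lambda>f b w. f w * b), ip = ipE\<rparr>"

lemma H_simps [simp]: "mcarrier H = E" "act H f b = (\<lambda>w. f w * b)" "ip H = ipE"
  by (simp_all add: H_def)

lemma mnorm_H: "mnorm H f = nrm f"
  by (simp add: mnorm_def nrm_def)

lemma H_complete:
  assumes s: "\<And>n. s n \<in> E" and cau: "\<forall>e>0. \<exists>N::nat. \<forall>m\<ge>N. \<forall>n\<ge>N. nrm (s m - s n) < e"
  shows "\<exists>l\<in>E. (\<lambda>n. nrm (s n - l)) \<longlonglongrightarrow> 0"
proof -
  have d: "(\<lambda>w. f w - g w) = f - g" for f g :: "'w \<Rightarrow> 'b" by auto
  have sd: "rnorm_le (s m - s n) (nrm (s m - s n))" for m n
    using rnorm_le_nrm[OF E_diff[OF s s], of m n] by (simp add: d)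
  have "Cauchy (\<lambda>n. s n w)" for w
  proof (rule CauchyI)
    fix e :: real assume e: "e > 0"
    define t where "t = snorm [(w, 1)]"
    have t: "t \<ge> 0" by (simp add: t_def)
    obtain N where N: "\<And>m n. m \<ge> N \<Longrightarrow> n \<ge> N \<Longrightarrow> nrm (s m - s n) < e / (t + 1)"
      using cau e t by (meson add_nonneg_pos divide_pos_pos zero_less_one)
    have "norm (s m w - s n w) < e" if "m \<ge> N" "n \<ge> N" for m n
    proof -
      have "norm (s m w - s n w) \<le> nrm (s m - s n) * t"
        using rnorm_le_point[OF sd[of m n], of w] by (simp add: t_def)
      also have "\<dots> \<le> e / (t + 1) * t" using N[OF that] t by (intro mult_right_mono) auto
      also have "\<dots> < e" using e t by (simp add: field_simps)
      finally show ?thesis .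
    qed
    then show "\<exists>M. \<forall>m\<ge>M. \<forall>n\<ge>M. norm (s m w - s n w) < e" by blast
  qed
  then have "\<exists>l. \<forall>w. (\<lambda>n. s n w) \<longlonglongrightarrow> l w"
    by (intro choice allI) (meson Cauchy_convergent convergentD)
  then obtain l where l: "\<And>w. (\<lambda>n. s n w) \<longlonglongrightarrow> l w" by blast
  have close: "\<exists>N. \<forall>n\<ge>N. rnorm_le (s n - l) e" if e: "e > 0" for e
  proof -
    obtain N where N: "\<And>m n. m \<ge> N \<Longrightarrow> n \<ge> N \<Longrightarrow> nrm (s m - s n) < e" using cau e by blast
    have "rnorm_le (s n - l) e" if n: "n \<ge> N" for n
      unfolding rnorm_le_def
    proof
      fix L
      have 1: "(\<lambda>m. norm (ip0 L (s n - s m))) \<longlonglongrightarrow> norm (ip0 L (s n - l))"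
        by (intro tendsto_norm ip0_tendsto) (auto intro!: tendsto_intros l)
      show "norm (ip0 L (s n - l)) \<le> e * snorm L"
      proof (rule LIMSEQ_le_const2[OF 1], intro exI allI impI)
        fix m assume "m \<ge> N"
        then have "rnorm_le (s n - s m) e" using rnorm_le_mono[OF sd] N[OF n] less_imp_le by blast
        then show "norm (ip0 L (s n - s m)) \<le> e * snorm L" by (rule rnorm_leD)
      qed
    qed
    then show ?thesis by blast
  qed
  have lE: "l \<in> E" unfolding E_def mem_Collect_eq
  proof (intro allI impI)
    fix e :: real assume e: "e > 0"
    then obtain n where n: "rnorm_le (s n - l) (e/2)" using close[of "e/2"] by auto
    obtain L where L: "rnorm_le (\<lambda>w. s n w - kv L w) (e/2)"
      using s[of n] e unfolding E_def mem_Collect_eq by (meson half_gt_zero)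
    from rnorm_le_diff[OF L n] have "rnorm_le (\<lambda>w. l w - kv L w) e" by simp
    then show "\<exists>L. rnorm_le (\<lambda>w. l w - kv L w) e" by blast
  qed
  have "(\<lambda>n. nrm (s n - l)) \<longlonglongrightarrow> 0"
  proof (rule LIMSEQ_I)
    fix e :: real assume e: "e > 0"
    obtain N where N: "\<And>n. n \<ge> N \<Longrightarrow> rnorm_le (s n - l) (e/2)" using close[of "e/2"] e by auto
    have "norm (nrm (s n - l) - 0) < e" if "n \<ge> N" for n
      using nrm_le[OF _ N[OF that]] E_diff[OF s lE, of n] e by (simp add: d)
    then show "\<exists>N. \<forall>n\<ge>N. norm (nrm (s n - l) - 0) < e" by blast
  qed
  then show ?thesis using lE by blast
qed

lemma hilbert_module_H: "hilbert_module H"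
proof -
  have z: "f = 0" if "f \<in> E" "ipE f f = 0" for f
  proof -
    have "rnorm_le f 0" using rnorm_le_nrm[OF that(1)] that(2) by (simp add: nrm_def)
    then have "f w = 0" for w using rnorm_le_point[of f 0 w] by simp
    then show ?thesis by auto
  qed
  have f1: "f + g = (\<lambda>w. f w + g w)" "- f = (\<lambda>w. - f w)" "0 = (\<lambda>_. 0)" for f g :: "'w \<Rightarrow> 'b" by auto
  show ?thesis unfolding hilbert_module_def mnorm_H H_simps
  proof (intro conjI ballI allI impI)
    show "0 \<in> E" using E_zero by (simp add: f1(3)[symmetric])
    show "ipE x (y + z) = ipE x y + ipE x z" if "x \<in> E" "y \<in> E" "z \<in> E" for x y z
      unfolding f1 by (rule ipE_add[OF that])
    show "\<exists>b. ipE x x = star b * b" if "x \<in> E" for x using ipE_pos[OF that] npos_iff by blast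
    show "\<exists>l\<in>E. (\<lambda>n. nrm (s n - l)) \<longlonglongrightarrow> 0"
      if "(\<forall>n. s n \<in> E) \<and> (\<forall>e>0. \<exists>N::nat. \<forall>m\<ge>N. \<forall>n\<ge>N. nrm (s m - s n) < e)" for s
      using H_complete that by blast
    show "ipE y x = star (ipE x y)" if "x \<in> E" "y \<in> E" for x y by (rule ipE_herm[OF that])
    show "x = 0" if "x \<in> E" "ipE x x = 0" for x by (rule z[OF that])
    show "x + y \<in> E" if "x \<in> E" "y \<in> E" for x y unfolding f1(1) by (rule E_add[OF that])
    show "- x \<in> E" if "x \<in> E" for x unfolding f1(2) by (rule E_minus[OF that])
    show "(\<lambda>w. x w * b) \<in> E" if "x \<in> E" for x b by (rule E_mult[OF that])
    show "ipE x (\<lambda>w. y w * b) = ipE x y * b" if "x \<in> E" "y \<in> E" for x y b by (rule ipE_mult[OF that])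
  qed (simp_all only: f1(1) distrib_left distrib_right mult.assoc mult_1_right)
qed

lemma snorm_mapi_le:
  assumes "pos_kernel UNIV (\<lambda>w w'. (C * C) *\<^sub>R K w w' - K (\<tau> w) (\<tau> w'))" "C \<ge> 0"
  shows "snorm (mapi \<tau> L) \<le> C * snorm L"
proof -
  have 1: "lform (\<lambda>w w'. (C * C) *\<^sub>R K w w' - K (\<tau> w) (\<tau> w')) L' M
      = (C * C) *\<^sub>R lform K L' M - lform K (mapi \<tau> L') (mapi \<tau> M)" for L' M
  proof -
    have "(\<Sum>(w', b')\<leftarrow>M. star b * ((C * C) *\<^sub>R K w w' - K (\<tau> w) (\<tau> w')) * b')
      = (C * C) *\<^sub>R (\<Sum>(w', b')\<leftarrow>M. star b * K w w' * b') - (\<Sum>(w', b')\<leftarrow>mapi \<tau> M. star b * K (\<tau> w) w' * b')" for w b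
      by (induction M) (auto simp: mapi_def algebra_simps)
    then show ?thesis unfolding lform_def by (induction L') (auto simp: mapi_def algebra_simps)
  qed
  have "npos ((C * C) *\<^sub>R lform K L L - lform K (mapi \<tau> L) (mapi \<tau> L))"
    using pos_kernel_lform[OF assms(1), of L] by (simp add: 1)
  then have "norm (ip0 (mapi \<tau> L) (kv (mapi \<tau> L))) \<le> norm ((C * C) *\<^sub>R ip0 L (kv L))"
    unfolding ip0_kv[symmetric] by (intro npos_norm_mono ip0_kv_pos)
  then have "(snorm (mapi \<tau> L))\<^sup>2 \<le> (C * snorm L)\<^sup>2"
    by (simp add: snorm_sq power_mult_distrib power2_eq_square ac_simps)
  then show ?thesis by (rule power2_le_imp_le) (simp add: assms(2))
qed

context
  fixes \<tau> \<tau>' :: "'w \<Rightarrow> 'w" and C :: real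
  assumes adj: "\<And>w w'. K (\<tau> w) w' = K w (\<tau>' w')" and C: "C \<ge> 0"
    and bd: "\<And>L. snorm (mapi \<tau> L) \<le> C * snorm L" "\<And>L. snorm (mapi \<tau>' L) \<le> C * snorm L"
begin

lemma kv_mapi: "kv (mapi \<tau> L) w = kv L (\<tau>' w)"
proof -
  have "K w (\<tau> u) = K (\<tau>' w) u" for u
    by (metis adj K_herm)
  then show ?thesis by (induction L) (auto simp: mapi_def)
qed

lemma rnorm_le_shift:
  assumes "rnorm_le f t" "t \<ge> 0"
  shows "rnorm_le (\<lambda>w. f (\<tau>' w)) (C * t)"
  unfolding rnorm_le_def ip0_mapi[symmetric]
proof
  fix L
  have "norm (ip0 (mapi \<tau>' L) f) \<le> t * snorm (mapi \<tau>' L)" using assms(1) by (rule rnorm_leD)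
  also have "\<dots> \<le> t * (C * snorm L)" by (intro mult_left_mono bd assms)
  finally show "norm (ip0 (mapi \<tau>' L) f) \<le> C * t * snorm L" by (simp add: ac_simps)
qed

lemma apx_shift:
  assumes "apx Ls f"
  shows "apx (\<lambda>n. mapi \<tau> (Ls n)) (\<lambda>w. f (\<tau>' w))"
  unfolding apx_def
proof (intro allI impI)
  fix e :: real assume e: "e > 0"
  have C1: "C + 1 > 0" using C by simp
  then have "\<forall>\<^sub>F n in sequentially. rnorm_le (\<lambda>w. f w - kv (Ls n) w) (e / (C + 1))"
    using assms e by (simp add: apx_def)
  then show "\<forall>\<^sub>F n in sequentially. rnorm_le (\<lambda>w. f (\<tau>' w) - kv (mapi \<tau> (Ls n)) w) e"
  proof eventually_elim
    case (elim n)
    have "C * (e / (C + 1)) \<le> e" using e C1 by (simp add: field_simps)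
    then show ?case using rnorm_le_mono[OF rnorm_le_shift[OF elim]] e C1 by (simp add: kv_mapi)
  qed
qed

lemma E_shift: "f \<in> E \<Longrightarrow> (\<lambda>w. f (\<tau>' w)) \<in> E"
  using apx_exists apx_shift apx_E by blast

lemma nrm_shift: "f \<in> E \<Longrightarrow> nrm (\<lambda>w. f (\<tau>' w)) \<le> C * nrm f"
  by (rule nrm_le[OF E_shift rnorm_le_shift[OF rnorm_le_nrm]]) (simp_all add: C)

end

lemma ipE_shift:
  assumes adj: "\<And>w w'. K (\<tau> w) w' = K w (\<tau>' w')" and C: "C \<ge> 0"
    and bd: "\<And>L. snorm (mapi \<tau> L) \<le> C * snorm L" "\<And>L. snorm (mapi \<tau>' L) \<le> C * snorm L"
    and fg: "f \<in> E" "g \<in> E"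
  shows "ipE (\<lambda>w. f (\<tau>' w)) g = ipE f (\<lambda>w. g (\<tau> w))"
proof -
  have adj': "K (\<tau>' w) w' = K w (\<tau> w')" for w w' by (metis adj K_herm)
  obtain Ls where L: "apx Ls f" using apx_exists fg by blast
  have "(\<lambda>n. ip0 (mapi \<tau> (Ls n)) g) \<longlonglongrightarrow> ipE (\<lambda>w. f (\<tau>' w)) g"
    by (rule ipE_lim[OF apx_shift[OF adj C bd L] fg(2)])
  moreover have "(\<lambda>n. ip0 (mapi \<tau> (Ls n)) g) \<longlonglongrightarrow> ipE f (\<lambda>w. g (\<tau> w))"
    unfolding ip0_mapi by (rule ipE_lim[OF L E_shift[OF adj' C bd(2,1) fg(2)]])
  ultimately show ?thesis using LIMSEQ_unique by blast
qed

lemma adjointable_shift: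
  assumes adj: "\<And>w w'. K (\<tau> w) w' = K w (\<tau>' w')" and C: "C \<ge> 0"
    and bd: "\<And>L. snorm (mapi \<tau> L) \<le> C * snorm L" "\<And>L. snorm (mapi \<tau>' L) \<le> C * snorm L"
  shows "adjointable H (\<lambda>f w. f (\<tau>' w))"
proof -
  have adj': "K (\<tau>' w) w' = K w (\<tau> w')" for w w' by (metis adj K_herm)
  show ?thesis unfolding adjointable_def mnorm_H H_simps
  proof (intro conjI exI[of _ "\<lambda>f w. f (\<tau> w)"] exI[of _ C] ballI)
    show "(\<lambda>w. x (\<tau>' w)) \<in> E" if "x \<in> E" for x by (rule E_shift[OF adj C bd that])
    show "(\<lambda>w. x (\<tau> w)) \<in> E" if "x \<in> E" for x by (rule E_shift[OF adj' C bd(2,1) that])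
    show "ipE (\<lambda>w. x (\<tau>' w)) y = ipE x (\<lambda>w. y (\<tau> w))" if "x \<in> E" "y \<in> E" for x y
      by (rule ipE_shift[OF adj C bd that])
    show "nrm (\<lambda>w. x (\<tau>' w)) \<le> C * nrm x" if "x \<in> E" for x by (rule nrm_shift[OF adj C bd that])
  qed
qed

lemma E_relation:
  assumes "\<And>w. K u w = c *\<^sub>C K u1 w + d *\<^sub>C K u2 w" "f \<in> E"
  shows "f u = c *\<^sub>C f u1 + d *\<^sub>C f u2"
proof -
  obtain Ls where L: "apx Ls f" using apx_exists assms by blast
  have e: "c *\<^sub>C x = x * (c *\<^sub>C 1)" for c and x :: 'b by (rule scaleC_conv_mult)
  have kv: "kv L u = c *\<^sub>C kv L u1 + d *\<^sub>C kv L u2" for L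
    by (induction L) (auto simp: assms(1) scaleC_add_right mult_scaleC_left algebra_simps)
  have "(\<lambda>n. kv (Ls n) u) \<longlonglongrightarrow> c *\<^sub>C f u1 + d *\<^sub>C f u2"
    unfolding kv e[of _ "kv _ _"] e[of _ "f _"] by (intro tendsto_intros apx_point L)
  then show ?thesis using apx_point[OF L] LIMSEQ_unique by blast
qed

end

section \<open>The kernel of a joint representation\<close>

definition star_action :: "('w \<Rightarrow> 'w \<Rightarrow> 'b::unital_cstar_algebra) \<Rightarrow> ('a::unital_cstar_algebra \<Rightarrow> 'w \<Rightarrow> 'w) \<Rightarrow> bool" where
  "star_action K \<alpha> \<longleftrightarrow>
     (\<forall>a w w'. K (\<alpha> a w) w' = K w (\<alpha> (star a) w')) \<and>
     (\<forall>a b w w'. K w (\<alpha> (a + b) w') = K w (\<alpha> a w') + K w (\<alpha> b w')) \<and>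
     (\<forall>c a w w'. K w (\<alpha> (c *\<^sub>C a) w') = c *\<^sub>C K w (\<alpha> a w')) \<and>
     (\<forall>a b w w'. K w (\<alpha> (a * b) w') = K w (\<alpha> a (\<alpha> b w'))) \<and>
     (\<forall>w w'. K w (\<alpha> 1 w') = K w w')"

context
  fixes E :: "('b::unital_cstar_algebra, 'e::ab_group_add) hmodule"
  assumes HM: "hilbert_module E"
begin

lemmas hilbert_module_conjs = HM[unfolded hilbert_module_def]

lemma ip_npos: "x \<in> mcarrier E \<Longrightarrow> npos (ip E x x)"
  unfolding npos_iff by (rule hilbert_module_conjs[THEN conjunct2, THEN conjunct2, THEN conjunct2, THEN conjunct2, THEN conjunct2, THEN conjunct2, THEN conjunct2, THEN conjunct2, THEN conjunct2, THEN conjunct2, THEN conjunct2, THEN conjunct1, rule_format])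

lemmas hilbert_moduleD =
  hilbert_module_conjs[THEN conjunct1, rule_format]
  hilbert_module_conjs[THEN conjunct2, THEN conjunct1, rule_format]
  hilbert_module_conjs[THEN conjunct2, THEN conjunct2, THEN conjunct1, rule_format]
  hilbert_module_conjs[THEN conjunct2, THEN conjunct2, THEN conjunct2, THEN conjunct1, rule_format]
  hilbert_module_conjs[THEN conjunct2, THEN conjunct2, THEN conjunct2, THEN conjunct2, THEN conjunct1, rule_format]
  hilbert_module_conjs[THEN conjunct2, THEN conjunct2, THEN conjunct2, THEN conjunct2, THEN conjunct2, THEN conjunct1, rule_format]
  hilbert_module_conjs[THEN conjunct2, THEN conjunct2, THEN conjunct2, THEN conjunct2, THEN conjunct2, THEN conjunct2, THEN conjunct1, rule_format]
  hilbert_module_conjs[THEN conjunct2, THEN conjunct2, THEN conjunct2, THEN conjunct2, THEN conjunct2, THEN conjunct2, THEN conjunct2, THEN conjunct1, rule_format]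
  hilbert_module_conjs[THEN conjunct2, THEN conjunct2, THEN conjunct2, THEN conjunct2, THEN conjunct2, THEN conjunct2, THEN conjunct2, THEN conjunct2, THEN conjunct1, rule_format]
  hilbert_module_conjs[THEN conjunct2, THEN conjunct2, THEN conjunct2, THEN conjunct2, THEN conjunct2, THEN conjunct2, THEN conjunct2, THEN conjunct2, THEN conjunct2, THEN conjunct1, rule_format]
  ip_npos
  hilbert_module_conjs[THEN conjunct2, THEN conjunct2, THEN conjunct2, THEN conjunct2, THEN conjunct2, THEN conjunct2, THEN conjunct2, THEN conjunct2, THEN conjunct2, THEN conjunct2, THEN conjunct2, THEN conjunct2, THEN conjunct1, rule_format]

lemmas ip_hermitian = hilbert_module_conjs[THEN conjunct2, THEN conjunct2, THEN conjunct2, THEN conjunct2, THEN conjunct2, THEN conjunct2, THEN conjunct2, THEN conjunct2, THEN conjunct2, THEN conjunct2, THEN conjunct1, rule_format]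

lemma mcarrier_diff: "x \<in> mcarrier E \<Longrightarrow> y \<in> mcarrier E \<Longrightarrow> x - y \<in> mcarrier E"
  using hilbert_moduleD(2)[OF _ hilbert_moduleD(3)] by (metis diff_conv_add_uminus)

lemma mcarrier_sum: "(\<And>i. i \<in> I \<Longrightarrow> f i \<in> mcarrier E) \<Longrightarrow> (\<Sum>i\<in>I. f i) \<in> mcarrier E"
  by (induction I rule: infinite_finite_induct) (auto intro: hilbert_moduleD(1,2))

lemma ip_add_left: "x \<in> mcarrier E \<Longrightarrow> y \<in> mcarrier E \<Longrightarrow> z \<in> mcarrier E \<Longrightarrow> ip E (x + y) z = ip E x z + ip E y z"
  using ip_hermitian[of z "x + y"] ip_hermitian[of z x] ip_hermitian[of z y] hilbert_moduleD(2)[of x y] hilbert_moduleD(9)[of z x y]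
  by (simp add: star_add)

lemma ip_act_left: "x \<in> mcarrier E \<Longrightarrow> y \<in> mcarrier E \<Longrightarrow> ip E (act E x b) y = star b * ip E x y"
  using ip_hermitian[of y "act E x b"] ip_hermitian[of y x] hilbert_moduleD(4)[of x b] hilbert_moduleD(10)[of y x b]
  by (simp add: star_mult)

lemma ip_zero: "x \<in> mcarrier E \<Longrightarrow> ip E x 0 = 0" "x \<in> mcarrier E \<Longrightarrow> ip E 0 x = 0"
  using hilbert_moduleD(9)[of x 0 0] ip_add_left[of 0 0 x] hilbert_moduleD(1) by simp_all

lemma ip_minus:
  assumes "x \<in> mcarrier E" "y \<in> mcarrier E"
  shows "ip E x (- y) = - ip E x y" "ip E (- x) y = - ip E x y"
proof -
  have "ip E x y + ip E x (- y) = 0" "ip E x y + ip E (- x) y = 0"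
    using hilbert_moduleD(9)[OF assms hilbert_moduleD(3)[OF assms(2)]] ip_add_left[OF assms(1) hilbert_moduleD(3)[OF assms(1)] assms(2)]
      ip_zero assms by simp_all
  then show "ip E x (- y) = - ip E x y" "ip E (- x) y = - ip E x y"
    by (simp_all only: add_eq_0_iff)
qed

lemma ip_diff: "x \<in> mcarrier E \<Longrightarrow> y \<in> mcarrier E \<Longrightarrow> z \<in> mcarrier E \<Longrightarrow> ip E x (y - z) = ip E x y - ip E x z"
  "x \<in> mcarrier E \<Longrightarrow> y \<in> mcarrier E \<Longrightarrow> z \<in> mcarrier E \<Longrightarrow> ip E (x - y) z = ip E x z - ip E y z"
  using hilbert_moduleD(9)[of x y "- z"] ip_add_left[of x "- y" z] hilbert_moduleD(3)[of y] hilbert_moduleD(3)[of z] ip_minus[of x z] ip_minus[of y z]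
  by simp_all

lemma ip_sum: "x \<in> mcarrier E \<Longrightarrow> (\<And>i. i \<in> I \<Longrightarrow> f i \<in> mcarrier E) \<Longrightarrow> ip E x (\<Sum>i\<in>I. f i) = (\<Sum>i\<in>I. ip E x (f i))"
  "x \<in> mcarrier E \<Longrightarrow> (\<And>i. i \<in> I \<Longrightarrow> f i \<in> mcarrier E) \<Longrightarrow> ip E (\<Sum>i\<in>I. f i) x = (\<Sum>i\<in>I. ip E (f i) x)"
  by (induction I rule: infinite_finite_induct) (auto simp: ip_zero hilbert_moduleD mcarrier_sum ip_add_left)

lemma mcarrier_eqI:
  assumes "x \<in> mcarrier E" "y \<in> mcarrier E" "\<And>z. z \<in> mcarrier E \<Longrightarrow> ip E z x = ip E z y"
  shows "x = y"
proof -
  have "ip E (x - y) (x - y) = 0" using assms by (simp add: ip_diff mcarrier_diff)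
  then show ?thesis using hilbert_moduleD(12)[OF mcarrier_diff] assms by auto
qed

lemma act_zero_left: "act E 0 b = 0"
  by (rule mcarrier_eqI) (simp_all add: hilbert_moduleD ip_zero)

lemma act_zero_right: "x \<in> mcarrier E \<Longrightarrow> act E x 0 = 0"
  by (rule mcarrier_eqI) (simp_all add: hilbert_moduleD ip_zero)

lemma act_diff_left: "x \<in> mcarrier E \<Longrightarrow> y \<in> mcarrier E \<Longrightarrow> act E (x - y) b = act E x b - act E y b"
  by (rule mcarrier_eqI) (simp_all add: hilbert_moduleD mcarrier_diff ip_diff left_diff_distrib)

lemma act_minus_right: "x \<in> mcarrier E \<Longrightarrow> act E x (- b) = - act E x b"
  by (rule mcarrier_eqI) (simp_all add: hilbert_moduleD ip_minus)

lemma act_sum_left: "(\<And>i. i \<in> I \<Longrightarrow> f i \<in> mcarrier E) \<Longrightarrow> act E (\<Sum>i\<in>I. f i) b = (\<Sum>i\<in>I. act E (f i) b)"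
  by (induction I rule: infinite_finite_induct) (auto simp: hilbert_moduleD mcarrier_sum act_zero_left)

lemma qform_ip:
  assumes "\<And>i. i < N \<Longrightarrow> v i \<in> mcarrier E"
  shows "qform N (\<lambda>i j. ip E (v i) (v j)) b = ip E (\<Sum>i<N. act E (v i) (b i)) (\<Sum>i<N. act E (v i) (b i))"
proof -
  have a: "act E (v i) (b i) \<in> mcarrier E" if "i \<in> {..<N}" for i using assms that by (simp add: hilbert_moduleD(4))
  have "ip E (\<Sum>i<N. act E (v i) (b i)) (\<Sum>i<N. act E (v i) (b i))
      = (\<Sum>i<N. \<Sum>j<N. ip E (act E (v i) (b i)) (act E (v j) (b j)))"
    by (subst ip_sum(2)[OF mcarrier_sum[OF a] a], assumption+, intro sum.cong refl ip_sum(1) a)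
  also have "\<dots> = qform N (\<lambda>i j. ip E (v i) (v j)) b"
    unfolding qform_def
  proof (intro sum.cong refl)
    fix i j assume "i \<in> {..<N}" "j \<in> {..<N}"
    then have "v i \<in> mcarrier E" "v j \<in> mcarrier E" using assms by auto
    then show "ip E (act E (v i) (b i)) (act E (v j) (b j)) = star (b i) * ip E (v i) (v j) * b j"
      by (simp add: hilbert_moduleD(4,10) ip_act_left)
  qed
  finally show ?thesis by simp
qed

lemma posform_ip:
  assumes "\<And>i. i < N \<Longrightarrow> v i \<in> mcarrier E"
  shows "posform N (\<lambda>i j. ip E (v i) (v j))"
  unfolding posform_def
  by (intro allI, subst qform_ip) (use assms in \<open>auto intro!: ip_npos mcarrier_sum hilbert_moduleD(4)\<close>)

context
  fixes \<sigma> :: "'a::unital_cstar_algebra \<Rightarrow> 'e \<Rightarrow> 'e"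
  assumes S: "unital_star_hom E \<sigma>"
begin

lemmas star_hom_conjs = S[unfolded unital_star_hom_def adjointable_def mscale_def]

lemmas star_homD =
  star_hom_conjs[THEN conjunct1, THEN spec, THEN conjunct1, rule_format]
  star_hom_conjs[THEN conjunct2, THEN conjunct1, rule_format]
  star_hom_conjs[THEN conjunct2, THEN conjunct2, THEN conjunct1, rule_format]
  star_hom_conjs[THEN conjunct2, THEN conjunct2, THEN conjunct2, THEN conjunct1, rule_format]
  star_hom_conjs[THEN conjunct2, THEN conjunct2, THEN conjunct2, THEN conjunct2, THEN conjunct1, rule_format]
  star_hom_conjs[THEN conjunct2, THEN conjunct2, THEN conjunct2, THEN conjunct2, THEN conjunct2, rule_format, symmetric]

lemma star_hom_add: "x \<in> mcarrier E \<Longrightarrow> y \<in> mcarrier E \<Longrightarrow> \<sigma> a (x + y) = \<sigma> a x + \<sigma> a y"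
  by (rule mcarrier_eqI) (simp_all add: hilbert_moduleD(2,9) star_homD(1,6))

lemma star_hom_act: "x \<in> mcarrier E \<Longrightarrow> \<sigma> a (act E x b) = act E (\<sigma> a x) b"
  by (rule mcarrier_eqI) (simp_all add: hilbert_moduleD star_homD(1,6))

lemma star_hom_zero: "\<sigma> a 0 = 0"
  by (rule mcarrier_eqI) (simp_all add: hilbert_moduleD ip_zero star_homD(1,6))

lemma star_hom_sum: "(\<And>i. i \<in> I \<Longrightarrow> f i \<in> mcarrier E) \<Longrightarrow> \<sigma> a (\<Sum>i\<in>I. f i) = (\<Sum>i\<in>I. \<sigma> a (f i))"
  by (induction I rule: infinite_finite_induct) (auto simp: mcarrier_sum star_hom_add star_hom_zero)

lemma star_action_ip:
  assumes u: "\<And>w. u w \<in> mcarrier E" and \<alpha>: "\<And>a w. u (\<alpha> a w) = \<sigma> a (u w)"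
  shows "star_action (\<lambda>w w'. ip E (u w) (u w')) \<alpha>"
  unfolding star_action_def \<alpha>
proof (intro conjI allI)
  fix a b c w w'
  show "ip E (\<sigma> a (u w)) (u w') = ip E (u w) (\<sigma> (star a) (u w'))"
    using star_homD(6)[OF u u, of w "star a" w'] by (simp add: star_star)
  show "ip E (u w) (\<sigma> (a + b) (u w')) = ip E (u w) (\<sigma> a (u w')) + ip E (u w) (\<sigma> b (u w'))"
    by (simp add: star_homD(2) u star_homD(1) hilbert_moduleD(9))
  show "ip E (u w) (\<sigma> (c *\<^sub>C a) (u w')) = c *\<^sub>C ip E (u w) (\<sigma> a (u w'))"
    by (simp add: star_homD(3) u star_homD(1) hilbert_moduleD(10) mult_scaleC_right)
qed (simp_all add: star_homD(4,5) u)

end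

end

text \<open>The kernel of a joint representation: \<open>K w w' = \<langle>w x, w' x\<rangle>\<close> for words \<open>w\<close>, \<open>w'\<close>.\<close>

definition joint_kernel :: "('a::unital_cstar_algebra \<Rightarrow> 'b::unital_cstar_algebra) \<Rightarrow> ('a \<Rightarrow> 'b) \<Rightarrow>
    (('a + 'a) list \<Rightarrow> ('a + 'a) list \<Rightarrow> 'b) \<Rightarrow> bool" where
  "joint_kernel \<phi>1 \<phi>2 K \<longleftrightarrow> pos_kernel UNIV K \<and>
     star_action K (\<lambda>a. (#) (Inl a)) \<and> star_action K (\<lambda>a. (#) (Inr a)) \<and>
     K [] [] = 1 \<and> (\<forall>a. K [] [Inl a] = \<phi>1 a) \<and> (\<forall>a. K [] [Inr a] = \<phi>2 a)"

definition cb_kernel :: "real \<Rightarrow> nat \<Rightarrow> (nat \<Rightarrow> nat \<Rightarrow> 'a::unital_cstar_algebra) \<Rightarrow>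
    (('a + 'a) list \<Rightarrow> ('a + 'a) list \<Rightarrow> 'b::unital_cstar_algebra) \<Rightarrow>
    ('a + 'a) list \<times> nat \<Rightarrow> ('a + 'a) list \<times> nat \<Rightarrow> 'b" where
  "cb_kernel c n X K = (\<lambda>(w, j) (w', j').
     (if j = j' then (c * c) *\<^sub>R K w w' else 0) -
     (\<Sum>i<n. K (Inl (X i j) # w) (Inl (X i j') # w') - K (Inl (X i j) # w) (Inr (X i j') # w')
          - K (Inr (X i j) # w) (Inl (X i j') # w') + K (Inr (X i j) # w) (Inr (X i j') # w')))"

text \<open>The operator inequality \<open>(\<sigma>1 - \<sigma>2)\<^sub>n(X)\<^sup>* (\<sigma>1 - \<sigma>2)\<^sub>n(X) \<le> c\<^sup>2\<close>, tested on combinations of the \<open>w x\<close>.\<close>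

definition cb_bounded :: "real \<Rightarrow> (('a::unital_cstar_algebra + 'a) list \<Rightarrow> ('a + 'a) list \<Rightarrow> 'b::unital_cstar_algebra) \<Rightarrow> bool" where
  "cb_bounded c K \<longleftrightarrow> (\<forall>n X. mat_norm n X \<le> 1 \<longrightarrow> pos_kernel (UNIV \<times> {..<n}) (cb_kernel c n X K))"

primrec word_vec :: "('a \<Rightarrow> 'e \<Rightarrow> 'e) \<Rightarrow> ('a \<Rightarrow> 'e \<Rightarrow> 'e) \<Rightarrow> 'e \<Rightarrow> ('a + 'a) list \<Rightarrow> 'e" where
  "word_vec \<sigma>1 \<sigma>2 x [] = x"
| "word_vec \<sigma>1 \<sigma>2 x (l # w) = (case l of Inl a \<Rightarrow> \<sigma>1 a (word_vec \<sigma>1 \<sigma>2 x w) | Inr a \<Rightarrow> \<sigma>2 a (word_vec \<sigma>1 \<sigma>2 x w))"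

context
  fixes E :: "('b::unital_cstar_algebra, 'e::ab_group_add) hmodule"
    and \<phi>1 \<phi>2 :: "'a::unital_cstar_algebra \<Rightarrow> 'b" and \<sigma>1 \<sigma>2 :: "'a \<Rightarrow> 'e \<Rightarrow> 'e" and x :: 'e
  assumes J: "joint_rep \<phi>1 \<phi>2 E \<sigma>1 \<sigma>2 x"
begin

lemmas joint_rep_conjs = J[unfolded joint_rep_def]

lemmas joint_repD =
  joint_rep_conjs[THEN conjunct1, rule_format]
  joint_rep_conjs[THEN conjunct2, THEN conjunct1, rule_format]
  joint_rep_conjs[THEN conjunct2, THEN conjunct2, THEN conjunct1, rule_format]
  joint_rep_conjs[THEN conjunct2, THEN conjunct2, THEN conjunct2, THEN conjunct1, rule_format]
  joint_rep_conjs[THEN conjunct2, THEN conjunct2, THEN conjunct2, THEN conjunct2, THEN conjunct1, rule_format]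
  joint_rep_conjs[THEN conjunct2, THEN conjunct2, THEN conjunct2, THEN conjunct2, THEN conjunct2, THEN conjunct1, rule_format]
  joint_rep_conjs[THEN conjunct2, THEN conjunct2, THEN conjunct2, THEN conjunct2, THEN conjunct2, THEN conjunct2, rule_format]

private abbreviation "wv \<equiv> word_vec \<sigma>1 \<sigma>2 x"

private lemmas HM = joint_repD(1) and S1 = joint_repD(2) and S2 = joint_repD(3)

lemma wv_carrier: "wv w \<in> mcarrier E"
proof (induction w)
  case (Cons l w)
  then show ?case by (cases l) (simp_all add: star_homD(1)[OF HM S1] star_homD(1)[OF HM S2])
qed (simp add: joint_repD(4))

lemma joint_rep_kernel: "joint_kernel \<phi>1 \<phi>2 (\<lambda>w w'. ip E (wv w) (wv w'))"
proof -
  have "pos_kernel UNIV (\<lambda>w w'. ip E (wv w) (wv w'))"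
    unfolding pos_kernel_def by (intro allI impI posform_ip[OF HM] wv_carrier)
  moreover have "star_action (\<lambda>w w'. ip E (wv w) (wv w')) (\<lambda>a. (#) (Inl a))"
    by (rule star_action_ip[OF HM S1 wv_carrier]) simp
  moreover have "star_action (\<lambda>w w'. ip E (wv w) (wv w')) (\<lambda>a. (#) (Inr a))"
    by (rule star_action_ip[OF HM S2 wv_carrier]) simp
  ultimately show ?thesis unfolding joint_kernel_def using joint_repD(5-7) by simp
qed

private abbreviation "tup N w j b \<equiv> (\<lambda>k. \<Sum>r<N. act E (wv (w r)) (if j r = k then b r else 0))"
private abbreviation "dop X n v \<equiv> (\<lambda>i. \<Sum>k<n. \<sigma>1 (X i k) (v k) - \<sigma>2 (X i k) (v k))"

lemma cb_kernel_identity: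
  fixes N n :: nat and w :: "nat \<Rightarrow> ('a + 'a) list" and b :: "nat \<Rightarrow> 'b"
  assumes j: "\<And>r. r < N \<Longrightarrow> j r < n"
  shows "qform N (\<lambda>r s. cb_kernel c n X (\<lambda>w w'. ip E (wv w) (wv w')) (w r, j r) (w s, j s)) b
    = (c * c) *\<^sub>R (\<Sum>k<n. ip E (tup N w j b k) (tup N w j b k))
      - (\<Sum>i<n. ip E (dop X n (tup N w j b) i) (dop X n (tup N w j b) i))"
proof -
  let ?K = "\<lambda>w w'. ip E (wv w) (wv w')"
  note w = wv_carrier and s1 = star_homD(1)[OF HM S1] and s2 = star_homD(1)[OF HM S2]
  define dv where "dv = (\<lambda>i k r. \<sigma>1 (X i k) (wv (w r)) - \<sigma>2 (X i k) (wv (w r)))"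
  have dvC: "dv i k r \<in> mcarrier E" for i k r unfolding dv_def by (intro mcarrier_diff[OF HM] s1 s2 w)
  have dop: "dop X n (tup N w j b) i = (\<Sum>r<N. act E (dv i (j r) r) (b r))" for i
  proof -
    have "dop X n (tup N w j b) i = (\<Sum>k<n. \<Sum>r<N. act E (dv i k r) (if j r = k then b r else 0))"
      by (simp add: star_hom_sum[OF HM S1] star_hom_sum[OF HM S2] star_hom_act[OF HM S1] star_hom_act[OF HM S2] hilbert_moduleD(4)[OF HM] w
          sum_subtractf[symmetric] dv_def act_diff_left[OF HM] s1 s2)
    also have "\<dots> = (\<Sum>r<N. \<Sum>k<n. if k = j r then act E (dv i k r) (b r) else 0)"
      by (subst sum.swap) (auto intro!: sum.cong simp: act_zero_right[OF HM] dvC)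
    also have "\<dots> = (\<Sum>r<N. act E (dv i (j r) r) (b r))" using j by (intro sum.cong) auto
    finally show ?thesis .
  qed
  have D: "?K (Inl (X i (j r)) # w r) (Inl (X i (j s)) # w s) - ?K (Inl (X i (j r)) # w r) (Inr (X i (j s)) # w s)
          - ?K (Inr (X i (j r)) # w r) (Inl (X i (j s)) # w s) + ?K (Inr (X i (j r)) # w r) (Inr (X i (j s)) # w s)
      = ip E (dv i (j r) r) (dv i (j s) s)" for i r s
    by (simp add: dv_def ip_diff[OF HM] mcarrier_diff[OF HM] s1 s2 w)
  have tt: "(\<Sum>k<n. ip E (tup N w j b k) (tup N w j b k))
      = qform N (\<lambda>r s. if j r = j s then ?K (w r) (w s) else 0) b"
  proof -
    have "ip E (tup N w j b k) (tup N w j b k)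
        = (\<Sum>r<N. \<Sum>s<N. if k = j r \<and> j r = j s then star (b r) * ?K (w r) (w s) * b s else 0)" for k
      unfolding qform_ip[OF HM, of N "\<lambda>r. wv (w r)" "\<lambda>r. if j r = k then b r else 0", OF w, symmetric] qform_def
      by (intro sum.cong) (auto simp: star_zero)
    then have "(\<Sum>k<n. ip E (tup N w j b k) (tup N w j b k))
        = (\<Sum>r<N. \<Sum>s<N. \<Sum>k<n. if k = j r \<and> j r = j s then star (b r) * ?K (w r) (w s) * b s else 0)"
      by (simp only:) (subst sum.swap, intro sum.cong refl sum.swap)
    also have "\<dots> = (\<Sum>r<N. \<Sum>s<N. star (b r) * (if j r = j s then ?K (w r) (w s) else 0) * b s)"
      using j by (intro sum.cong refl) auto
    finally show ?thesis by (simp add: qform_def)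
  qed
  have "qform N (\<lambda>r s. cb_kernel c n X ?K (w r, j r) (w s, j s)) b
      = (c * c) *\<^sub>R qform N (\<lambda>r s. if j r = j s then ?K (w r) (w s) else 0) b
        - (\<Sum>i<n. qform N (\<lambda>r s. ip E (dv i (j r) r) (dv i (j s) s)) b)"
  proof -
    have "qform N (\<lambda>r s. cb_kernel c n X ?K (w r, j r) (w s, j s)) b
       = (\<Sum>r<N. \<Sum>s<N. (c * c) *\<^sub>R (star (b r) * (if j r = j s then ?K (w r) (w s) else 0) * b s)
            - (\<Sum>i<n. star (b r) * ip E (dv i (j r) r) (dv i (j s) s) * b s))"
      unfolding qform_def cb_kernel_def D case_prod_conv
      by (intro sum.cong refl) (auto simp: algebra_simps sum_distrib_left sum_distrib_right)
    also have "\<dots> = (c * c) *\<^sub>R qform N (\<lambda>r s. if j r = j s then ?K (w r) (w s) else 0) b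
        - (\<Sum>r<N. \<Sum>s<N. \<Sum>i<n. star (b r) * ip E (dv i (j r) r) (dv i (j s) s) * b s)"
      by (simp only: qform_def sum_subtractf scaleR_sum_right)
    also have "(\<Sum>r<N. \<Sum>s<N. \<Sum>i<n. star (b r) * ip E (dv i (j r) r) (dv i (j s) s) * b s)
        = (\<Sum>r<N. \<Sum>i<n. \<Sum>s<N. star (b r) * ip E (dv i (j r) r) (dv i (j s) s) * b s)"
      by (intro sum.cong refl sum.swap)
    also have "\<dots> = (\<Sum>i<n. \<Sum>r<N. \<Sum>s<N. star (b r) * ip E (dv i (j r) r) (dv i (j s) s) * b s)"
      by (rule sum.swap)
    finally show ?thesis by (simp only: qform_def)
  qed
  then show ?thesis unfolding tt dop by (simp only: qform_ip[OF HM dvC])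
qed

lemma cb_norm_imp_npos:
  assumes c: "cb_norm E (\<lambda>a v. \<sigma>1 a v - \<sigma>2 a v) \<le> ennreal c" "c \<ge> 0"
    and X: "mat_norm n X \<le> 1" and v: "\<And>k. k < n \<Longrightarrow> v k \<in> mcarrier E"
  shows "npos ((c * c) *\<^sub>R (\<Sum>k<n. ip E (v k) (v k)) - (\<Sum>i<n. ip E (dop X n v i) (dop X n v i)))"
proof -
  note s1 = star_homD(1)[OF HM S1] and s2 = star_homD(1)[OF HM S2]
  have dC: "dop X n v i \<in> mcarrier E" if "\<And>k. k < n \<Longrightarrow> v k \<in> mcarrier E" for i v
    by (intro mcarrier_sum[OF HM] mcarrier_diff[OF HM] s1 s2 that) auto
  define u where "u = (\<Sum>k<n. ip E (v k) (v k))"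
  define t where "t = (\<Sum>i<n. ip E (dop X n v i) (dop X n v i))"
  have u: "npos u" unfolding u_def by (intro npos_sum hilbert_moduleD(11)[OF HM] v) auto
  have t: "npos t" unfolding t_def by (intro npos_sum hilbert_moduleD(11)[OF HM] dC v)
  have main: "npos ((c * c) *\<^sub>R (u + e *\<^sub>R 1) - t)" if e: "e > 0" for e
  proof -
    define P where "P = u + e *\<^sub>R 1"
    obtain w where w: "star w = w" "w * P * w = 1"
      using npos_inverse_sqrt[OF u e] unfolding P_def by blast
    define v' where "v' = (\<lambda>k. act E (v k) w)"
    have v'C: "v' k \<in> mcarrier E" if "k < n" for k using v[OF that] by (simp add: v'_def hilbert_moduleD[OF HM])
    have nv': "(\<Sum>k<n. ip E (v' k) (v' k)) = w * u * w"
      unfolding u_def sum_distrib_left sum_distrib_right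
      using v by (intro sum.cong refl) (simp add: v'_def hilbert_moduleD[OF HM] ip_act_left[OF HM] w(1) mult.assoc)
    have "npos (w * u * w)" using npos_conj[OF u, of w] w(1) by simp
    moreover have "npos (1 *\<^sub>R 1 - w * u * w)"
    proof -
      have "1 *\<^sub>R 1 - w * u * w = e *\<^sub>R (w * w)" using w(2) by (simp add: P_def algebra_simps)
      then show ?thesis using npos_scaleR[OF npos_square[OF w(1)], of e] e by simp
    qed
    ultimately have "norm (w * u * w) \<le> 1" by (intro npos_norm_le) auto
    then have tn: "tuple_norm E n v' \<le> 1" unfolding tuple_norm_def nv' by simp
    have dv': "dop X n v' i = act E (dop X n v i) w" for i
    proof -
      have "dop X n v' i = (\<Sum>k<n. act E (\<sigma>1 (X i k) (v k) - \<sigma>2 (X i k) (v k)) w)"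
        using v by (intro sum.cong refl)
          (simp add: v'_def star_hom_act[OF HM S1] star_hom_act[OF HM S2] act_diff_left[OF HM] s1 s2)
      also have "\<dots> = act E (dop X n v i) w"
        using v by (intro act_sum_left[OF HM, symmetric] mcarrier_diff[OF HM] s1 s2) auto
      finally show ?thesis .
    qed
    have "ennreal (tuple_norm E n (dop X n v')) \<le> mat_op_norm E n (\<lambda>i j v. \<sigma>1 (X i j) v - \<sigma>2 (X i j) v)"
      unfolding mat_op_norm_def by (rule SUP_upper2[of v']) (use v'C tn in auto)
    also have "\<dots> \<le> cb_norm E (\<lambda>a v. \<sigma>1 a v - \<sigma>2 a v)"
      unfolding cb_norm_def by (rule SUP_upper2[of n], simp, rule SUP_upper2[of X]) (use X in auto)
    also have "\<dots> \<le> ennreal c" by (rule c(1))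
    finally have "tuple_norm E n (dop X n v') \<le> c" using c(2) by (simp add: ennreal_le_iff)
    moreover have "(\<Sum>i<n. ip E (dop X n v' i) (dop X n v' i)) = w * t * w"
      unfolding t_def sum_distrib_left sum_distrib_right dv'
      using dC[OF v] by (intro sum.cong refl) (simp add: hilbert_moduleD(4,10)[OF HM] ip_act_left[OF HM] w(1) mult.assoc)
    ultimately have "sqrt (norm (w * t * w)) \<le> c" unfolding tuple_norm_def by simp
    then have "norm (w * t * w) \<le> c * c" using c(2)
      by (metis norm_ge_zero power2_eq_square real_sqrt_ge_zero real_sqrt_pow2 power_mono)
    then have "npos ((c * c) *\<^sub>R 1 - w * t * w)"
      by (intro npos_norm_minus) (simp add: star_mult w(1) npos_star[OF t] mult.assoc)
    from npos_conj[OF this, of "P * w"]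
    have "npos (star (P * w) * ((c * c) *\<^sub>R 1 - w * t * w) * (P * w))" .
    moreover have "star (P * w) * ((c * c) *\<^sub>R 1 - w * t * w) * (P * w) = (c * c) *\<^sub>R P - t"
    proof -
      have Ps: "star P = P" unfolding P_def using npos_star[OF u] by (simp add: star_simps)
      have a: "w * (P * w) = 1" using w(2) by (simp add: mult.assoc)
      have eq: "w * P = P * w" by (metis a mult.assoc mult.left_neutral mult.right_neutral w(2))
      have b: "P * w * (P * w) = P"
        by (metis a eq mult.assoc mult.right_neutral)
      have c: "P * w * (w * t * w) * (P * w) = t"
      proof -
        have "P * w * (w * t * w) * (P * w) = (P * w * w) * t * (w * (P * w))" by (simp only: mult.assoc)
        also have "P * w * w = 1" using eq w(2) by (metis)
        finally show ?thesis by (simp add: a)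
      qed
      have "star (P * w) = P * w" by (simp add: star_mult Ps w(1) eq)
      then show ?thesis using b c by (simp add: right_diff_distrib left_diff_distrib)
    qed
    ultimately show ?thesis by (simp add: P_def)
  qed
  have "npos ((c * c) *\<^sub>R (u + 0 *\<^sub>R 1) - t)"
  proof (rule npos_limit)
    show "(\<lambda>m. (c * c) *\<^sub>R (u + (1 / Suc m) *\<^sub>R 1) - t) \<longlonglongrightarrow> (c * c) *\<^sub>R (u + 0 *\<^sub>R 1) - t"
      by (intro tendsto_intros LIMSEQ_Suc lim_1_over_n)
    show "\<forall>\<^sub>F m in sequentially. npos ((c * c) *\<^sub>R (u + (1 / Suc m) *\<^sub>R 1) - t)"
      by (intro always_eventually allI main) simp
  qed simp
  then show ?thesis by (simp add: u_def t_def)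
qed

lemma joint_rep_cb_bounded:
  assumes c: "cb_norm E (\<lambda>a v. \<sigma>1 a v - \<sigma>2 a v) \<le> ennreal c" "c \<ge> 0"
  shows "cb_bounded c (\<lambda>w w'. ip E (wv w) (wv w'))"
  unfolding cb_bounded_def pos_kernel_def
proof (intro allI impI)
  fix n N and X :: "nat \<Rightarrow> nat \<Rightarrow> 'a" and f :: "nat \<Rightarrow> ('a + 'a) list \<times> nat"
  assume X: "mat_norm n X \<le> 1" and f: "\<forall>i<N. f i \<in> UNIV \<times> {..<n}"
  define w j where "w = fst \<circ> f" and "j = snd \<circ> f"
  have fe: "f r = (w r, j r)" for r by (simp add: w_def j_def)
  have j: "r < N \<Longrightarrow> j r < n" for r using f by (auto simp: j_def mem_Times_iff)
  show "posform N (\<lambda>i k. cb_kernel c n X (\<lambda>w w'. ip E (wv w) (wv w')) (f i) (f k))"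
    unfolding posform_def fe
  proof
    fix b
    have "npos ((c * c) *\<^sub>R (\<Sum>k<n. ip E (tup N w j b k) (tup N w j b k))
      - (\<Sum>i<n. ip E (dop X n (tup N w j b) i) (dop X n (tup N w j b) i)))"
      by (intro cb_norm_imp_npos[OF c X] mcarrier_sum[OF HM] hilbert_moduleD(4)[OF HM] wv_carrier)
    then show "npos (qform N (\<lambda>i k. cb_kernel c n X (\<lambda>w w'. ip E (wv w) (wv w')) (w i, j i) (w k, j k)) b)"
      by (simp only: cb_kernel_identity j)
  qed
qed

end

lemma star_actionD:
  assumes "star_action K \<alpha>"
  shows "K (\<alpha> a w) w' = K w (\<alpha> (star a) w')" "K w (\<alpha> (a + b) w') = K w (\<alpha> a w') + K w (\<alpha> b w')"
    "K w (\<alpha> (c *\<^sub>C a) w') = c *\<^sub>C K w (\<alpha> a w')" "K w (\<alpha> (a * b) w') = K w (\<alpha> a (\<alpha> b w'))"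
    "K w (\<alpha> 1 w') = K w w'"
  using assms unfolding star_action_def by simp_all

text \<open>Writing \<open>|a|\<^sup>2 - a\<^sup>* a\<close> as \<open>s\<^sup>2\<close>, the difference of the kernels is \<open>K (s w) (s w')\<close>.\<close>

lemma star_action_contractive:
  assumes A: "star_action K \<alpha>" and pos: "pos_kernel UNIV K"
  shows "pos_kernel UNIV (\<lambda>w w'. (norm a * norm a) *\<^sub>R K w w' - K (\<alpha> a w) (\<alpha> a w'))"
proof -
  note D = star_actionD[OF A]
  obtain s where s: "star s = s" "star a * a + s * s = (norm a)\<^sup>2 *\<^sub>R 1" using sq_norm_minus_exists by blast
  have "(norm a * norm a) *\<^sub>R K w w' - K (\<alpha> a w) (\<alpha> a w') = K (\<alpha> s w) (\<alpha> s w')" for w w'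
  proof -
    have "K (\<alpha> a w) (\<alpha> a w') + K (\<alpha> s w) (\<alpha> s w') = K w (\<alpha> (star a * a + s * s) w')"
      by (simp only: D(1) D(2) D(4) s(1))
    also have "\<dots> = K w (\<alpha> (complex_of_real ((norm a)\<^sup>2) *\<^sub>C 1) w')" unfolding s(2) scaleC_of_real ..
    also have "\<dots> = (norm a * norm a) *\<^sub>R K w w'"
      unfolding D(3) unfolding D(5) scaleC_of_real power2_eq_square ..
    finally show ?thesis by (simp add: algebra_simps)
  qed
  then show ?thesis using pos unfolding pos_kernel_def by simp
qed

context pos_kernel_space
begin

lemma star_action_snorm:
  assumes "star_action K \<alpha>"
  shows "snorm (mapi (\<alpha> a) L) \<le> norm a * snorm L" "snorm (mapi (\<alpha> (star a)) L) \<le> norm a * snorm L"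
  using snorm_mapi_le[OF star_action_contractive[OF assms pos, of a]]
    snorm_mapi_le[OF star_action_contractive[OF assms pos, of "star a"]] by (simp_all add: norm_star)

lemma star_action_hom:
  assumes A: "star_action K \<alpha>"
  shows "unital_star_hom H (\<lambda>a f w. f (\<alpha> (star a) w))"
proof -
  note D = star_actionD[OF A]
  have D': "K (\<alpha> (star a) w) w' = K w (\<alpha> a w')" for a w w' by (simp add: D(1) star_star)
  note bd = star_action_snorm[OF A]
  show ?thesis unfolding unital_star_hom_def mscale_def H_simps
  proof (intro conjI allI ballI)
    fix a b c f g
    show "adjointable H (\<lambda>f w. f (\<alpha> (star a) w))"
      by (rule adjointable_shift[where \<tau>="\<alpha> a", OF D(1) norm_ge_zero bd])
    assume f: "f \<in> E"
    have "f (\<alpha> (star (a + b)) w) = f (\<alpha> (star a) w) + f (\<alpha> (star b) w)" for w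
      using E_relation[OF _ f, of "\<alpha> (star (a + b)) w" 1 "\<alpha> (star a) w" 1 "\<alpha> (star b) w"]
      by (simp add: D' D(2))
    then show "(\<lambda>w. f (\<alpha> (star (a + b)) w)) = (\<lambda>w. f (\<alpha> (star a) w)) + (\<lambda>w. f (\<alpha> (star b) w))"
      by (simp add: fun_eq_iff)
    have "f (\<alpha> (star (c *\<^sub>C a)) w) = c *\<^sub>C f (\<alpha> (star a) w)" for w
      using E_relation[OF _ f, of "\<alpha> (star (c *\<^sub>C a)) w" c "\<alpha> (star a) w" 0 "\<alpha> (star a) w"]
      by (simp add: D' D(3))
    then show "(\<lambda>w. f (\<alpha> (star (c *\<^sub>C a)) w)) = (\<lambda>w. f (\<alpha> (star a) w) * (c *\<^sub>C 1))"
      by (simp add: fun_eq_iff mult_scaleC_right)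
    have "f (\<alpha> (star (a * b)) w) = f (\<alpha> (star b) (\<alpha> (star a) w))" for w
      using E_relation[OF _ f, of "\<alpha> (star (a * b)) w" 1 "\<alpha> (star b) (\<alpha> (star a) w)" 0 w]
      by (simp add: D' D(4))
    then show "(\<lambda>w. f (\<alpha> (star (a * b)) w)) = (\<lambda>w. f (\<alpha> (star b) (\<alpha> (star a) w)))" by simp
    have "f (\<alpha> (star 1) w) = f w" for w
      using E_relation[OF _ f, of "\<alpha> (star 1) w" 1 w 0 w] by (simp add: D' D(5))
    then show "(\<lambda>w. f (\<alpha> (star 1) w)) = f" by simp
    assume g: "g \<in> E"
    show "ipE (\<lambda>w. f (\<alpha> (star (star a)) w)) g = ipE f (\<lambda>w. g (\<alpha> (star a) w))"
      unfolding star_star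
      by (rule ipE_shift[where \<tau>="\<alpha> (star a)", OF D' norm_ge_zero bd(2,1) f g])
  qed
qed

lemma kv_singleton: "kv [(w, 1)] = (\<lambda>u. K u w)"
  by auto

lemma ipE_kv_singleton: "g \<in> E \<Longrightarrow> ipE (\<lambda>u. K u w) g = g w"
  using ipE_kv[of g "[(w, 1)]"] by (simp add: kv_singleton star_one)

lemma kernel_fun_E: "(\<lambda>u. K u w) \<in> E"
  using kv_E[of "[(w, 1)]"] by (simp add: kv_singleton)

lemma apx_add: "apx Ls f \<Longrightarrow> apx Ms g \<Longrightarrow> apx (\<lambda>n. Ls n @ Ms n) (\<lambda>w. f w + g w)"
  unfolding apx_def
proof (intro allI impI)
  fix e :: real
  assume "\<forall>e>0. \<forall>\<^sub>F n in sequentially. rnorm_le (\<lambda>w. f w - kv (Ls n) w) e"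
    "\<forall>e>0. \<forall>\<^sub>F n in sequentially. rnorm_le (\<lambda>w. g w - kv (Ms n) w) e" "e > 0"
  then have "\<forall>\<^sub>F n in sequentially. rnorm_le (\<lambda>w. f w - kv (Ls n) w) (e / 2)"
    "\<forall>\<^sub>F n in sequentially. rnorm_le (\<lambda>w. g w - kv (Ms n) w) (e / 2)" by (meson half_gt_zero)+
  then show "\<forall>\<^sub>F n in sequentially. rnorm_le (\<lambda>w. f w + g w - kv (Ls n @ Ms n) w) e"
  proof eventually_elim
    case (elim n)
    from rnorm_le_add[OF elim] show ?case by (simp add: algebra_simps)
  qed
qed

lemma apx_minus:
  assumes "apx Ls f"
  shows "apx (\<lambda>n. smulr (Ls n) (-1)) (\<lambda>w. - f w)"
proof -
  have "rnorm_le (\<lambda>w. - f w - kv (smulr (Ls n) (-1)) w) e" if "rnorm_le (\<lambda>w. f w - kv (Ls n) w) e" for n e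
    using rnorm_le_diff[OF rnorm_le_zero that] by (simp add: kv_smulr)
  then show ?thesis using assms unfolding apx_def by (meson eventually_mono)
qed

lemma apx_sum:
  assumes "\<And>k. k < (n::nat) \<Longrightarrow> apx (Ls k) (f k)"
  shows "\<exists>Ms. apx Ms (\<Sum>k<n. f k) \<and> (\<forall>m. kv (Ms m) = (\<Sum>k<n. kv (Ls k m)))"
  using assms
proof (induction n)
  case 0
  have "kv [] = 0" by auto
  then show ?case using apx_kv[of "[]"]
    by (intro exI[of _ "\<lambda>_. []"]) (simp only: lessThan_0 sum.empty simp_thms)
next
  case (Suc n)
  then obtain Ms where Ms: "apx Ms (\<Sum>k<n. f k)" "\<And>m. kv (Ms m) = (\<Sum>k<n. kv (Ls k m))" by auto
  have "(\<lambda>w. (\<Sum>k<n. f k) w + f n w) = (\<Sum>k<Suc n. f k)" by auto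
  then have "apx (\<lambda>m. Ms m @ Ls n m) (\<Sum>k<Suc n. f k)"
    using apx_add[OF Ms(1) Suc.prems[of n]] by simp
  moreover have "kv (Ms m @ Ls n m) = (\<Sum>k<Suc n. kv (Ls k m))" for m
    by (auto simp: Ms(2)[symmetric])
  ultimately show ?case by blast
qed

end

lemma sum_list_concat_nth:
  fixes g :: "'p \<Rightarrow> 'm::comm_monoid_add"
  shows "(\<Sum>r<length (concat (map F [0..<n])). g (concat (map F [0..<n]) ! r)) = (\<Sum>k<n. sum_list (map g (F k)))"
proof -
  have "sum_list (map g (concat (map F [0..<n]))) = (\<Sum>k<n. sum_list (map g (F k)))"
    by (induction n) (auto simp: add.commute)
  then show ?thesis by (simp add: sum_list_sum_nth atLeast0LessThan)
qed

lemma sqrt_norm_le: "norm a \<le> c\<^sup>2 \<Longrightarrow> 0 \<le> c \<Longrightarrow> sqrt (norm a) \<le> c"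
  by (metis real_sqrt_le_iff real_sqrt_unique)

lemma joint_kernel_imp_rep:
  fixes \<phi>1 \<phi>2 :: "'a::unital_cstar_algebra \<Rightarrow> 'b::unital_cstar_algebra"
  assumes J: "joint_kernel \<phi>1 \<phi>2 K"
  shows "\<exists>(E :: ('b, ('a, 'b) rep_space) hmodule) \<sigma>1 \<sigma>2 x. joint_rep \<phi>1 \<phi>2 E \<sigma>1 \<sigma>2 x \<and>
    (\<forall>c\<ge>0. cb_bounded c K \<longrightarrow> cb_norm E (\<lambda>a v. \<sigma>1 a v - \<sigma>2 a v) \<le> ennreal c)"
proof -
  interpret pos_kernel_space K using J by unfold_locales (simp add: joint_kernel_def)
  have A1: "star_action K (\<lambda>a. (#) (Inl a))" and A2: "star_action K (\<lambda>a. (#) (Inr a))"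
    using J by (simp_all add: joint_kernel_def)
  define \<sigma>1 \<sigma>2 :: "'a \<Rightarrow> (('a + 'a) list \<Rightarrow> 'b) \<Rightarrow> ('a + 'a) list \<Rightarrow> 'b"
    where "\<sigma>1 = (\<lambda>a f w. f (Inl (star a) # w))" and "\<sigma>2 = (\<lambda>a f w. f (Inr (star a) # w))"
  define x where "x = (\<lambda>u. K u [])"
  have S1: "unital_star_hom H \<sigma>1" using star_action_hom[OF A1] by (simp add: \<sigma>1_def)
  have S2: "unital_star_hom H \<sigma>2" using star_action_hom[OF A2] by (simp add: \<sigma>2_def)
  have xE: "x \<in> E" unfolding x_def by (rule kernel_fun_E)
  have \<sigma>E: "\<sigma>1 a f \<in> E" "\<sigma>2 a f \<in> E" if "f \<in> E" for a f
    using star_homD(1)[OF hilbert_module_H S1, of f a] star_homD(1)[OF hilbert_module_H S2, of f a] that by simp_all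
  have ipx: "ipE x g = g []" if "g \<in> E" for g using ipE_kv_singleton[OF that] by (simp add: x_def)
  have D': "K (Inl (star a) # w) w' = K w (Inl a # w')" "K (Inr (star a) # w) w' = K w (Inr a # w')" for a w w'
    using star_actionD(1)[OF A1, of "star a"] star_actionD(1)[OF A2, of "star a"] by (simp_all add: star_star)
  have JR: "joint_rep \<phi>1 \<phi>2 H \<sigma>1 \<sigma>2 x"
    unfolding joint_rep_def
    using hilbert_module_H S1 S2 xE J
    by (simp add: ipx \<sigma>E xE joint_kernel_def) (simp add: \<sigma>1_def \<sigma>2_def x_def D')
  have wv: "word_vec \<sigma>1 \<sigma>2 x w = (\<lambda>u. K u w)" for w
    by (induction w) (auto simp: x_def \<sigma>1_def \<sigma>2_def D' split: sum.split)
  have gram: "ipE (word_vec \<sigma>1 \<sigma>2 x w) (word_vec \<sigma>1 \<sigma>2 x w') = K w w'" for w w'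
    unfolding wv by (rule ipE_kv_singleton[OF kernel_fun_E])
  have "cb_norm H (\<lambda>a v. \<sigma>1 a v - \<sigma>2 a v) \<le> ennreal c" if c: "c \<ge> 0" "cb_bounded c K" for c
    unfolding cb_norm_def mat_op_norm_def
  proof (intro SUP_least)
    fix n and X :: "nat \<Rightarrow> nat \<Rightarrow> 'a" and v
    assume X: "X \<in> {X. mat_norm n X \<le> 1}" and v: "v \<in> {v. (\<forall>i<n. v i \<in> mcarrier H) \<and> tuple_norm H n v \<le> 1}"
    define T where "T = (\<lambda>v i. \<Sum>k<n. \<sigma>1 (X i k) (v k) - \<sigma>2 (X i k) (v k))"
    have vE: "v k \<in> E" if "k < n" for k using v that by simp
    have dense: "npos ((c * c) *\<^sub>R (\<Sum>k<n. ipE (kv (L k)) (kv (L k))) - (\<Sum>i<n. ipE (T (\<lambda>k. kv (L k)) i) (T (\<lambda>k. kv (L k)) i)))" for L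
    proof -
      define Z where "Z = concat (map (\<lambda>k. map (\<lambda>(w, b). (w, k, b)) (L k)) [0..<n])"
      define N where "N = length Z"
      define w j b where "w = (\<lambda>r. fst (Z ! r))" and "j = (\<lambda>r. fst (snd (Z ! r)))" and "b = (\<lambda>r. snd (snd (Z ! r)))"
      have j: "j r < n" if "r < N" for r
        using nth_mem[of r Z] that by (auto simp: N_def j_def Z_def)
      have tup: "(\<Sum>r<N. act H (word_vec \<sigma>1 \<sigma>2 x (w r)) (if j r = k then b r else 0)) = kv (L k)" if k: "k < n" for k
      proof -
        let ?g = "\<lambda>(w, k', b). act H (word_vec \<sigma>1 \<sigma>2 x w) (if k' = k then b else 0)"
        have "(\<Sum>r<N. act H (word_vec \<sigma>1 \<sigma>2 x (w r)) (if j r = k then b r else 0)) = (\<Sum>r<N. ?g (Z ! r))"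
          by (intro sum.cong refl) (simp add: w_def j_def b_def case_prod_beta)
        also have "\<dots> = (\<Sum>k'<n. sum_list (map ?g (map (\<lambda>(w, b). (w, k', b)) (L k'))))"
          unfolding N_def Z_def by (rule sum_list_concat_nth)
        also have "\<dots> = (\<Sum>k'<n. if k' = k then kv (L k) else 0)"
        proof (intro sum.cong refl)
          fix k'
          have "sum_list (map ?g (map (\<lambda>(w, b). (w, k', b)) M)) = (if k' = k then kv M else 0)" for M
            by (induction M) (auto simp: wv fun_eq_iff kv_def)
          then show "sum_list (map ?g (map (\<lambda>(w, b). (w, k', b)) (L k'))) = (if k' = k then kv (L k) else 0)"
            by simp
        qed
        also have "\<dots> = kv (L k)" using k by simp
        finally show ?thesis .
      qed
      have "pos_kernel (UNIV \<times> {..<n}) (cb_kernel c n X K)" using c X unfolding cb_bounded_def by simp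
      then have "posform N (\<lambda>r s. cb_kernel c n X K (w r, j r) (w s, j s))"
        unfolding pos_kernel_def using j by auto
      then have "npos (qform N (\<lambda>r s. cb_kernel c n X K (w r, j r) (w s, j s)) b)" by (simp add: posform_def)
      then have "npos ((c * c) *\<^sub>R (\<Sum>k<n. ipE (kv (L k)) (kv (L k)))
          - (\<Sum>i<n. ipE (\<Sum>k<n. \<sigma>1 (X i k) (kv (L k)) - \<sigma>2 (X i k) (kv (L k))) (\<Sum>k<n. \<sigma>1 (X i k) (kv (L k)) - \<sigma>2 (X i k) (kv (L k)))))"
        using cb_kernel_identity[OF JR, of N j n c X w b, OF j]
        by (simp add: gram tup del: H_simps(2) cong: sum.cong_simp)
      then show ?thesis by (simp add: T_def)
    qed
    have "\<forall>k<n. \<exists>Ls. apx Ls (v k)" using apx_exists vE by blast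
    then obtain Ls where Ls: "\<And>k. k < n \<Longrightarrow> apx (Ls k) (v k)" by metis
    define F where "F = (\<lambda>m k. kv (Ls k m))"
    have limT: "(\<lambda>m. ipE (T (F m) i) (T (F m) i)) \<longlonglongrightarrow> ipE (T v i) (T v i)" for i
    proof -
      define Rs where "Rs = (\<lambda>k m. mapi ((#) (Inl (X i k))) (Ls k m) @ smulr (mapi ((#) (Inr (X i k))) (Ls k m)) (-1))"
      have s1: "apx (\<lambda>m. mapi ((#) (Inl a)) (Ms m)) (\<sigma>1 a f)" "apx (\<lambda>m. mapi ((#) (Inr a)) (Ms m)) (\<sigma>2 a f)"
        if "apx Ms f" for a Ms f
        using apx_shift[OF star_actionD(1)[OF A1] norm_ge_zero star_action_snorm[OF A1] that]
          apx_shift[OF star_actionD(1)[OF A2] norm_ge_zero star_action_snorm[OF A2] that]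
        by (simp_all add: \<sigma>1_def \<sigma>2_def)
      have R: "apx (Rs k) (\<sigma>1 (X i k) (v k) - \<sigma>2 (X i k) (v k))" if "k < n" for k
        using apx_add[OF s1(1)[OF Ls[OF that]] apx_minus[OF s1(2)[OF Ls[OF that]]], of "X i k" "X i k"]
        by (simp add: Rs_def fun_diff_def)
      have kR: "kv (Rs k m) = \<sigma>1 (X i k) (F m k) - \<sigma>2 (X i k) (F m k)" for k m
        using kv_mapi[OF star_actionD(1)[OF A1] norm_ge_zero star_action_snorm[OF A1]]
          kv_mapi[OF star_actionD(1)[OF A2] norm_ge_zero star_action_snorm[OF A2]]
        by (auto simp: Rs_def F_def \<sigma>1_def \<sigma>2_def kv_smulr)
      obtain Ms where Ms: "apx Ms (T v i)" "\<And>m. kv (Ms m) = T (F m) i"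
        using apx_sum[of n Rs "\<lambda>k. \<sigma>1 (X i k) (v k) - \<sigma>2 (X i k) (v k)", OF R] unfolding T_def kR by blast
      have "(\<lambda>m. ipE (kv (Ms m)) (kv (Ms m))) \<longlonglongrightarrow> ipE (T v i) (T v i)"
        unfolding ipE_kv[OF kv_E] by (rule ipE_lim2[OF Ms(1,1)])
      then show ?thesis by (simp add: Ms(2))
    qed
    have limv: "(\<lambda>m. ipE (F m k) (F m k)) \<longlonglongrightarrow> ipE (v k) (v k)" if "k < n" for k
      unfolding F_def ipE_kv[OF kv_E] by (rule ipE_lim2[OF Ls[OF that] Ls[OF that]])
    have "npos ((c * c) *\<^sub>R (\<Sum>k<n. ipE (v k) (v k)) - (\<Sum>i<n. ipE (T v i) (T v i)))"
    proof (rule npos_limit)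
      show "(\<lambda>m. (c * c) *\<^sub>R (\<Sum>k<n. ipE (F m k) (F m k)) - (\<Sum>i<n. ipE (T (F m) i) (T (F m) i)))
        \<longlonglongrightarrow> (c * c) *\<^sub>R (\<Sum>k<n. ipE (v k) (v k)) - (\<Sum>i<n. ipE (T v i) (T v i))"
        by (intro tendsto_intros limT limv) auto
      show "\<forall>\<^sub>F m in sequentially. npos ((c * c) *\<^sub>R (\<Sum>k<n. ipE (F m k) (F m k)) - (\<Sum>i<n. ipE (T (F m) i) (T (F m) i)))"
        using dense unfolding F_def by (intro always_eventually allI)
    qed simp
    moreover have TE: "T v i \<in> E" for i
    proof -
      have "T v i \<in> mcarrier H"
        unfolding T_def by (intro mcarrier_sum[OF hilbert_module_H] mcarrier_diff[OF hilbert_module_H]) (auto intro: \<sigma>E vE)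
      then show ?thesis by simp
    qed
    have "npos (\<Sum>i<n. ipE (T v i) (T v i))" by (intro npos_sum ipE_pos TE)
    ultimately have "norm (\<Sum>i<n. ipE (T v i) (T v i)) \<le> norm ((c * c) *\<^sub>R (\<Sum>k<n. ipE (v k) (v k)))"
      by (intro npos_norm_mono)
    also have "\<dots> = (c * c) * norm (\<Sum>k<n. ipE (v k) (v k))" by simp
    also have "\<dots> \<le> (c * c) * 1"
      using v by (intro mult_left_mono) (auto simp: tuple_norm_def)
    finally have "norm (\<Sum>i<n. ipE (T v i) (T v i)) \<le> c\<^sup>2" by (simp add: power2_eq_square)
    then have "tuple_norm H n (T v) \<le> c"
      unfolding tuple_norm_def H_simps using c(1) by (rule sqrt_norm_le)
    then show "ennreal (tuple_norm H n (\<lambda>i. \<Sum>j<n. \<sigma>1 (X i j) (v j) - \<sigma>2 (X i j) (v j))) \<le> ennreal c"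
      unfolding T_def by (rule ennreal_leI)
  qed
  then show ?thesis using JR by blast
qed

section \<open>Limits and existence of joint representations\<close>

primrec word_bound :: "('a::real_normed_vector + 'a) list \<Rightarrow> real" where
  "word_bound [] = 1"
| "word_bound (l # w) = (case l of Inl a \<Rightarrow> norm a * norm a | Inr a \<Rightarrow> norm a * norm a) * word_bound w"

lemma joint_kernel_diag_bound:
  assumes J: "joint_kernel \<phi>1 \<phi>2 K"
  shows "norm (K w w) \<le> word_bound w"
proof (induction w)
  case Nil
  then show ?case using J by (simp add: joint_kernel_def)
next
  case (Cons l w)
  have pos: "pos_kernel UNIV K" and A: "star_action K (\<lambda>a. (#) (Inl a))" "star_action K (\<lambda>a. (#) (Inr a))"
    using J by (simp_all add: joint_kernel_def)
  have *: "norm (K (\<alpha> a w) (\<alpha> a w)) \<le> norm a * norm a * word_bound w" if "star_action K \<alpha>" for \<alpha> and a :: 'a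
  proof -
    have "npos ((norm a * norm a) *\<^sub>R K w w - K (\<alpha> a w) (\<alpha> a w))"
      using pos_kernel_diag[OF star_action_contractive[OF that pos]] by simp
    then have "norm (K (\<alpha> a w) (\<alpha> a w)) \<le> norm ((norm a * norm a) *\<^sub>R K w w)"
      by (intro npos_norm_mono pos_kernel_diag[OF pos]) auto
    also have "\<dots> = norm a * norm a * norm (K w w)" by simp
    also have "\<dots> \<le> norm a * norm a * word_bound w" using Cons by (intro mult_left_mono) auto
    finally show ?thesis .
  qed
  show ?case using *[OF A(1)] *[OF A(2)] by (cases l) auto
qed

lemma joint_kernel_bound:
  assumes J: "joint_kernel \<phi>1 \<phi>2 K"
  shows "norm (K w w') \<le> sqrt (word_bound w * word_bound w')"
proof (rule real_le_rsqrt)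
  have pos: "pos_kernel UNIV K" using J by (simp add: joint_kernel_def)
  have "(norm (K w w'))\<^sup>2 \<le> norm (K w w) * norm (K w' w')" by (rule pos_kernel_cauchy_schwarz[OF pos]) auto
  also have "\<dots> \<le> word_bound w * word_bound w'"
    using joint_kernel_diag_bound[OF J] norm_ge_zero order_trans by (intro mult_mono) blast+
  finally show "(norm (K w w'))\<^sup>2 \<le> word_bound w * word_bound w'" .
qed

lemma gen_limitD:
  assumes "gen_limit \<Psi>"
  shows "Bseq f \<Longrightarrow> Bseq g \<Longrightarrow> \<Psi> (\<lambda>m. f m + g m) = \<Psi> f + \<Psi> g"
    "Bseq f \<Longrightarrow> \<Psi> (\<lambda>m. c *\<^sub>C f m) = c *\<^sub>C \<Psi> f" "\<Psi> (\<lambda>_. b) = b"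
    "(\<And>i j. i < N \<Longrightarrow> j < N \<Longrightarrow> Bseq (\<lambda>m. M m i j)) \<Longrightarrow> \<forall>\<^sub>F m in sequentially. posform N (M m)
      \<Longrightarrow> posform N (\<lambda>i j. \<Psi> (\<lambda>m. M m i j))"
  using assms unfolding gen_limit_def by simp_all

lemma gen_limit_scaleR:
  assumes "gen_limit \<Psi>" "Bseq f"
  shows "\<Psi> (\<lambda>m. r *\<^sub>R f m) = r *\<^sub>R \<Psi> f"
  using gen_limitD(2)[OF assms, of "complex_of_real r"] by (simp add: scaleC_of_real)

lemma gen_limit_diff:
  assumes "gen_limit \<Psi>" "Bseq f" "Bseq g"
  shows "\<Psi> (\<lambda>m. f m - g m) = \<Psi> f - \<Psi> g"
  using gen_limitD(1)[OF assms(1,2) Bseq_scaleR_seq[OF assms(3), of "-1"]]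
    gen_limit_scaleR[OF assms(1,3), of "-1"] by simp

lemma gen_limit_sum:
  assumes "gen_limit \<Psi>" "\<And>k. k \<in> I \<Longrightarrow> Bseq (f k)"
  shows "\<Psi> (\<lambda>m. \<Sum>k\<in>I. f k m) = (\<Sum>k\<in>I. \<Psi> (f k))"
  using assms(2)
  by (induction I rule: infinite_finite_induct)
    (auto simp: gen_limitD(1,3)[OF assms(1)] Bseq_sum_seq)

lemma joint_kernel_limit:
  fixes K :: "nat \<Rightarrow> ('a::unital_cstar_algebra + 'a) list \<Rightarrow> ('a + 'a) list \<Rightarrow> 'b::unital_cstar_algebra"
    and \<Psi> :: "(nat \<Rightarrow> 'b) \<Rightarrow> 'b"
  assumes \<Psi>: "gen_limit \<Psi>" and J: "\<And>m. joint_kernel \<phi>1 \<phi>2 (K m)"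
    and cb: "\<And>e. e > 0 \<Longrightarrow> \<forall>\<^sub>F m in sequentially. cb_bounded (g + e) (K m)"
  shows "\<exists>K'. joint_kernel \<phi>1 \<phi>2 K' \<and> cb_bounded g K'"
proof -
  note G = gen_limitD[OF \<Psi>]
  define K' where "K' = (\<lambda>w w'. \<Psi> (\<lambda>m. K m w w'))"
  have bK: "Bseq (\<lambda>m. K m w w')" for w w'
    by (rule BseqI'[of _ "sqrt (word_bound w * word_bound w')"]) (rule joint_kernel_bound[OF J])
  have pos: "pos_kernel UNIV (K m)" and A: "star_action (K m) (\<lambda>a. (#) (Inl a))" "star_action (K m) (\<lambda>a. (#) (Inr a))"
    and v: "K m [] [] = 1" "K m [] [Inl a] = \<phi>1 a" "K m [] [Inr a] = \<phi>2 a" for m a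
    using J[of m] by (simp_all add: joint_kernel_def)
  have "pos_kernel UNIV K'"
    unfolding pos_kernel_def K'_def
    using pos by (intro allI impI G(4) bK always_eventually) (simp add: pos_kernel_def)
  moreover have act: "star_action K' \<alpha>" if "\<And>m. star_action (K m) \<alpha>" for \<alpha> :: "'a \<Rightarrow> ('a + 'a) list \<Rightarrow> ('a + 'a) list"
    unfolding star_action_def K'_def using star_actionD[OF that] by (simp add: G(1,2) bK)
  ultimately have JK: "joint_kernel \<phi>1 \<phi>2 K'"
    unfolding joint_kernel_def using A v by (auto simp: K'_def G(3))
  have cbK: "cb_kernel c n X K' p q = \<Psi> (\<lambda>m. cb_kernel c n X (K m) p q)"
    and Bcb: "Bseq (\<lambda>m. cb_kernel c n X (K m) p q)" for c n X p q
  proof -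
    obtain w j w' j' where pq: "p = (w, j)" "q = (w', j')" by (metis prod.exhaust)
    have 1: "Bseq (\<lambda>m. if j = j' then (c * c) *\<^sub>R K m w w' else 0)"
      by (cases "j = j'") (simp_all add: Bseq_scaleR_seq bK)
    have 2: "Bseq (\<lambda>m. K m (Inl (X i j) # w) (Inl (X i j') # w') - K m (Inl (X i j) # w) (Inr (X i j') # w')
          - K m (Inr (X i j) # w) (Inl (X i j') # w') + K m (Inr (X i j) # w) (Inr (X i j') # w'))" for i
      by (intro Bseq_seq bK)
    show "Bseq (\<lambda>m. cb_kernel c n X (K m) p q)"
      unfolding cb_kernel_def pq case_prod_conv by (intro Bseq_diff_seq Bseq_sum_seq 1 2)
    have d: "\<Psi> (\<lambda>m. if j = j' then (c * c) *\<^sub>R K m w w' else 0) = (if j = j' then (c * c) *\<^sub>R K' w w' else 0)"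
      by (cases "j = j'") (simp_all add: gen_limit_scaleR[OF \<Psi>] bK G(3) K'_def)
    show "cb_kernel c n X K' p q = \<Psi> (\<lambda>m. cb_kernel c n X (K m) p q)"
      unfolding cb_kernel_def pq case_prod_conv
      unfolding gen_limit_diff[OF \<Psi> 1 Bseq_sum_seq[OF 2]] gen_limit_sum[OF \<Psi> 2] d
      by (simp add: G(1) gen_limit_diff[OF \<Psi>] Bseq_diff_seq bK K'_def)
  qed
  have "cb_bounded g K'"
    unfolding cb_bounded_def pos_kernel_def
  proof (intro allI impI)
    fix n N and X :: "nat \<Rightarrow> nat \<Rightarrow> 'a" and f :: "nat \<Rightarrow> ('a + 'a) list \<times> nat"
    assume X: "mat_norm n X \<le> 1" and f: "\<forall>i<N. f i \<in> UNIV \<times> {..<n}"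
    have e: "posform N (\<lambda>i j. cb_kernel (g + e) n X K' (f i) (f j))" if "e > 0" for e
      unfolding cbK
    proof (intro G(4) Bcb)
      show "\<forall>\<^sub>F m in sequentially. posform N (\<lambda>i j. cb_kernel (g + e) n X (K m) (f i) (f j))"
        using cb[OF that] by eventually_elim (use X f in \<open>auto simp: cb_bounded_def pos_kernel_def\<close>)
    qed
    show "posform N (\<lambda>i j. cb_kernel g n X K' (f i) (f j))"
    proof (rule posform_limit)
      fix i j
      obtain w k w' k' where fe: "f i = (w, k)" "f j = (w', k')" by (metis prod.exhaust)
      have "(\<lambda>m. g + 1 / Suc m) \<longlonglongrightarrow> g + 0"
        by (intro tendsto_intros LIMSEQ_Suc lim_1_over_n)
      then have t: "(\<lambda>m. g + 1 / Suc m) \<longlonglongrightarrow> g" by simp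
      show "(\<lambda>m. cb_kernel (g + 1 / Suc m) n X K' (f i) (f j)) \<longlonglongrightarrow> cb_kernel g n X K' (f i) (f j)"
        unfolding cb_kernel_def fe case_prod_conv
        by (cases "k = k'"; simp only: if_True if_False simp_thms; intro tendsto_intros t)
      show "\<forall>\<^sub>F m in sequentially. posform N (\<lambda>i j. cb_kernel (g + 1 / Suc m) n X K' (f i) (f j))"
        by (intro always_eventually allI e) simp
    qed simp
  qed
  then show ?thesis using JK by blast
qed

lemma UCP_posform:
  assumes "\<phi> \<in> UCP"
  shows "posform N (\<lambda>r s. \<phi> (star (c r) * c s))"
proof -
  have "mat_positive N (\<lambda>r s. star (c r) * c s)"
    unfolding mat_positive_def
  proof (intro exI[of _ "\<lambda>k i. if k = 0 then c i else 0"] allI impI)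
    fix i j assume "i < N" "j < N"
    have "(\<Sum>k<N. star (if k = 0 then c i else 0) * (if k = 0 then c j else 0))
        = (\<Sum>k<N. if k = 0 then star (c i) * c j else 0)" by (intro sum.cong) auto
    also have "\<dots> = star (c i) * c j" using \<open>i < N\<close> by simp
    finally show "star (c i) * c j = (\<Sum>k<N. star (if k = 0 then c i else 0) * (if k = 0 then c j else 0))" ..
  qed
  then show ?thesis using assms unfolding UCP_def by (intro mat_positive_imp_posform) blast
qed

lemma unital_star_hom_conj:
  fixes E :: "('b::unital_cstar_algebra, 'e::ab_group_add) hmodule"
    and \<sigma> :: "'a::unital_cstar_algebra \<Rightarrow> 'e \<Rightarrow> 'e"
  assumes HM: "hilbert_module E" and S: "unital_star_hom E \<sigma>"
    and U: "\<And>f. f \<in> mcarrier E \<Longrightarrow> U f \<in> mcarrier E" "\<And>f. f \<in> mcarrier E \<Longrightarrow> U (U f) = f"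
      "\<And>f g. f \<in> mcarrier E \<Longrightarrow> g \<in> mcarrier E \<Longrightarrow> ip E (U f) g = ip E f (U g)"
  shows "unital_star_hom E (\<lambda>a f. U (\<sigma> a (U f)))"
proof -
  let ?C = "mcarrier E"
  note s = star_homD[OF HM S] and h = hilbert_moduleD[OF HM]
  have Uadd: "U (f + g) = U f + U g" if "f \<in> ?C" "g \<in> ?C" for f g
    by (rule mcarrier_eqI[OF HM]) (use that U in \<open>simp_all add: h(2,9) U(3)[symmetric]\<close>)
  have Uact: "U (act E f b) = act E (U f) b" if "f \<in> ?C" for f b
    by (rule mcarrier_eqI[OF HM]) (use that U in \<open>simp_all add: h(4,10) U(3)[symmetric]\<close>)
  have adj: "ip E (U (\<sigma> (star a) (U f))) g = ip E f (U (\<sigma> a (U g)))" if "f \<in> ?C" "g \<in> ?C" for a f g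
  proof -
    have "ip E (U (\<sigma> (star a) (U f))) g = ip E (\<sigma> (star a) (U f)) (U g)" by (rule U(3)) (use that U s in auto)
    also have "\<dots> = ip E (U f) (\<sigma> a (U g))" by (rule s(6)[symmetric]) (use that U in auto)
    also have "\<dots> = ip E f (U (\<sigma> a (U g)))" by (rule U(3)) (use that U s in auto)
    finally show ?thesis .
  qed
  have norm: "mnorm E (U f) = mnorm E f" if "f \<in> ?C" for f
    using U(3)[of f "U f"] that U by (simp add: mnorm_def)
  show ?thesis unfolding unital_star_hom_def
  proof (intro conjI allI ballI)
    fix a
    obtain K where K: "\<And>f. f \<in> ?C \<Longrightarrow> mnorm E (\<sigma> a f) \<le> K * mnorm E f"
      using S[unfolded unital_star_hom_def adjointable_def, THEN conjunct1, THEN spec, of a] by blast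
    show "adjointable E (\<lambda>f. U (\<sigma> a (U f)))"
      unfolding adjointable_def
    proof (intro conjI exI[of _ "\<lambda>f. U (\<sigma> (star a) (U f))"] exI[of _ K] ballI)
      show "ip E (U (\<sigma> a (U f))) g = ip E f (U (\<sigma> (star a) (U g)))" if "f \<in> ?C" "g \<in> ?C" for f g
        using adj[OF that, of "star a"] by (simp add: star_star)
      show "mnorm E (U (\<sigma> a (U f))) \<le> K * mnorm E f" if "f \<in> ?C" for f
        using K[of "U f"] that U s(1) by (simp add: norm)
    qed (simp_all add: U s(1))
  next
    fix a b c f assume f: "f \<in> ?C"
    show "U (\<sigma> (a + b) (U f)) = U (\<sigma> a (U f)) + U (\<sigma> b (U f))" by (simp add: s(1,2) U(1) f Uadd)
    show "U (\<sigma> (c *\<^sub>C a) (U f)) = mscale E c (U (\<sigma> a (U f)))"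
      by (simp add: s(1,3) U(1) f Uact mscale_def)
    show "U (\<sigma> (a * b) (U f)) = U (\<sigma> a (U (U (\<sigma> b (U f)))))" by (simp add: s(1,4) U(1,2) f)
    show "U (\<sigma> 1 (U f)) = f" by (simp add: s(5) U(1,2) f)
  qed (rule adj)
qed

lemma reflection:
  fixes E :: "('b::unital_cstar_algebra, 'e::ab_group_add) hmodule"
  assumes HM: "hilbert_module E" and d: "d \<in> mcarrier E" "ip E d d = 1 + 1"
  defines "U \<equiv> (\<lambda>f. f - act E d (ip E d f))"
  shows "f \<in> mcarrier E \<Longrightarrow> U f \<in> mcarrier E" "f \<in> mcarrier E \<Longrightarrow> U (U f) = f"
    "f \<in> mcarrier E \<Longrightarrow> g \<in> mcarrier E \<Longrightarrow> ip E (U f) g = ip E f (U g)"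
proof -
  let ?C = "mcarrier E"
  note h = hilbert_moduleD[OF HM]
  show UC: "U f \<in> ?C" if "f \<in> ?C" for f unfolding U_def by (intro mcarrier_diff[OF HM] h(4) d that)
  show "U (U f) = f" if "f \<in> ?C"
  proof -
    have "ip E d (U f) = ip E d f - ip E d d * ip E d f"
      using that d(1) by (simp add: U_def ip_diff[OF HM] h(4,10))
    also have "\<dots> = - ip E d f" unfolding d(2) by (simp only: distrib_right mult_1_left) simp
    finally have "ip E d (U f) = - ip E d f" .
    moreover have e: "U g = g - act E d (ip E d g)" for g by (simp add: U_def)
    ultimately show ?thesis
      unfolding e[of "U f"] using act_minus_right[OF HM d(1)] by (simp add: e[of f])
  qed
  show "ip E (U f) g = ip E f (U g)" if "f \<in> ?C" "g \<in> ?C"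
    using that d by (simp add: U_def ip_diff[OF HM] h(4,10) ip_act_left[OF HM] ip_hermitian[OF HM d(1) that(1)])
qed

text \<open>Conjugate the direct sum of the two GNS representations by the unitary reflection that exchanges
  their cyclic vectors.\<close>

lemma joint_rep_exists:
  fixes \<phi>1 \<phi>2 :: "'a::unital_cstar_algebra \<Rightarrow> 'b::unital_cstar_algebra"
  assumes \<phi>: "\<phi>1 \<in> UCP" "\<phi>2 \<in> UCP"
  shows "\<exists>(E :: ('b, 'a \<times> bool \<Rightarrow> 'b) hmodule) \<sigma>1 \<sigma>2 x. joint_rep \<phi>1 \<phi>2 E \<sigma>1 \<sigma>2 x"
proof -
  define \<phi> where "\<phi> = (\<lambda>i. if i then \<phi>1 else \<phi>2)"
  have \<phi>U: "\<phi> i \<in> UCP" for i using \<phi> by (simp add: \<phi>_def)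
  have \<phi>_add: "\<phi> i (a + b) = \<phi> i a + \<phi> i b" and \<phi>_scale: "\<phi> i (c *\<^sub>C a) = c *\<^sub>C \<phi> i a" and \<phi>_one: "\<phi> i 1 = 1" for i a b c
    using \<phi>U[of i] unfolding UCP_def by auto
  have \<phi>_zero: "\<phi> i 0 = 0" for i using \<phi>_scale[of i 0 0] by simp
  define K :: "'a \<times> bool \<Rightarrow> 'a \<times> bool \<Rightarrow> 'b"
    where "K = (\<lambda>(a, i) (a', i'). if i = i' then \<phi> i (star a * a') else 0)"
  have K: "K (a, i) (a', i') = (if i = i' then \<phi> i (star a * a') else 0)" for a i a' i' by (simp add: K_def)
  have pos: "pos_kernel UNIV K"
    unfolding pos_kernel_def
  proof (intro allI impI)
    fix N and f :: "nat \<Rightarrow> 'a \<times> bool"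
    define c where "c = (\<lambda>i r. if snd (f r) = i then fst (f r) else 0)"
    have "K (f r) (f s) = \<phi> True (star (c True r) * c True s) + \<phi> False (star (c False r) * c False s)" for r s
      by (cases "f r"; cases "f s") (auto simp: K c_def \<phi>_zero star_zero)
    then show "posform N (\<lambda>r s. K (f r) (f s))"
      using posform_add[OF UCP_posform[OF \<phi>U] UCP_posform[OF \<phi>U]] by simp
  qed
  interpret pos_kernel_space K by unfold_locales (rule pos)
  define \<alpha> :: "'a \<Rightarrow> 'a \<times> bool \<Rightarrow> 'a \<times> bool" where "\<alpha> = (\<lambda>a (a', i). (a * a', i))"
  have A: "star_action K \<alpha>"
    unfolding star_action_def
    by (auto simp: \<alpha>_def K star_mult star_star distrib_left distrib_right \<phi>_add mult_scaleC_left mult_scaleC_right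
        \<phi>_scale mult.assoc)
  note HM = hilbert_module_H
  define \<rho> where "\<rho> = (\<lambda>a (f :: 'a \<times> bool \<Rightarrow> 'b) w. f (\<alpha> (star a) w))"
  have R: "unital_star_hom H \<rho>" unfolding \<rho>_def by (rule star_action_hom[OF A])
  define x y where "x = (\<lambda>u. K u (1, True))" and "y = (\<lambda>u. K u (1, False))"
  have xy: "x \<in> mcarrier H" "y \<in> mcarrier H" using kernel_fun_E by (simp_all add: x_def y_def)
  have ev: "ip H x g = g (1, True)" "ip H y g = g (1, False)" if "g \<in> mcarrier H" for g
    using ipE_kv_singleton that by (simp_all add: x_def y_def)
  have v: "ip H x x = 1" "ip H y y = 1" "ip H x y = 0" "ip H y x = 0"
    unfolding ev[OF xy(1)] ev[OF xy(2)] by (simp_all add: x_def y_def K star_one \<phi>_one)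
  define d where "d = x - y"
  have d: "d \<in> mcarrier H" unfolding d_def by (rule mcarrier_diff[OF HM xy])
  have dd: "ip H d d = 1 + 1" and dx: "ip H d x = 1"
    unfolding d_def using xy v by (simp_all only: ip_diff[OF HM] mcarrier_diff[OF HM]) simp_all
  define U where "U = (\<lambda>f. f - act H d (ip H d f))"
  have U: "U f \<in> mcarrier H" "U (U f) = f" "g \<in> mcarrier H \<Longrightarrow> ip H (U f) g = ip H f (U g)"
    if "f \<in> mcarrier H" for f g
    using reflection[OF HM d dd, of f] that by (simp_all only: U_def)
  have Ux: "U x = y" unfolding U_def dx hilbert_moduleD(8)[OF HM d] by (simp add: d_def)
  have "\<phi>1 a = ip H x (\<rho> a x)" for a
    using star_homD(1)[OF HM R xy(1), of a] by (simp only: ev) (simp add: \<rho>_def x_def \<alpha>_def K star_star \<phi>_def)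
  moreover have "\<phi>2 a = ip H x (U (\<rho> a (U x)))" for a
  proof -
    have "ip H x (U (\<rho> a (U x))) = ip H y (\<rho> a y)"
      using U(3)[OF xy(1) star_homD(1)[OF HM R xy(2)], of a] by (simp only: Ux)
    also have "\<dots> = \<phi>2 a"
      using star_homD(1)[OF HM R xy(2), of a] by (simp only: ev) (simp add: \<rho>_def y_def \<alpha>_def K star_star \<phi>_def)
    finally show ?thesis ..
  qed
  ultimately have "joint_rep \<phi>1 \<phi>2 H \<rho> (\<lambda>a f. U (\<rho> a (U f))) x"
    unfolding joint_rep_def using HM R unital_star_hom_conj[OF HM R, of U] U xy(1) v(1) by blast
  then show ?thesis by blast
qed

theorem theorem5p3:
  fixes \<phi>1 \<phi>2 :: "'a::unital_cstar_algebra \<Rightarrow> 'b::unital_cstar_algebra"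
  assumes "von_neumann_algebra_on TYPE('g::complex_hilbert_space) TYPE('b) \<or>
           injective_cstar_algebra TYPE('b)"
    and "\<phi>1 \<in> UCP" and "\<phi>2 \<in> UCP"
  shows "(\<exists>(E :: ('b, ('a, 'b) rep_space) hmodule) \<sigma>1 \<sigma>2 x.
            joint_rep \<phi>1 \<phi>2 E \<sigma>1 \<sigma>2 x \<and>
            gamma \<phi>1 \<phi>2 = cb_norm E (\<lambda>a v. \<sigma>1 a v - \<sigma>2 a v)) \<and>
         gamma \<phi>1 \<phi>2 \<le> gamma_over TYPE('e::ab_group_add) \<phi>1 \<phi>2"
proof
  obtain \<Psi> :: "(nat \<Rightarrow> 'b) \<Rightarrow> 'b" where \<Psi>: "gen_limit \<Psi>"
    using assms(1) gen_limit_von_neumann gen_limit_injective by blast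
  have lower: "gamma \<phi>1 \<phi>2 \<le> cb_norm E (\<lambda>a v. \<sigma>1 a v - \<sigma>2 a v)"
    if "joint_rep \<phi>1 \<phi>2 E \<sigma>1 \<sigma>2 x" for E :: "('b, ('a, 'b) rep_space) hmodule" and \<sigma>1 \<sigma>2 x
    unfolding gamma_def gamma_over_def by (rule Inf_lower) (use that in blast)
  show "\<exists>(E :: ('b, ('a, 'b) rep_space) hmodule) \<sigma>1 \<sigma>2 x.
            joint_rep \<phi>1 \<phi>2 E \<sigma>1 \<sigma>2 x \<and> gamma \<phi>1 \<phi>2 = cb_norm E (\<lambda>a v. \<sigma>1 a v - \<sigma>2 a v)"
  proof (cases "gamma \<phi>1 \<phi>2 = top_class.top")
    case True
    obtain E :: "('b, 'a \<times> bool \<Rightarrow> 'b) hmodule" and \<sigma>1 \<sigma>2 x where "joint_rep \<phi>1 \<phi>2 E \<sigma>1 \<sigma>2 x"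
      using joint_rep_exists[OF assms(2,3)] by blast
    from joint_kernel_imp_rep[OF joint_rep_kernel[OF this]]
    obtain E :: "('b, ('a, 'b) rep_space) hmodule" and \<sigma>1 \<sigma>2 x where J: "joint_rep \<phi>1 \<phi>2 E \<sigma>1 \<sigma>2 x" by blast
    then have "gamma \<phi>1 \<phi>2 = cb_norm E (\<lambda>a v. \<sigma>1 a v - \<sigma>2 a v)"
      using lower[OF J] True by (simp add: top_unique)
    with J show ?thesis by blast
  next
    case False
    define g where "g = enn2real (gamma \<phi>1 \<phi>2)"
    have g: "gamma \<phi>1 \<phi>2 = ennreal g" "g \<ge> 0" using False by (simp_all add: g_def less_top)
    have "\<exists>K. joint_kernel \<phi>1 \<phi>2 K \<and> (\<forall>c \<ge> g + 1 / Suc m. cb_bounded c K)" for m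
    proof -
      have "gamma \<phi>1 \<phi>2 < ennreal (g + 1 / Suc m)" unfolding g(1) using g(2) by (intro ennreal_lessI) (auto intro: add_nonneg_pos)
      then obtain E :: "('b, ('a, 'b) rep_space) hmodule" and \<sigma>1 \<sigma>2 x where J: "joint_rep \<phi>1 \<phi>2 E \<sigma>1 \<sigma>2 x"
        and c: "cb_norm E (\<lambda>a v. \<sigma>1 a v - \<sigma>2 a v) < ennreal (g + 1 / Suc m)"
        unfolding gamma_def gamma_over_def Inf_less_iff by blast
      have "cb_bounded c (\<lambda>w w'. ip E (word_vec \<sigma>1 \<sigma>2 x w) (word_vec \<sigma>1 \<sigma>2 x w'))" if "c \<ge> g + 1 / Suc m" for c
      proof (rule joint_rep_cb_bounded[OF J])
        show "cb_norm E (\<lambda>a v. \<sigma>1 a v - \<sigma>2 a v) \<le> ennreal c"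
          using c ennreal_leI[OF that] by (meson less_imp_le order_trans)
        show "c \<ge> 0" using that g(2) by (meson add_nonneg_nonneg order_trans zero_le_divide_1_iff of_nat_0_le_iff)
      qed
      then show ?thesis using joint_rep_kernel[OF J] by blast
    qed
    then obtain K where K: "\<And>m. joint_kernel \<phi>1 \<phi>2 (K m)" "\<And>m c. c \<ge> g + 1 / Suc m \<Longrightarrow> cb_bounded c (K m)" by metis
    have "\<forall>\<^sub>F m in sequentially. cb_bounded (g + e) (K m)" if e: "e > 0" for e
    proof -
      obtain M where M: "1 / Suc M < e" using nat_approx_posE[OF e] by blast
      have "cb_bounded (g + e) (K m)" if "m \<ge> M" for m
      proof (rule K(2))
        have "1 / real (Suc m) \<le> 1 / Suc M" using that by (simp add: frac_le)
        then show "g + 1 / Suc m \<le> g + e" using M by simp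
      qed
      then show ?thesis unfolding eventually_sequentially by blast
    qed
    from joint_kernel_limit[where K=K, OF \<Psi> K(1) this]
    obtain K' where K': "joint_kernel \<phi>1 \<phi>2 K'" "cb_bounded g K'" by blast
    obtain E :: "('b, ('a, 'b) rep_space) hmodule" and \<sigma>1 \<sigma>2 x where J: "joint_rep \<phi>1 \<phi>2 E \<sigma>1 \<sigma>2 x"
      and c: "cb_norm E (\<lambda>a v. \<sigma>1 a v - \<sigma>2 a v) \<le> ennreal g"
      using joint_kernel_imp_rep[OF K'(1)] K'(2) g(2) by blast
    have "gamma \<phi>1 \<phi>2 = cb_norm E (\<lambda>a v. \<sigma>1 a v - \<sigma>2 a v)"
      using c lower[OF J] by (simp add: g(1))
    with J show ?thesis by blast
  qed
  show "gamma \<phi>1 \<phi>2 \<le> gamma_over TYPE('e) \<phi>1 \<phi>2"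
    unfolding gamma_over_def
  proof (rule Inf_greatest)
    fix t assume "t \<in> {cb_norm E (\<lambda>a v. \<sigma>1 a v - \<sigma>2 a v) | (E :: ('b, 'e) hmodule) \<sigma>1 \<sigma>2 x.
            joint_rep \<phi>1 \<phi>2 E \<sigma>1 \<sigma>2 x}"
    then obtain E :: "('b, 'e) hmodule" and \<sigma>1 \<sigma>2 x where J: "joint_rep \<phi>1 \<phi>2 E \<sigma>1 \<sigma>2 x"
      and t: "t = cb_norm E (\<lambda>a v. \<sigma>1 a v - \<sigma>2 a v)" by blast
    show "gamma \<phi>1 \<phi>2 \<le> t"
    proof (cases t)
      case (real c)
      have "cb_bounded c (\<lambda>w w'. ip E (word_vec \<sigma>1 \<sigma>2 x w) (word_vec \<sigma>1 \<sigma>2 x w'))"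
        by (rule joint_rep_cb_bounded[OF J]) (use real t in auto)
      then obtain E' :: "('b, ('a, 'b) rep_space) hmodule" and \<tau>1 \<tau>2 y where J': "joint_rep \<phi>1 \<phi>2 E' \<tau>1 \<tau>2 y"
        and "cb_norm E' (\<lambda>a v. \<tau>1 a v - \<tau>2 a v) \<le> ennreal c"
        using joint_kernel_imp_rep[OF joint_rep_kernel[OF J]] real(1) by blast
      then show ?thesis using order_trans[OF lower[OF J']] real by simp
    qed (simp add: top_greatest)
  qed
qed

end
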